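(* Let $n\geq 1$ and let $I^1,\ldots,I^n\in\mathbb{R}[x^1,\ldots,x^n]$ be algebraically independent, homogeneous, real polynomials in $n$ variables. Let $G$ be the group of linear automorphisms $g\in \mathrm{GL}_n(\mathbb{R})$ of $\mathbb{R}^n$ such that $I^j\circ g=I^j$ for all $j=1,\ldots,n$. Suppose that all the Euclidean gradient cross-products are polynomial in $I^1,\ldots,I^n$, i.e. for all $i,j\in\{1,\ldots,n\}$ there is a polynomial $g^{ij}$ in $n$ variables with real coefficients such that $$\sum_{k=1}^n \frac{\partial I^i}{\partial x^k}\frac{\partial I^j}{\partial x^k} = g^{ij}(I^1,\ldots,I^n).$$ Then $I^1,\ldots,I^n$ freely generate the algebra of $G$-invariants, i.e. $\mathbb{R}[x^1,\ldots,x^n]^G=\mathbb{R}[I^1,\ldots,I^n]$ (and the generators $I^1,\ldots,I^n$ are algebraically independent).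
   Context: The algebra of $G$-invariants $\mathbb{R}[x^1,\ldots,x^n]^G$ consists of all polynomials $p\in\mathbb{R}[x^1,\ldots,x^n]$ with $p\circ g=p$ for every $g\in G$. *)

theory Defs
  imports "HOL-Analysis.Analysis" "HOL-Library.Poly_Mapping"
begin

text \<open>
  Formal real polynomials in the variables \<open>x\<^sup>i\<close>, \<open>i :: 'n\<close>: finitely supported maps from exponent
  vectors to coefficients, with the convolution product of \<^theory>\<open>HOL-Library.Poly_Mapping\<close>.
  The number of variables is \<open>CARD('n)\<close>.
\<close>

type_synonym 'n rpoly = "('n \<Rightarrow>\<^sub>0 nat) \<Rightarrow>\<^sub>0 real"

definition poly_fun :: "('n::finite) rpoly \<Rightarrow> real ^ 'n \<Rightarrow> real" where
  "poly_fun p x =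
     (\<Sum>m\<in>Poly_Mapping.keys p. Poly_Mapping.lookup p m * (\<Prod>i\<in>UNIV. (x $ i) ^ Poly_Mapping.lookup m i))"

text \<open>\<open>poly_subst I P\<close> is the formal polynomial \<open>P(I\<^sup>1, \<dots>, I\<^sup>n)\<close>; \<open>single 0 c\<close> is the constant \<open>c\<close>.\<close>

definition poly_subst :: "('n::finite \<Rightarrow> 'n rpoly) \<Rightarrow> 'n rpoly \<Rightarrow> 'n rpoly" where
  "poly_subst I P =
     (\<Sum>m\<in>Poly_Mapping.keys P. Poly_Mapping.single 0 (Poly_Mapping.lookup P m) *
        (\<Prod>i\<in>UNIV. I i ^ Poly_Mapping.lookup m i))"

text \<open>
  If \<open>x\<^sup>k\<close> does not occur in the monomial \<open>m\<close>, the truncated subtraction leaves \<open>m\<close> unchanged, but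
  the coefficient vanishes.
\<close>

definition poly_partial :: "'n \<Rightarrow> 'n rpoly \<Rightarrow> 'n rpoly" where
  "poly_partial k p =
     (\<Sum>m\<in>Poly_Mapping.keys p. Poly_Mapping.single (m - Poly_Mapping.single k 1)
        (real (Poly_Mapping.lookup m k) * Poly_Mapping.lookup p m))"

definition homogeneous_poly :: "('n::finite) rpoly \<Rightarrow> bool" where
  "homogeneous_poly p \<longleftrightarrow>
     (\<exists>d. \<forall>m\<in>Poly_Mapping.keys p. (\<Sum>i\<in>UNIV. Poly_Mapping.lookup m i) = d)"

definition algebraically_independent :: "('n::finite \<Rightarrow> 'n rpoly) \<Rightarrow> bool" where
  "algebraically_independent I \<longleftrightarrow> (\<forall>P. poly_subst I P = 0 \<longrightarrow> P = 0)"

definition generated_subalgebra :: "('n::finite \<Rightarrow> 'n rpoly) \<Rightarrow> 'n rpoly set" where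
  "generated_subalgebra I = range (poly_subst I)"

definition symmetry_group :: "('n::finite \<Rightarrow> 'n rpoly) \<Rightarrow> (real ^ 'n \<Rightarrow> real ^ 'n) set" where
  "symmetry_group I = {g. linear g \<and> bij g \<and> (\<forall>j. poly_fun (I j) \<circ> g = poly_fun (I j))}"

definition invariant_algebra :: "(real ^ 'n \<Rightarrow> real ^ 'n) set \<Rightarrow> ('n::finite) rpoly set" where
  "invariant_algebra G = {p. \<forall>g\<in>G. poly_fun p \<circ> g = poly_fun p}"

end

theory Submission
  imports Defs "HOL-Probability.Probability"
begin

text \<open>
  Write \<open>Y = (I\<^sup>1, \<dots>, I\<^sup>n)\<close>, \<open>J\<close> for its Jacobian and \<open>A = \<real>[I\<^sup>1, \<dots>, I\<^sup>n]\<close>. By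
  hypothesis \<open>Y\<close> carries the Euclidean cometric to a polynomial cometric \<open>g\<close>, with
  \<open>det g \<circ> Y = (det J)\<^sup>2\<close>. Straight lines in the source with velocity \<open>J(x)\<^sup>T \<xi>\<close> therefore
  project to the geodesics of \<open>g\<close>, so that lines issuing with the same \<open>\<xi>\<close> from two points of
  one fibre have the same image. Hence two points of a regular fibre are exchanged by an affine
  map preserving all \<open>I\<^sup>j\<close>, and by homogeneity by an element of \<open>G\<close>.

  Cramer's rule and Euler's identity express \<open>r\<^sup>2\<close>, and Jacobi's formula the Laplacians
  \<open>\<Delta>I\<^sup>j\<close>, as rational functions of \<open>I\<close>. A pole along a prime \<open>q\<close> would force \<open>q\<close> to divide
  its own brackets, so that \<open>|\<nabla>(q \<circ> Y)|\<^sup>2\<close> would be a multiple of \<open>(q \<circ> Y)\<^sup>2\<close>, which degrees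
  and positivity exclude. So \<open>r\<^sup>2 \<in> A\<close> and \<open>\<Delta>A \<subseteq> A\<close>.

  Subtract from a \<open>G\<close>-invariant form of degree \<open>k\<close> its orthogonal projection onto the degree
  \<open>k\<close> part of \<open>A\<close> with respect to the Gaussian measure. Integration by parts shows that the
  difference \<open>p\<close> is orthogonal to all of \<open>A\<close>, for Gaussians of every width. By
  Stone-Weierstrass \<open>p\<close> is orthogonal to every continuous function of
  \<open>(exp(- r\<^sup>2), exp(- r\<^sup>2) Y)\<close>, and as \<open>p\<close> is constant on regular fibres, \<open>p = 0\<close>.
\<close>

section \<open>Polynomial functions\<close>

text \<open>Nothing is known about G at the outset, not even compactness, so invariants cannot be
  averaged over G; orthogonal projection onto A takes the place of averaging. The projection works
  in one degree, whereas the density argument at the end requires orthogonality to A in all degrees.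
  Multiplication by r^2, which raises degrees, and the Laplacian, which lowers them, connect the
  degrees, and this is why A must be closed under both. The obstacle to both closure statements is
  the denominator det g. The ring of real polynomials is factorial, so a fraction that is not a
  polynomial has a pole along a prime q, and the order of that pole can be followed through
  differentiation. For r^2 the equation |\<nabla>r^2|^2 = 4 r^2 supplies the contradiction; for the
  Laplacians it is the fact that derivatives of a polynomial along straight lines eventually vanish.
  The real image of Y need not fill the target space. Identities in the target variables are
  therefore obtained from algebraic independence. Since Y is unbounded, Stone-Weierstrass is applied
  after damping by exp(-r^2), and each power of this factor narrows the Gaussian; hence the need for
  all widths.\<close>

abbreviation PF :: "('a::euclidean_space \<Rightarrow> real) \<Rightarrow> bool" where
  "PF \<equiv> real_polynomial_function"

text \<open>Fields on an arbitrary Euclidean space are allowed because the geodesic flow below lives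
  on pairs of vectors. Partial derivatives are the constant fields, so the rules of calculus are
  proved once.\<close>

definition lie :: "('a::euclidean_space \<Rightarrow> 'a) \<Rightarrow> ('a \<Rightarrow> real) \<Rightarrow> 'a \<Rightarrow> real" where
  "lie V f z = frechet_derivative f (at z) (V z)"

definition pd :: "'n::finite \<Rightarrow> (real ^ 'n \<Rightarrow> real) \<Rightarrow> real ^ 'n \<Rightarrow> real" where
  "pd k = lie (\<lambda>_. axis k 1)"

lemma PF_has_derivative:
  "PF f \<Longrightarrow> (f has_derivative frechet_derivative f (at x)) (at x)"
  using differentiable_at_real_polynomial_function frechet_derivative_works by blast

lemma PF_continuous: "PF f \<Longrightarrow> continuous_on S f"
  using continuous_on_polymonial_function real_polynomial_function_eq by blast

lemma PF_nth: "PF (\<lambda>x::real^'n. x $ i)"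
  by (auto intro!: real_polynomial_function.intros(1) bounded_linear_vec_nth)

lemma polynomial_function_vec:
  fixes f :: "'a::euclidean_space \<Rightarrow> real^'n"
  assumes "\<And>i. PF (\<lambda>x. f x $ i)"
  shows "polynomial_function f"
  unfolding polynomial_function_iff_Basis_inner
  using assms by (auto simp: Basis_vec_def inner_axis)

lemma PF_compose: "polynomial_function f \<Longrightarrow> PF g \<Longrightarrow> PF (\<lambda>x. g (f x))"
  using real_polynomial_function_compose[of f g] by (simp add: o_def)

lemma polynomial_function_Pair:
  fixes f :: "'a::euclidean_space \<Rightarrow> 'b::euclidean_space" and g :: "'a \<Rightarrow> 'c::euclidean_space"
  assumes "polynomial_function f" "polynomial_function g"
  shows "polynomial_function (\<lambda>x. (f x, g x))"
  using assms unfolding polynomial_function_iff_Basis_inner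
  by (auto simp: Basis_prod_def)

lemma PF_pair_fst: "PF f \<Longrightarrow> PF (\<lambda>z. f (fst z))"
  by (rule PF_compose[OF polynomial_function_bounded_linear[OF bounded_linear_fst]])

lemma PF_pair_snd: "PF g \<Longrightarrow> PF (\<lambda>z. g (snd z))"
  by (rule PF_compose[OF polynomial_function_bounded_linear[OF bounded_linear_snd]])

lemma lie_eqI: "(f has_derivative f') (at z) \<Longrightarrow> lie V f z = f' (V z)"
  by (metis lie_def frechet_derivative_at)

lemma lie_linear: "bounded_linear f \<Longrightarrow> lie V f = (\<lambda>z. f (V z))"
  using bounded_linear_imp_has_derivative by (intro ext lie_eqI) blast

lemma lie_const [simp]: "lie V (\<lambda>z. c) = (\<lambda>z. 0)"
  by (simp add: lie_def fun_eq_iff)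

lemma lie_add: "PF f \<Longrightarrow> PF g \<Longrightarrow> lie V (\<lambda>z. f z + g z) = (\<lambda>z. lie V f z + lie V g z)"
  unfolding lie_def[of V f] lie_def[of V g]
  by (intro ext) (rule lie_eqI[OF has_derivative_add[OF PF_has_derivative PF_has_derivative]])

lemma lie_diff: "PF f \<Longrightarrow> PF g \<Longrightarrow> lie V (\<lambda>z. f z - g z) = (\<lambda>z. lie V f z - lie V g z)"
  unfolding lie_def[of V f] lie_def[of V g]
  by (intro ext) (rule lie_eqI[OF has_derivative_diff[OF PF_has_derivative PF_has_derivative]])

lemma lie_mult: "PF f \<Longrightarrow> PF g \<Longrightarrow> lie V (\<lambda>z. f z * g z) = (\<lambda>z. f z * lie V g z + lie V f z * g z)"
  unfolding lie_def[of V f] lie_def[of V g]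
  by (intro ext) (rule lie_eqI[OF has_derivative_mult[OF PF_has_derivative PF_has_derivative]])

lemma lie_cmult: "PF f \<Longrightarrow> lie V (\<lambda>z. c * f z) = (\<lambda>z. c * lie V f z)"
  by (subst lie_mult) auto

lemma lie_sum: "(\<And>i. i \<in> S \<Longrightarrow> PF (f i)) \<Longrightarrow> lie V (\<lambda>z. \<Sum>i\<in>S. f i z) = (\<lambda>z. \<Sum>i\<in>S. lie V (f i) z)"
  by (induction S rule: infinite_finite_induct) (auto simp: lie_add real_polynomial_function_sum)

lemma lie_power: "PF f \<Longrightarrow> lie V (\<lambda>z. f z ^ n) = (\<lambda>z. real n * f z ^ (n - 1) * lie V f z)"
proof (induction n)
  case (Suc n)
  have "lie V (\<lambda>z. f z ^ Suc n) = (\<lambda>z. f z * lie V (\<lambda>z. f z ^ n) z + lie V f z * f z ^ n)"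
    using Suc.prems by (simp add: lie_mult real_polynomial_function_power)
  then show ?case
    unfolding Suc.IH[OF Suc.prems] by (cases n) (auto simp: fun_eq_iff algebra_simps)
qed auto

lemma PF_lie:
  assumes "PF f" "polynomial_function V"
  shows "PF (lie V f)"
  using assms(1)
proof (induction f rule: real_polynomial_function.induct)
  case (linear f)
  then show ?case using assms(2) by (simp add: lie_linear polynomial_function_def o_def)
next
  case (mult f g)
  then show ?case by (simp add: lie_mult real_polynomial_function.intros(3) real_polynomial_function.intros(4))
qed (simp_all add: lie_add real_polynomial_function.intros)

text \<open>The chain rule for \<open>F\<close>-related fields; the relation is asked for at the
  point \<open>z\<close> only.\<close>

lemma lie_related:
  assumes "PF f" and F: "(F has_derivative F') (at z)" and "F' (V z) = W (F z)"
  shows "lie V (\<lambda>z. f (F z)) z = lie W f (F z)"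
proof -
  have "((\<lambda>z. f (F z)) has_derivative (\<lambda>h. frechet_derivative f (at (F z)) (F' h))) (at z)"
    using diff_chain_at[OF F PF_has_derivative[OF assms(1)]] by (simp add: o_def)
  from lie_eqI[OF this, of V] show ?thesis
    using assms(3) by (simp add: lie_def)
qed

lemma PF_pd: "PF f \<Longrightarrow> PF (pd k f)"
  unfolding pd_def by (rule PF_lie) auto

lemma pd_add: "PF f \<Longrightarrow> PF g \<Longrightarrow> pd k (\<lambda>z. f z + g z) = (\<lambda>z. pd k f z + pd k g z)"
  and pd_diff: "PF f \<Longrightarrow> PF g \<Longrightarrow> pd k (\<lambda>z. f z - g z) = (\<lambda>z. pd k f z - pd k g z)"
  and pd_mult: "PF f \<Longrightarrow> PF g \<Longrightarrow> pd k (\<lambda>z. f z * g z) = (\<lambda>z. f z * pd k g z + pd k f z * g z)"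
  and pd_cmult: "PF f \<Longrightarrow> pd k (\<lambda>z. c * f z) = (\<lambda>z. c * pd k f z)"
  and pd_sum: "(\<And>i. i \<in> S \<Longrightarrow> PF (F i)) \<Longrightarrow> pd k (\<lambda>z. \<Sum>i\<in>S. F i z) = (\<lambda>z. \<Sum>i\<in>S. pd k (F i) z)"
  and pd_power: "PF f \<Longrightarrow> pd k (\<lambda>z. f z ^ n) = (\<lambda>z. real n * f z ^ (n - 1) * pd k f z)"
  unfolding pd_def by (simp_all only: lie_add lie_diff lie_mult lie_cmult lie_sum lie_power)

lemma pd_const [simp]: "pd k (\<lambda>_. c) = (\<lambda>_. 0)"
  by (simp add: pd_def)

lemma pd_nth: "pd k (\<lambda>x. x $ i) = (\<lambda>_. if i = k then 1 else 0)"
  unfolding pd_def by (subst lie_linear) (auto simp: bounded_linear_vec_nth axis_def)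

lemma frechet_derivative_pd:
  fixes f :: "real^'n \<Rightarrow> real"
  assumes "PF f"
  shows "frechet_derivative f (at x) h = (\<Sum>k\<in>UNIV. h $ k * pd k f x)"
proof -
  let ?D = "frechet_derivative f (at x)"
  have lin: "linear ?D"
    using PF_has_derivative[OF assms] has_derivative_linear by blast
  have "h = (\<Sum>k\<in>UNIV. h $ k *\<^sub>R axis k 1)"
    by (simp add: vec_eq_iff axis_def if_distrib cong: if_cong)
  then have "?D h = ?D (\<Sum>k\<in>UNIV. h $ k *\<^sub>R axis k 1)" by simp
  also have "\<dots> = (\<Sum>k\<in>UNIV. h $ k *\<^sub>R ?D (axis k 1))"
    by (simp add: linear_sum[OF lin] linear_scale[OF lin])
  finally show ?thesis by (simp add: pd_def lie_def)
qed

lemma has_derivative_pd: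
  fixes f :: "real^'n \<Rightarrow> real"
  assumes "PF f"
  shows "(f has_derivative (\<lambda>h. \<Sum>k\<in>UNIV. h $ k * pd k f x)) (at x)"
proof -
  have "frechet_derivative f (at x) = (\<lambda>h. \<Sum>k\<in>UNIV. h $ k * pd k f x)"
    by (rule ext) (rule frechet_derivative_pd[OF assms])
  from PF_has_derivative[OF assms, of x, unfolded this] show ?thesis .
qed

lemma pd_eqI:
  "(f has_derivative f') (at x) \<Longrightarrow> pd k f x = f' (axis k 1)"
  by (simp add: pd_def lie_eqI)

lemma pd_compose:
  fixes I :: "real^'n \<Rightarrow> real^'m" and f :: "real^'m \<Rightarrow> real"
  assumes "PF f" "\<And>j. PF (\<lambda>x. I x $ j)"
  shows "pd k (\<lambda>x. f (I x)) x = (\<Sum>j\<in>UNIV. pd j f (I x) * pd k (\<lambda>x. I x $ j) x)"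
proof -
  have "polynomial_function I" using assms(2) by (rule polynomial_function_vec)
  then obtain I' where I': "(I has_derivative I') (at x)"
    using differentiable_at_polynomial_function[of I x UNIV] by (auto simp: differentiable_def)
  have "pd k (\<lambda>x. I x $ j) x = I' (axis k 1) $ j" for j
    by (rule pd_eqI, rule bounded_linear.has_derivative[OF bounded_linear_vec_nth I'])
  moreover have "pd k (\<lambda>x. f (I x)) x = frechet_derivative f (at (I x)) (I' (axis k 1))"
    by (rule pd_eqI, rule diff_chain_at[OF I' PF_has_derivative[OF assms(1)], unfolded o_def])
  ultimately show ?thesis
    by (simp add: frechet_derivative_pd[OF assms(1)] mult.commute)
qed

lemma pd_commute:
  assumes "PF f"
  shows "pd i (pd j f) = pd j (pd i f)"
  using assms
proof (induction f rule: real_polynomial_function.induct)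
  case (linear f)
  then show ?case by (simp add: pd_def lie_linear)
next
  case (mult f g)
  then show ?case
    by (simp add: pd_mult pd_add PF_pd real_polynomial_function.intros(4)) (simp add: algebra_simps)
qed (simp_all add: pd_add PF_pd)

text \<open>The bound \<open>N\<close> is uniform over all lines: later, derivatives along lines of
  order above \<open>N\<close> vanish for all lines at once.\<close>

lemma PF_line:
  fixes f :: "'a::euclidean_space \<Rightarrow> real"
  assumes "PF f"
  shows "\<exists>N. \<forall>x v. \<exists>q. degree q \<le> N \<and> (\<forall>t. f (x + t *\<^sub>R v) = poly q t)"
  using assms
proof (induction f rule: real_polynomial_function.induct)
  case (linear f)
  then have "f (x + t *\<^sub>R v) = poly [:f x, f v:] t" for x v t
    by (simp add: bounded_linear.linear linear_add linear_scale)
  moreover have "degree [:f x, f v:] \<le> 1" for x v by simp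
  ultimately show ?case by blast
next
  case (const c)
  show ?case by (rule exI[of _ 0], intro allI, rule exI[of _ "[:c:]"]) auto
next
  case (add f g)
  then obtain N M where
    N: "\<And>x v. \<exists>q. degree q \<le> N \<and> (\<forall>t. f (x + t *\<^sub>R v) = poly q t)" and
    M: "\<And>x v. \<exists>q. degree q \<le> M \<and> (\<forall>t. g (x + t *\<^sub>R v) = poly q t)" by blast
  have "\<exists>q. degree q \<le> max N M \<and> (\<forall>t. f (x + t *\<^sub>R v) + g (x + t *\<^sub>R v) = poly q t)" for x v
  proof -
    obtain q r where "degree q \<le> N" "\<forall>t. f (x + t *\<^sub>R v) = poly q t"
      "degree r \<le> M" "\<forall>t. g (x + t *\<^sub>R v) = poly r t" using N M by metis
    then show ?thesis by (intro exI[of _ "q + r"]) (auto intro: degree_add_le)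
  qed
  then show ?case by blast
next
  case (mult f g)
  then obtain N M where
    N: "\<And>x v. \<exists>q. degree q \<le> N \<and> (\<forall>t. f (x + t *\<^sub>R v) = poly q t)" and
    M: "\<And>x v. \<exists>q. degree q \<le> M \<and> (\<forall>t. g (x + t *\<^sub>R v) = poly q t)" by blast
  have "\<exists>q. degree q \<le> N + M \<and> (\<forall>t. f (x + t *\<^sub>R v) * g (x + t *\<^sub>R v) = poly q t)" for x v
  proof -
    obtain q r where "degree q \<le> N" "\<forall>t. f (x + t *\<^sub>R v) = poly q t"
      "degree r \<le> M" "\<forall>t. g (x + t *\<^sub>R v) = poly r t" using N M by metis
    then show ?thesis
      by (intro exI[of _ "q * r"]) (auto intro: order_trans[OF degree_mult_le])
  qed
  then show ?case by blast
qed

text \<open>On the line through \<open>x\<close> (at \<open>t = 0\<close>) and \<open>a\<close> (at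
  \<open>t = 1\<close>) the claim concerns univariate polynomials, which have no zero
  divisors.\<close>

lemma PF_mult_eq_0:
  fixes f g :: "'a::euclidean_space \<Rightarrow> real"
  assumes "PF f" "PF g" and fg: "\<And>x. f x * g x = 0" and "f a \<noteq> 0"
  shows "g x = 0"
proof -
  obtain p q where p: "\<forall>t. f (x + t *\<^sub>R (a - x)) = poly p t"
    and q: "\<forall>t. g (x + t *\<^sub>R (a - x)) = poly q t"
    using PF_line[OF assms(1)] PF_line[OF assms(2)] by metis
  have "poly (p * q) t = 0" for t using p q fg by (metis poly_mult)
  then have "p * q = 0" using poly_all_0_iff_0 by blast
  moreover have "p \<noteq> 0" using p[rule_format, of 1] assms(4) by auto
  ultimately have "q = 0" by simp
  then show ?thesis using q[rule_format, of 0] by simp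
qed

section \<open>Formal polynomials and their functions\<close>

definition monom_fun :: "('n::finite \<Rightarrow>\<^sub>0 nat) \<Rightarrow> real ^ 'n \<Rightarrow> real" where
  "monom_fun m x = (\<Prod>i\<in>UNIV. (x $ i) ^ Poly_Mapping.lookup m i)"

lemma monom_fun_0 [simp]: "monom_fun 0 x = 1"
  by (simp add: monom_fun_def)

lemma monom_fun_add: "monom_fun (a + b) x = monom_fun a x * monom_fun b x"
  by (simp add: monom_fun_def lookup_add power_add prod.distrib)

lemma monom_fun_single: "monom_fun (Poly_Mapping.single k 1) x = x $ k"
proof -
  have "monom_fun (Poly_Mapping.single k 1) x = (\<Prod>i\<in>UNIV. if i = k then x $ i else 1)"
    unfolding monom_fun_def by (intro prod.cong) (auto simp: lookup_single when_def)
  then show ?thesis by simp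
qed

lemma PF_monom_fun: "PF (monom_fun m)"
  unfolding monom_fun_def by (auto intro!: real_polynomial_function_prod real_polynomial_function_power PF_nth)

lemma poly_fun_superset:
  "finite S \<Longrightarrow> Poly_Mapping.keys p \<subseteq> S \<Longrightarrow> poly_fun p x = (\<Sum>m\<in>S. Poly_Mapping.lookup p m * monom_fun m x)"
  unfolding poly_fun_def monom_fun_def
  by (rule sum.mono_neutral_left) (auto simp: in_keys_iff)

lemma poly_fun_eq: "poly_fun p x = (\<Sum>m\<in>Poly_Mapping.keys p. Poly_Mapping.lookup p m * monom_fun m x)"
  by (rule poly_fun_superset) auto

lemma poly_fun_0 [simp]: "poly_fun 0 x = 0"
  by (simp add: poly_fun_def)

lemma poly_fun_single [simp]: "poly_fun (Poly_Mapping.single m c) x = c * monom_fun m x"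
  by (subst poly_fun_superset[of "{m}"]) auto

lemma poly_fun_1 [simp]: "poly_fun 1 x = 1"
  using poly_fun_single[of 0 1 x] by simp

lemma poly_fun_add: "poly_fun (p + q) x = poly_fun p x + poly_fun q x"
proof -
  let ?S = "Poly_Mapping.keys p \<union> Poly_Mapping.keys q"
  have "poly_fun (p + q) x = (\<Sum>m\<in>?S. Poly_Mapping.lookup (p + q) m * monom_fun m x)"
    by (rule poly_fun_superset) (use keys_add[of p q] in auto)
  also have "\<dots> = (\<Sum>m\<in>?S. Poly_Mapping.lookup p m * monom_fun m x) + (\<Sum>m\<in>?S. Poly_Mapping.lookup q m * monom_fun m x)"
    by (simp add: lookup_add distrib_right sum.distrib)
  also have "\<dots> = poly_fun p x + poly_fun q x"
    by (subst (1 2) poly_fun_superset[of ?S]) auto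
  finally show ?thesis .
qed

lemma poly_fun_sum: "poly_fun (\<Sum>i\<in>S. p i) x = (\<Sum>i\<in>S. poly_fun (p i) x)"
  by (induction S rule: infinite_finite_induct) (auto simp: poly_fun_add)

lemma sum_single: "(\<Sum>m\<in>Poly_Mapping.keys p. Poly_Mapping.single m (Poly_Mapping.lookup p m)) = p"
  by (rule poly_mapping_eqI)
     (auto simp: lookup_sum lookup_single when_def in_keys_iff if_distrib cong: if_cong)

lemma poly_fun_mult: "poly_fun (p * q) x = poly_fun p x * poly_fun q x"
proof -
  have "p * q = (\<Sum>m\<in>Poly_Mapping.keys p. \<Sum>m'\<in>Poly_Mapping.keys q.
      Poly_Mapping.single (m + m') (Poly_Mapping.lookup p m * Poly_Mapping.lookup q m'))"
    by (subst (1) sum_single[symmetric], subst (5) sum_single[symmetric])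
       (simp add: sum_product mult_single)
  then have "poly_fun (p * q) x = (\<Sum>m\<in>Poly_Mapping.keys p. \<Sum>m'\<in>Poly_Mapping.keys q.
      Poly_Mapping.lookup p m * Poly_Mapping.lookup q m' * monom_fun (m + m') x)"
    by (simp add: poly_fun_sum)
  then show ?thesis
    by (simp add: monom_fun_add poly_fun_eq[of p] poly_fun_eq[of q] sum_product algebra_simps)
qed

lemma poly_fun_power: "poly_fun (p ^ k) x = poly_fun p x ^ k"
  by (induction k) (auto simp: poly_fun_mult)

lemma poly_fun_prod: "poly_fun (\<Prod>i\<in>S. p i) x = (\<Prod>i\<in>S. poly_fun (p i) x)"
  by (induction S rule: infinite_finite_induct) (auto simp: poly_fun_mult)

lemma poly_fun_subst: "poly_fun (poly_subst I P) x = poly_fun P (\<chi> j. poly_fun (I j) x)"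
  by (simp add: poly_subst_def poly_fun_sum poly_fun_mult poly_fun_prod poly_fun_power)
     (simp add: poly_fun_def)

lemma PF_poly_fun: "PF (poly_fun p)"
proof -
  have "poly_fun p = (\<lambda>x. \<Sum>m\<in>Poly_Mapping.keys p. Poly_Mapping.lookup p m * monom_fun m x)"
    by (rule ext) (rule poly_fun_eq)
  then show ?thesis
    by (auto intro!: real_polynomial_function_sum real_polynomial_function.intros(2,4) PF_monom_fun)
qed

lemma pd_monom_fun:
  "pd k (monom_fun m) x = real (Poly_Mapping.lookup m k) * monom_fun (m - Poly_Mapping.single k 1) x"
proof -
  let ?e = "Poly_Mapping.lookup m"
  define R where "R = (\<lambda>x::real^'a. \<Prod>i\<in>UNIV - {k}. (x $ i) ^ ?e i)"
  have split: "monom_fun m' x = x $ k ^ Poly_Mapping.lookup m' k * (\<Prod>i\<in>UNIV - {k}. (x $ i) ^ Poly_Mapping.lookup m' i)" for m' and x :: "real^'a"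
    unfolding monom_fun_def by (rule prod.remove) auto
  have PR: "PF R"
    unfolding R_def by (auto intro!: real_polynomial_function_prod real_polynomial_function_power PF_nth)
  have "pd k (\<lambda>x. \<Prod>i\<in>S. (x $ i) ^ ?e i) = (\<lambda>x. 0)" if "k \<notin> S" for S
    using finite[of S] that
  proof (induction S rule: finite_induct)
    case (insert i S)
    have "PF (\<lambda>x. \<Prod>i\<in>S. (x $ i) ^ ?e i)"
      by (auto intro!: real_polynomial_function_prod real_polynomial_function_power PF_nth)
    moreover have "i \<noteq> k" using insert by auto
    ultimately show ?case using insert
      by (simp add: pd_mult pd_power PF_nth real_polynomial_function_power pd_nth)
  qed auto
  then have R0: "pd k R = (\<lambda>x. 0)" by (simp add: R_def)
  have m: "monom_fun m = (\<lambda>x. x $ k ^ ?e k * R x)"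
    by (simp add: fun_eq_iff split R_def)
  have "(\<Prod>i\<in>UNIV - {k}. (x $ i) ^ Poly_Mapping.lookup (m - Poly_Mapping.single k 1) i) = R x"
    unfolding R_def by (intro prod.cong) (auto simp: lookup_minus lookup_single when_def)
  then have "monom_fun (m - Poly_Mapping.single k 1) x = x $ k ^ (?e k - 1) * R x"
    unfolding split by (simp add: lookup_minus)
  then show ?thesis
    unfolding m
    by (simp add: pd_mult PR R0 pd_power PF_nth pd_nth real_polynomial_function_power)
qed

lemma poly_fun_partial: "poly_fun (poly_partial k p) x = pd k (poly_fun p) x"
proof -
  have "poly_fun p = (\<lambda>x. \<Sum>m\<in>Poly_Mapping.keys p. Poly_Mapping.lookup p m * monom_fun m x)"
    by (rule ext) (rule poly_fun_eq)
  then have "pd k (poly_fun p) x = (\<Sum>m\<in>Poly_Mapping.keys p. Poly_Mapping.lookup p m * pd k (monom_fun m) x)"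
    by (simp add: pd_sum pd_cmult PF_monom_fun real_polynomial_function.intros(2,4))
  then show ?thesis
    by (simp add: poly_partial_def poly_fun_sum pd_monom_fun algebra_simps)
qed

lemma lookup_poly_partial:
  "Poly_Mapping.lookup (poly_partial k p) m
     = real (Poly_Mapping.lookup m k + 1) * Poly_Mapping.lookup p (m + Poly_Mapping.single k 1)"
proof -
  let ?e = "Poly_Mapping.single k (1::nat)"
  have eq: "m' - ?e = m \<longleftrightarrow> m' = m + ?e" if "Poly_Mapping.lookup m' k \<noteq> 0" for m'
  proof
    assume "m' - ?e = m"
    then have "Poly_Mapping.lookup m' i = Poly_Mapping.lookup (m + ?e) i" for i
      using that by (auto simp: lookup_add lookup_minus lookup_single when_def)
    then show "m' = m + ?e" by (rule poly_mapping_eqI)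
  qed simp
  have "Poly_Mapping.lookup (poly_partial k p) m
     = (\<Sum>m'\<in>Poly_Mapping.keys p. if m' = m + ?e then real (Poly_Mapping.lookup m' k) * Poly_Mapping.lookup p m' else 0)"
    unfolding poly_partial_def lookup_sum
  proof (rule sum.cong[OF refl])
    fix m'
    show "Poly_Mapping.lookup (Poly_Mapping.single (m' - ?e) (real (Poly_Mapping.lookup m' k) * Poly_Mapping.lookup p m')) m
      = (if m' = m + ?e then real (Poly_Mapping.lookup m' k) * Poly_Mapping.lookup p m' else 0)"
    proof (cases "Poly_Mapping.lookup m' k = 0")
      case True
      then show ?thesis by (cases "m' = m + ?e") simp_all
    next
      case False
      then show ?thesis using eq[OF False] by (simp add: lookup_single when_def)
    qed
  qed
  also have "\<dots> = real (Poly_Mapping.lookup (m + ?e) k) * Poly_Mapping.lookup p (m + ?e)"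
    by (auto simp: in_keys_iff)
  finally show ?thesis by (simp add: lookup_add)
qed

text \<open>The constant coefficient is the value at 0. A coefficient of higher degree is, up to a
  nonzero factor, a coefficient of lower degree of a formal partial derivative, which again vanishes
  as a function.\<close>

lemma poly_fun_eq_0_imp:
  assumes "poly_fun p = (\<lambda>x. 0)"
  shows "p = 0"
proof -
  have "Poly_Mapping.lookup p m = 0" if "(\<Sum>i\<in>UNIV. Poly_Mapping.lookup m i) = d" for d m
    using assms that
  proof (induction d arbitrary: p m)
    case 0
    then have "m = 0" by (intro poly_mapping_eqI) auto
    have mz: "monom_fun m' 0 = (if m' = 0 then 1 else 0)" for m' :: "'a \<Rightarrow>\<^sub>0 nat"
    proof (cases "m' = 0")
      case False
      then obtain i where "Poly_Mapping.lookup m' i \<noteq> 0" by (metis poly_mapping_eqI lookup_zero)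
      then have "monom_fun m' 0 = 0" unfolding monom_fun_def by (intro prod_zero) (auto intro!: bexI[of _ i])
      then show ?thesis using False by simp
    qed simp
    then have "poly_fun p 0 = Poly_Mapping.lookup p 0"
      by (simp add: poly_fun_eq mz if_distrib[of "\<lambda>z. _ * z"] in_keys_iff cong: if_cong)
    then show ?case using 0 \<open>m = 0\<close> by simp
  next
    case (Suc d)
    then obtain k where k: "Poly_Mapping.lookup m k \<noteq> 0"
      by (metis sum.neutral nat.distinct(1))
    let ?e = "Poly_Mapping.single k (1::nat)"
    have m: "m = (m - ?e) + ?e"
      using k by (intro poly_mapping_eqI) (auto simp: lookup_add lookup_minus lookup_single when_def)
    have "(\<Sum>i\<in>UNIV. Poly_Mapping.lookup m i) = (\<Sum>i\<in>UNIV. Poly_Mapping.lookup (m - ?e) i) + (\<Sum>i\<in>UNIV. Poly_Mapping.lookup ?e i)"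
      by (subst m, subst sum.distrib[symmetric]) (simp add: lookup_add)
    also have "(\<Sum>i\<in>UNIV. Poly_Mapping.lookup ?e i) = 1"
      by (simp add: lookup_single when_def)
    finally have "(\<Sum>i\<in>UNIV. Poly_Mapping.lookup (m - ?e) i) = d" using Suc.prems(2) by simp
    moreover have "poly_fun (poly_partial k p) = (\<lambda>x. 0)"
      unfolding fun_eq_iff poly_fun_partial Suc.prems(1) by simp
    ultimately have "Poly_Mapping.lookup (poly_partial k p) (m - ?e) = 0" by (rule Suc.IH[rotated])
    then show ?case using m by (simp add: lookup_poly_partial)
  qed
  then show ?thesis by (intro poly_mapping_eqI) simp
qed

lemma poly_fun_inj: "poly_fun p = poly_fun q \<Longrightarrow> p = q"
proof -
  assume "poly_fun p = poly_fun q"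
  moreover have "poly_fun (p + Poly_Mapping.single 0 (-1) * q) x = poly_fun p x - poly_fun q x" for x
    by (simp add: poly_fun_add poly_fun_mult)
  ultimately have "p + Poly_Mapping.single 0 (-1) * q = 0"
    by (intro poly_fun_eq_0_imp) auto
  then show "p = q" by (simp add: single_uminus)
qed

lemma PF_imp_poly_fun:
  fixes f :: "real^'n \<Rightarrow> real"
  assumes "PF f"
  shows "\<exists>p. f = poly_fun p"
  using assms
proof (induction f rule: real_polynomial_function.induct)
  case (linear f)
  have "f x = poly_fun (\<Sum>i\<in>UNIV. Poly_Mapping.single (Poly_Mapping.single i 1) (f (axis i 1))) x" for x
  proof -
    have "linear f" using linear by (rule bounded_linear.linear)
    moreover have "x = (\<Sum>i\<in>UNIV. x $ i *\<^sub>R axis i 1)"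
      by (simp add: vec_eq_iff axis_def if_distrib cong: if_cong)
    then have "f x = f (\<Sum>i\<in>UNIV. x $ i *\<^sub>R axis i 1)" by simp
    ultimately have "f x = (\<Sum>i\<in>UNIV. x $ i * f (axis i 1))"
      by (simp add: linear_sum linear_scale)
    then show ?thesis by (simp add: poly_fun_sum monom_fun_single[simplified] mult.commute)
  qed
  then show ?case by blast
next
  case (const c)
  show ?case by (rule exI[of _ "Poly_Mapping.single 0 c"]) (simp add: fun_eq_iff)
next
  case (add f g)
  then show ?case by (metis (no_types) poly_fun_add ext)
next
  case (mult f g)
  then show ?case by (metis (no_types) poly_fun_mult ext)
qed

lemma PF_monomials:
  fixes f :: "real^'n \<Rightarrow> real"
  assumes "PF f"
  obtains K c where "finite K" "f = (\<lambda>x. \<Sum>m\<in>K. c m * monom_fun m x)"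
proof -
  obtain p where "f = poly_fun p" using PF_imp_poly_fun[OF assms] by blast
  then have "f = (\<lambda>x. \<Sum>m\<in>Poly_Mapping.keys p. Poly_Mapping.lookup p m * monom_fun m x)"
    by (simp add: fun_eq_iff poly_fun_eq)
  then show ?thesis by (rule that[rotated]) simp
qed

text \<open>Including \<open>t = 0\<close> forces functions of degree 0 to be constant, as
  \<open>0 ^ 0 = 1\<close>. The zero function is homogeneous of every degree, which keeps truncated
  degrees such as \<open>k - 2\<close> correct.\<close>

definition hom :: "nat \<Rightarrow> (real ^ 'n \<Rightarrow> real) \<Rightarrow> bool" where
  "hom d f \<longleftrightarrow> (\<forall>t x. f (t *\<^sub>R x) = t ^ d * f x)"

lemma homD: "hom d f \<Longrightarrow> f (t *\<^sub>R x) = t ^ d * f x"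
  by (simp add: hom_def)

lemma homogeneous_poly_hom:
  assumes "homogeneous_poly p"
  shows "\<exists>d. hom d (poly_fun p)"
proof -
  obtain d where d: "\<And>m. m \<in> Poly_Mapping.keys p \<Longrightarrow> (\<Sum>i\<in>UNIV. Poly_Mapping.lookup m i) = d"
    using assms by (auto simp: homogeneous_poly_def)
  have "poly_fun p (t *\<^sub>R x) = t ^ d * poly_fun p x" for t x
    unfolding poly_fun_eq sum_distrib_left
    by (intro sum.cong refl)
       (simp add: monom_fun_def power_mult_distrib prod.distrib power_sum[symmetric] d)
  then show ?thesis by (auto simp: hom_def)
qed

text \<open>With the degrees of the I^j as weights this is the degree in x of a monomial in I; with
  weights 1 it is the ordinary degree.\<close>

definition wdeg :: "('n::finite \<Rightarrow> nat) \<Rightarrow> ('n \<Rightarrow>\<^sub>0 nat) \<Rightarrow> nat" where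
  "wdeg w m = (\<Sum>i\<in>UNIV. w i * Poly_Mapping.lookup m i)"

lemma monom_fun_weighted: "monom_fun m (\<chi> i. t ^ w i * x $ i) = t ^ wdeg w m * monom_fun m x"
  by (simp add: monom_fun_def wdeg_def power_mult_distrib prod.distrib power_sum power_mult)

lemma hom_monom_fun: "hom (wdeg (\<lambda>_. 1) m) (monom_fun m)"
  unfolding hom_def
proof (intro allI)
  fix t :: real and x :: "real^'a"
  show "monom_fun m (t *\<^sub>R x) = t ^ wdeg (\<lambda>_. 1) m * monom_fun m x"
    using monom_fun_weighted[of m t "\<lambda>_. 1" x] by (simp add: scaleR_vec_def)
qed

lemma PF_homogeneous_components:
  fixes f :: "real^'n \<Rightarrow> real"
  assumes "PF f"
  obtains F N where "\<And>k. PF (F k)" "\<And>k. hom k (F k)" "\<And>x. f x = (\<Sum>k\<le>N. F k x)"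
proof -
  obtain K c where K: "finite K" "f = (\<lambda>x. \<Sum>m\<in>K. c m * monom_fun m x)"
    using PF_monomials[OF assms] .
  let ?d = "wdeg (\<lambda>_::'n. 1)"
  define F where "F k x = (\<Sum>m\<in>{m\<in>K. ?d m = k}. c m * monom_fun m x)" for k x
  show ?thesis
  proof (rule that)
    show "PF (F k)" for k
      unfolding F_def using K(1)
      by (auto intro!: real_polynomial_function_sum real_polynomial_function.intros(2,4) PF_monom_fun)
    show "hom k (F k)" for k
      by (auto simp: hom_def F_def sum_distrib_left homD[OF hom_monom_fun] intro!: sum.cong)
    show "f x = (\<Sum>k\<le>(\<Sum>m\<in>K. ?d m). F k x)" for x
      unfolding K(2) F_def
    proof (rule sum.group[symmetric])
      show "?d ` K \<subseteq> {..\<Sum>m\<in>K. ?d m}"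
        using K(1) by (auto intro: member_le_sum)
    qed (use K in auto)
  qed
qed

section \<open>Factoriality of polynomial rings\<close>

text \<open>Relative to a subring \<open>R\<close> of an integral domain rather than to a type, so that variables can be
  adjoined one at a time inside the ring of all polynomial functions.\<close>

definition subring :: "'a::idom set \<Rightarrow> bool" where
  "subring R \<longleftrightarrow> 0 \<in> R \<and> 1 \<in> R \<and> (\<forall>a\<in>R. \<forall>b\<in>R. a + b \<in> R \<and> a - b \<in> R \<and> a * b \<in> R)"

definition dvd_in :: "'a::idom set \<Rightarrow> 'a \<Rightarrow> 'a \<Rightarrow> bool" where
  "dvd_in R a b \<longleftrightarrow> (\<exists>c\<in>R. b = a * c)"

definition unit_in :: "'a::idom set \<Rightarrow> 'a \<Rightarrow> bool" where
  "unit_in R u \<longleftrightarrow> u \<in> R \<and> dvd_in R u 1"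

definition prime_in :: "'a::idom set \<Rightarrow> 'a \<Rightarrow> bool" where
  "prime_in R p \<longleftrightarrow> p \<in> R \<and> p \<noteq> 0 \<and> \<not> unit_in R p \<and>
     (\<forall>a\<in>R. \<forall>b\<in>R. dvd_in R p (a * b) \<longrightarrow> dvd_in R p a \<or> dvd_in R p b)"

text \<open>The base rule leaves \<open>n\<close> free, so \<open>n\<close> is an upper bound for
  the number of prime factors. This suffices for inductions and for bounding multiplicities.\<close>

inductive prime_product :: "'a::idom set \<Rightarrow> nat \<Rightarrow> 'a \<Rightarrow> bool" for R where
  unit: "unit_in R u \<Longrightarrow> prime_product R n u"
| step: "prime_in R p \<Longrightarrow> prime_product R n a \<Longrightarrow> prime_product R (Suc n) (p * a)"

text \<open>Factorizations into primes, as opposed to irreducibles, are automatically unique up to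
  units and order, so existence alone expresses factoriality.\<close>

definition factorial_in :: "'a::idom set \<Rightarrow> bool" where
  "factorial_in R \<longleftrightarrow> subring R \<and> (\<forall>a\<in>R. a \<noteq> 0 \<longrightarrow> (\<exists>n. prime_product R n a))"

lemma subringD:
  assumes "subring R"
  shows "0 \<in> R" "1 \<in> R" "a \<in> R \<Longrightarrow> b \<in> R \<Longrightarrow> a + b \<in> R" "a \<in> R \<Longrightarrow> b \<in> R \<Longrightarrow> a - b \<in> R"
    "a \<in> R \<Longrightarrow> b \<in> R \<Longrightarrow> a * b \<in> R" "a \<in> R \<Longrightarrow> - a \<in> R"
proof -
  show "0 \<in> R" "1 \<in> R" "a \<in> R \<Longrightarrow> b \<in> R \<Longrightarrow> a + b \<in> R" "a \<in> R \<Longrightarrow> b \<in> R \<Longrightarrow> a - b \<in> R"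
    "a \<in> R \<Longrightarrow> b \<in> R \<Longrightarrow> a * b \<in> R"
    using assms by (auto simp: subring_def)
  then show "a \<in> R \<Longrightarrow> - a \<in> R"
    using assms by (metis diff_0 subring_def)
qed

lemma subring_sum: "subring R \<Longrightarrow> (\<And>i. i \<in> S \<Longrightarrow> f i \<in> R) \<Longrightarrow> sum f S \<in> R"
  by (induction S rule: infinite_finite_induct) (auto simp: subringD)

lemma dvd_in_mult: "subring R \<Longrightarrow> dvd_in R p a \<Longrightarrow> b \<in> R \<Longrightarrow> dvd_in R p (a * b)"
  unfolding dvd_in_def by (metis subringD(5) mult.assoc)

lemma dvd_in_mult2: "subring R \<Longrightarrow> dvd_in R p a \<Longrightarrow> b \<in> R \<Longrightarrow> dvd_in R p (b * a)"
  using dvd_in_mult[of R p a b] by (simp add: mult.commute)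

lemma dvd_in_diff: "subring R \<Longrightarrow> dvd_in R p a \<Longrightarrow> dvd_in R p b \<Longrightarrow> dvd_in R p (a - b)"
  unfolding dvd_in_def by (metis subringD(4) right_diff_distrib)

lemma dvd_in_add: "subring R \<Longrightarrow> dvd_in R p a \<Longrightarrow> dvd_in R p b \<Longrightarrow> dvd_in R p (a + b)"
  unfolding dvd_in_def by (metis subringD(3) distrib_left)

lemma dvd_in_0: "subring R \<Longrightarrow> dvd_in R p 0"
  unfolding dvd_in_def by (metis subringD(1) mult_zero_right)

lemma dvd_in_sum: "subring R \<Longrightarrow> (\<And>i. i \<in> S \<Longrightarrow> dvd_in R p (f i)) \<Longrightarrow> dvd_in R p (sum f S)"
  by (induction S rule: infinite_finite_induct) (auto simp: dvd_in_0 dvd_in_add)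

lemma unit_in_mult: "subring R \<Longrightarrow> unit_in R a \<Longrightarrow> unit_in R b \<Longrightarrow> unit_in R (a * b)"
  unfolding unit_in_def dvd_in_def
  by (auto simp: subringD) (metis mult.assoc mult.left_commute mult_1 subringD(5))

lemma prime_product_in:
  assumes "subring R"
  shows "prime_product R n a \<Longrightarrow> a \<in> R"
  by (induction rule: prime_product.induct) (use assms in \<open>auto simp: unit_in_def prime_in_def subringD\<close>)

lemma prime_product_nz: "prime_product R n a \<Longrightarrow> a \<noteq> 0"
  by (induction rule: prime_product.induct) (auto simp: unit_in_def prime_in_def dvd_in_def)

lemma prime_product_unit_mult:
  assumes "subring R"
  shows "prime_product R n a \<Longrightarrow> unit_in R u \<Longrightarrow> prime_product R n (u * a)"
proof (induction rule: prime_product.induct)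
  case (step p n a)
  from prime_product.step[OF step(1) step(3)[OF step(4)]] show ?case
    by (simp add: mult.left_commute)
qed (use assms in \<open>auto intro: prime_product.unit unit_in_mult\<close>)

lemma prime_product_mult:
  "prime_product R n a \<Longrightarrow> subring R \<Longrightarrow> prime_product R m b \<Longrightarrow> prime_product R (n + m) (a * b)"
proof (induction rule: prime_product.induct)
  case (unit u n)
  have "prime_product R m (u * b)" using unit prime_product_unit_mult by blast
  moreover have "prime_product R k c \<Longrightarrow> prime_product R (n + k) c" for k c n
    by (induction rule: prime_product.induct) (auto intro: prime_product.intros)
  ultimately show ?case by blast
next
  case (step p n a)
  from prime_product.step[OF step(1) step(3)[OF step(4,5)]] show ?case by (simp add: mult.assoc)
qed

text \<open>Follow \<open>q\<close> through the factorization: it divides either the remaining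
  product, where induction applies, or the current prime \<open>p\<close>, which is then
  \<open>q\<close> times a unit.\<close>

lemma prime_product_cancel:
  assumes R: "subring R" and q: "prime_in R q"
  shows "prime_product R n (q * l) \<Longrightarrow> l \<in> R \<Longrightarrow> \<exists>n'. n = Suc n' \<and> prime_product R n' l"
proof (induction n "q * l" arbitrary: l rule: prime_product.induct)
  case (unit n)
  then have "unit_in R q"
    using q R unfolding unit_in_def prime_in_def dvd_in_def by (metis mult.assoc subringD(5))
  then show ?case using q by (auto simp: prime_in_def)
next
  case (step p n a)
  have a: "a \<in> R" and p: "p \<in> R" "p \<noteq> 0"
    using step prime_product_in[OF R] by (auto simp: prime_in_def)
  have q0: "q \<noteq> 0" "q \<in> R" using q by (auto simp: prime_in_def)
  have "dvd_in R q (p * a)" using step by (auto simp: dvd_in_def)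
  then consider "dvd_in R q a" | "dvd_in R q p" using q a p by (auto simp: prime_in_def)
  then show ?case
  proof cases
    case 1
    then obtain m where m: "m \<in> R" "a = q * m" by (auto simp: dvd_in_def)
    with step(3) obtain n' where n': "n = Suc n'" "prime_product R n' m" by blast
    have "q * l = q * (p * m)" using step(4) m by (simp only: mult.left_commute)
    then have "l = p * m" using q0 by (simp only: mult_cancel_left) simp
    then show ?thesis using prime_product.step[OF step(1) n'(2)] n' by blast
  next
    case 2
    then obtain u where u: "u \<in> R" "p = q * u" by (auto simp: dvd_in_def)
    then have "dvd_in R p (q * u)" using subringD(2)[OF R] by (auto simp: dvd_in_def intro!: bexI[of _ 1])
    then have "dvd_in R p q \<or> dvd_in R p u" using step(1) q0 u by (auto simp: prime_in_def)
    then have "unit_in R u"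
    proof
      assume "dvd_in R p q"
      then obtain w where w: "w \<in> R" "q = p * w" by (auto simp: dvd_in_def)
      then have "p * (u * w) = p * 1" using u by (metis mult.assoc mult.commute mult_1_right)
      then have "u * w = 1" using p by (metis mult_cancel_left)
      then show ?thesis using u w by (auto simp: unit_in_def dvd_in_def intro!: bexI[of _ w])
    next
      assume "dvd_in R p u"
      then obtain w where w: "w \<in> R" "u = p * w" by (auto simp: dvd_in_def)
      then have "p * (q * w) = p * 1" using u by (metis mult.left_commute mult_1_right)
      then have "q * w = 1" using p by (metis mult_cancel_left)
      then have "unit_in R q" using q0 w by (auto simp: unit_in_def dvd_in_def intro!: bexI[of _ w])
      then show ?thesis using q by (auto simp: prime_in_def)
    qed
    moreover have "l = u * a"
    proof -
      have "q * l = q * (u * a)" using step(4) u by (simp only: mult.assoc)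
      then show ?thesis using q0 by (simp only: mult_cancel_left) simp
    qed
    ultimately show ?thesis using prime_product_unit_mult[OF R step(2)] by auto
  qed
qed

lemma prime_power_bound:
  assumes R: "subring R" and q: "prime_in R q"
  shows "prime_product R n a \<Longrightarrow> c \<in> R \<Longrightarrow> a = q ^ k * c \<Longrightarrow> k \<le> n"
proof (induction k arbitrary: a n)
  case (Suc k)
  have "q ^ j * c \<in> R" for j
    by (induction j) (use q R Suc.prems(2) in \<open>auto simp: prime_in_def subringD mult.assoc\<close>)
  then obtain n' where "n = Suc n'" "prime_product R n' (q ^ k * c)"
    using prime_product_cancel[OF R q, of n "q ^ k * c"] Suc.prems by (auto simp: mult.assoc)
  then show ?case using Suc by auto
qed auto

lemma prime_multiplicity:
  assumes R: "subring R" and q: "prime_in R q" and a: "prime_product R n a"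
  obtains m c where "c \<in> R" "a = q ^ m * c" "\<not> dvd_in R q c"
proof -
  let ?P = "\<lambda>k. \<exists>c\<in>R. a = q ^ k * c"
  have "?P 0" using prime_product_in[OF R a] by auto
  moreover have "\<forall>k. ?P k \<longrightarrow> k < Suc n" using prime_power_bound[OF R q a] less_Suc_eq_le by blast
  ultimately have "\<exists>m. ?P m \<and> (\<forall>k. ?P k \<longrightarrow> k \<le> m)"
    by (rule ex_has_greatest_nat)
  then obtain m where m: "?P m" "\<And>k. ?P k \<Longrightarrow> k \<le> m" by blast
  then obtain c where c: "c \<in> R" "a = q ^ m * c" by blast
  have "\<not> dvd_in R q c"
  proof
    assume "dvd_in R q c"
    then obtain d where "d \<in> R" "a = q ^ Suc m * d" using c by (auto simp: dvd_in_def mult.assoc mult.left_commute)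
    then have "Suc m \<le> m" by (intro m(2)) blast
    then show False by simp
  qed
  with c show ?thesis by (rule that)
qed

lemma prime_power_dvd:
  assumes R: "subring R" and q: "prime_in R q" and "p \<in> R" "\<not> dvd_in R q p"
  shows "b \<in> R \<Longrightarrow> c \<in> R \<Longrightarrow> p * b = q ^ k * c \<Longrightarrow> dvd_in R (q ^ k) b"
proof (induction k arbitrary: b)
  case 0
  then show ?case by (auto simp: dvd_in_def)
next
  case (Suc k)
  have qk: "q ^ k * c \<in> R" for k
    by (induction k) (use q R Suc.prems(2) in \<open>auto simp: prime_in_def subringD mult.assoc\<close>)
  then have "dvd_in R q (p * b)" using Suc.prems by (auto simp: dvd_in_def mult.assoc)
  then have "dvd_in R q b" using q assms(3,4) Suc.prems(1) by (auto simp: prime_in_def)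
  then obtain b' where b': "b' \<in> R" "b = q * b'" by (auto simp: dvd_in_def)
  have "q * (p * b') = q * (q ^ k * c)" using Suc.prems(3) b' by (simp add: algebra_simps)
  then have "p * b' = q ^ k * c" using q by (simp add: prime_in_def)
  then have "dvd_in R (q ^ k) b'" using Suc.IH[OF b'(1) Suc.prems(2)] by blast
  then show ?case using b' by (auto simp: dvd_in_def mult.assoc)
qed

text \<open>Divisibility can be tested on prime powers. Primes of \<open>a\<close> that divide
  \<open>b\<close> are stripped from both until one is met that does not divide what is left of
  \<open>b\<close>; the exponent of this prime is rebuilt on the way back.\<close>

lemma not_dvd_in_prime_power:
  assumes R: "subring R"
  shows "prime_product R n a \<Longrightarrow> b \<in> R \<Longrightarrow> \<not> dvd_in R a b \<Longrightarrow>
    \<exists>q k. prime_in R q \<and> dvd_in R (q ^ Suc k) a \<and> \<not> dvd_in R (q ^ Suc k) b"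
proof (induction arbitrary: b rule: prime_product.induct)
  case (unit u n)
  then have "dvd_in R u b"
    using R unfolding unit_in_def dvd_in_def by (metis mult.assoc mult_1 subringD(5))
  then show ?case using unit by blast
next
  case (step p n a)
  have a: "a \<in> R" and p: "p \<in> R" "p \<noteq> 0"
    using step prime_product_in[OF R] by (auto simp: prime_in_def)
  show ?case
  proof (cases "dvd_in R p b")
    case False
    then show ?thesis using step(1) a by (intro exI[of _ p] exI[of _ 0]) (auto simp: dvd_in_def)
  next
    case True
    then obtain b' where b': "b' \<in> R" "b = p * b'" by (auto simp: dvd_in_def)
    have "\<not> dvd_in R a b'" using step(5) b' by (auto simp: dvd_in_def mult.assoc)
    with step(3)[OF b'(1)] obtain q k where q: "prime_in R q" "dvd_in R (q ^ Suc k) a" "\<not> dvd_in R (q ^ Suc k) b'"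
      by blast
    have q0: "q \<noteq> 0" "q \<in> R" using q by (auto simp: prime_in_def)
    have qk: "q ^ k \<in> R" for k by (induction k) (use q0 R in \<open>auto simp: subringD\<close>)
    obtain c where c: "c \<in> R" "a = q ^ Suc k * c" using q(2) by (auto simp: dvd_in_def)
    show ?thesis
    proof (cases "dvd_in R q p")
      case False
      have "\<not> dvd_in R (q ^ Suc k) b"
        using prime_power_dvd[OF R q(1) p(1) False b'(1)] q(3) b'(2) unfolding dvd_in_def by metis
      moreover have "dvd_in R (q ^ Suc k) (p * a)" by (rule dvd_in_mult2[OF R q(2) p(1)])
      ultimately show ?thesis using q(1) by blast
    next
      case True
      then obtain u where u: "u \<in> R" "p = q * u" by (auto simp: dvd_in_def)
      \<comment> \<open>Here \<open>p\<close> and \<open>q\<close> are associate, so putting the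
        stripped prime back raises the separating exponent by one.\<close>
      have "p * a = q ^ Suc (Suc k) * (u * c)" using u c by (simp add: algebra_simps)
      then have "dvd_in R (q ^ Suc (Suc k)) (p * a)" using subringD(5)[OF R u(1) c(1)] by (auto simp: dvd_in_def)
      moreover have "\<not> dvd_in R (q ^ Suc (Suc k)) b"
      proof
        assume "dvd_in R (q ^ Suc (Suc k)) b"
        then obtain d where d: "d \<in> R" "q * (u * b') = q * (q ^ Suc k * d)"
          using b' u by (auto simp: dvd_in_def mult.assoc)
        then have "u * b' = q ^ Suc k * d" using q0 by simp
        moreover have "\<not> dvd_in R q u"
        proof
          assume "dvd_in R q u"
          have "dvd_in R p (q * u)" using u subringD(2)[OF R] by (auto simp: dvd_in_def intro!: bexI[of _ 1])
          then have "dvd_in R p q \<or> dvd_in R p u" using step(1) q0 u by (auto simp: prime_in_def)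
          then show False
          proof
            assume "dvd_in R p u"
            then obtain w where w: "w \<in> R" "u = p * w" by (auto simp: dvd_in_def)
            then have "p * (q * w) = p * 1" using u by (metis mult.left_commute mult_1_right)
            then have "q * w = 1" using p by (metis mult_cancel_left)
            then show False using q(1) w q0 by (auto simp: prime_in_def unit_in_def dvd_in_def)
          next
            assume "dvd_in R p q"
            then obtain w where w: "w \<in> R" "q = p * w" by (auto simp: dvd_in_def)
            obtain v where v: "v \<in> R" "u = q * v" using \<open>dvd_in R q u\<close> by (auto simp: dvd_in_def)
            have "q * 1 = q * (q * v * w)" using w v u by (simp add: algebra_simps)
            then have "q * (v * w) = 1" using q0 by (metis mult_cancel_left mult.assoc)
            then show False using q(1) v w q0 subringD(5)[OF R v(1) w(1)]
              by (auto simp: prime_in_def unit_in_def dvd_in_def)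
          qed
        qed
        ultimately have "dvd_in R (q ^ Suc k) b'"
          using prime_power_dvd[OF R q(1) u(1) _ b'(1) d(1)] by blast
        then show False using q(3) by blast
      qed
      ultimately show ?thesis using q(1) by blast
    qed
  qed
qed

section \<open>Gauss's lemma and adjunction of one variable\<close>

definition polys_over :: "'a::idom set \<Rightarrow> 'a poly set" where
  "polys_over R = {p. \<forall>i. coeff p i \<in> R}"

lemma subring_polys_over:
  assumes "subring R"
  shows "subring (polys_over R)"
  unfolding subring_def polys_over_def
  using assms by (auto simp: subringD coeff_mult coeff_1 intro!: subring_sum)

lemma const_in_polys_over: "subring R \<Longrightarrow> [:c:] \<in> polys_over R \<longleftrightarrow> c \<in> R"
  by (auto simp: polys_over_def coeff_pCons subringD split: nat.splits)

lemma dvd_in_const: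
  assumes "subring R"
  shows "dvd_in (polys_over R) [:c:] p \<longleftrightarrow> (\<forall>i. dvd_in R c (coeff p i))"
proof
  assume "dvd_in (polys_over R) [:c:] p"
  then show "\<forall>i. dvd_in R c (coeff p i)" by (auto simp: dvd_in_def polys_over_def)
next
  assume "\<forall>i. dvd_in R c (coeff p i)"
  then obtain d where d: "\<And>i. d i \<in> R" "\<And>i. coeff p i = c * d i" unfolding dvd_in_def by metis
  \<comment> \<open>For \<open>c = 0\<close> the cofactors \<open>d\<close> are arbitrary; replacing
    them by 0 gives the finite support that a polynomial requires.\<close>
  define e where "e i = (if c = 0 then 0 else d i)" for i
  have e: "e i \<in> R" "coeff p i = c * e i" for i using d assms by (auto simp: e_def subringD)
  have "e i = 0" if "i > degree p" for i
    using e(2)[of i] coeff_eq_0[OF that] by (auto simp: e_def)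
  then have "coeff (Abs_poly e) = e" by (intro Abs_poly_inverse) (auto simp: eventually_cofinite intro!: finite_subset[of _ "{..degree p}"] simp: not_less[symmetric])
  then have "p = [:c:] * Abs_poly e" "Abs_poly e \<in> polys_over R"
    using e by (auto simp: poly_eq_iff polys_over_def)
  then show "dvd_in (polys_over R) [:c:] p" by (auto simp: dvd_in_def)
qed

text \<open>Gauss's lemma. If \<open>i\<close> and \<open>j\<close> are the lowest indices whose
  coefficients \<open>q\<close> fails to divide, then modulo \<open>q\<close> the coefficient of
  \<open>a * b\<close> at \<open>i + j\<close> is the product of these two coefficients.\<close>

lemma prime_in_const:
  assumes R: "subring R" and q: "prime_in R q"
  shows "prime_in (polys_over R) [:q:]"
  unfolding prime_in_def
proof (intro conjI ballI impI)
  show "[:q:] \<in> polys_over R" "[:q:] \<noteq> 0" using q const_in_polys_over[OF R] by (auto simp: prime_in_def)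
  show "\<not> unit_in (polys_over R) [:q:]"
  proof
    assume "unit_in (polys_over R) [:q:]"
    then have "\<forall>i. dvd_in R q (coeff 1 i)" using dvd_in_const[OF R] by (auto simp: unit_in_def)
    from spec[OF this, of 0] show False using q by (auto simp: prime_in_def unit_in_def)
  qed
  fix a b assume a: "a \<in> polys_over R" and b: "b \<in> polys_over R" and ab: "dvd_in (polys_over R) [:q:] (a * b)"
  show "dvd_in (polys_over R) [:q:] a \<or> dvd_in (polys_over R) [:q:] b"
  proof (rule ccontr)
    assume *: "\<not> ?thesis"
    define i where "i = (LEAST i. \<not> dvd_in R q (coeff a i))"
    define j where "j = (LEAST j. \<not> dvd_in R q (coeff b j))"
    have ex: "\<exists>i. \<not> dvd_in R q (coeff a i)" "\<exists>j. \<not> dvd_in R q (coeff b j)"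
      using * unfolding dvd_in_const[OF R] by blast+
    have i: "\<not> dvd_in R q (coeff a i)" and j: "\<not> dvd_in R q (coeff b j)"
      using LeastI_ex[OF ex(1)] LeastI_ex[OF ex(2)] by (auto simp: i_def j_def)
    have ij: "k < i \<Longrightarrow> dvd_in R q (coeff a k)" "k < j \<Longrightarrow> dvd_in R q (coeff b k)" for k
      using not_less_Least[of k "\<lambda>i. \<not> dvd_in R q (coeff a i)"]
        not_less_Least[of k "\<lambda>j. \<not> dvd_in R q (coeff b j)"] by (auto simp: i_def j_def)
    have cR: "coeff a k \<in> R" "coeff b k \<in> R" for k using a b by (auto simp: polys_over_def)
    have "coeff (a * b) (i + j) = coeff a i * coeff b j + (\<Sum>k\<in>{..i+j} - {i}. coeff a k * coeff b (i + j - k))"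
      unfolding coeff_mult by (subst sum.remove[of _ i]) auto
    moreover have "dvd_in R q (\<Sum>k\<in>{..i+j} - {i}. coeff a k * coeff b (i + j - k))"
    proof (rule dvd_in_sum[OF R])
      fix k assume k: "k \<in> {..i+j} - {i}"
      show "dvd_in R q (coeff a k * coeff b (i + j - k))"
      proof (cases "k < i")
        case True
        then show ?thesis using ij(1) cR dvd_in_mult[OF R] by blast
      next
        case False
        then have "i + j - k < j" using k by auto
        then show ?thesis using ij(2) cR dvd_in_mult2[OF R] by blast
      qed
    qed
    moreover have "dvd_in R q (coeff (a * b) (i + j))" using ab dvd_in_const[OF R] by blast
    ultimately have "dvd_in R q (coeff a i * coeff b j)"
      using dvd_in_diff[OF R, of q "coeff (a * b) (i + j)"] by fastforce
    then show False using q i j cR by (auto simp: prime_in_def)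
  qed
qed

text \<open>Testing against the primes of \<open>R\<close> avoids gcds. If \<open>R\<close> is a
  field there are no primes, and every polynomial over it counts as primitive.\<close>

definition primitive_in :: "'a::idom set \<Rightarrow> 'a poly \<Rightarrow> bool" where
  "primitive_in R p \<longleftrightarrow> p \<in> polys_over R \<and> (\<forall>q. prime_in R q \<longrightarrow> \<not> dvd_in (polys_over R) [:q:] p)"

text \<open>The prime factors of \<open>c\<close> pass the primitive polynomial \<open>p\<close> one
  at a time, by Gauss's lemma.\<close>

lemma primitive_cancel:
  assumes R: "subring R" and p: "primitive_in R p"
  shows "prime_product R n c \<Longrightarrow> w \<in> polys_over R \<Longrightarrow> dvd_in (polys_over R) [:c:] (p * w) \<Longrightarrow> dvd_in (polys_over R) [:c:] w"
proof (induction arbitrary: w rule: prime_product.induct)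
  case (unit u n)
  then obtain v where v: "v \<in> R" "1 = u * v" by (auto simp: unit_in_def dvd_in_def)
  have "[:u:] * [:v:] = 1" using v by (simp add: one_pCons mult.commute)
  then have "w = [:u:] * ([:v:] * w)" by (simp only: mult.assoc[symmetric] mult_1)
  moreover have "[:v:] * w \<in> polys_over R"
    using subringD(5)[OF subring_polys_over[OF R]] const_in_polys_over[OF R] v unit by blast
  ultimately show ?case unfolding dvd_in_def by blast
next
  case (step q n a)
  note PR = subring_polys_over[OF R]
  from step(5) obtain z where z: "z \<in> polys_over R" "p * w = [:q * a:] * z"
    unfolding dvd_in_def by blast
  have qa: "[:q * a:] = [:q:] * [:a:]" by simp
  from z(2) have z2: "p * w = [:q:] * ([:a:] * z)" unfolding qa by (simp only: mult.assoc)
  have aR: "[:a:] \<in> polys_over R" using prime_product_in[OF R step(2)] const_in_polys_over[OF R] by blast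
  have "dvd_in (polys_over R) [:q:] (p * w)" using z z2 subringD(5)[OF PR aR] unfolding dvd_in_def by blast
  then have "dvd_in (polys_over R) [:q:] w"
    using prime_in_const[OF R step(1)] p step(1,4) unfolding prime_in_def[of "polys_over R"] primitive_in_def by blast
  then obtain w' where w': "w' \<in> polys_over R" "w = [:q:] * w'" unfolding dvd_in_def by blast
  have "[:q:] * (p * w') = [:q:] * ([:a:] * z)" using z2 unfolding w'(2) by (simp only: mult.left_commute)
  moreover have "[:q:] \<noteq> 0" using step(1) by (auto simp: prime_in_def)
  ultimately have "p * w' = [:a:] * z" by (simp only: mult_cancel_left) simp
  then have "dvd_in (polys_over R) [:a:] (p * w')" using z unfolding dvd_in_def by blast
  then have "dvd_in (polys_over R) [:a:] w'" using step(3)[OF w'(1)] by blast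
  then obtain v where v: "v \<in> polys_over R" "w' = [:a:] * v" unfolding dvd_in_def by blast
  have "w = [:q * a:] * v" unfolding w'(2) v(2) qa by (simp only: mult.assoc)
  then show ?case using v unfolding dvd_in_def by blast
qed

text \<open>Each prime constant split off \<open>a\<close> also leaves the leading coefficient, so
  the length \<open>n\<close> of the factorization of that coefficient bounds the number of
  rounds.\<close>

lemma primitive_decomposition:
  assumes R: "subring R"
  shows "prime_product R n (lead_coeff a) \<Longrightarrow> a \<in> polys_over R \<Longrightarrow>
    \<exists>c m a0. prime_product R m c \<and> primitive_in R a0 \<and> a = [:c:] * a0"
proof (induction n arbitrary: a)
  case (Suc n)
  show ?case
  proof (cases "primitive_in R a")
    case True
    have "prime_product R 0 1" using R by (intro prime_product.unit) (auto simp: unit_in_def dvd_in_def subringD intro!: bexI[of _ 1])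
    then show ?thesis using True by (intro exI[of _ 1] exI[of _ 0] exI[of _ a]) auto
  next
    case False
    then obtain q where q: "prime_in R q" "dvd_in (polys_over R) [:q:] a" using Suc.prems by (auto simp: primitive_in_def)
    then obtain b where b: "b \<in> polys_over R" "a = [:q:] * b" by (auto simp: dvd_in_def)
    then have "lead_coeff a = q * lead_coeff b" by (simp add: lead_coeff_smult)
    then have "prime_product R n (lead_coeff b)"
      using prime_product_cancel[OF R q(1), of "Suc n" "lead_coeff b"] Suc.prems b by (auto simp: polys_over_def)
    from Suc.IH[OF this b(1)] obtain c m a0
      where c: "prime_product R m c" "primitive_in R a0" "b = [:c:] * a0" by blast
    have "a = [:q * c:] * a0" using b c by (simp add: mult.commute)
    then show ?thesis using c(2) prime_product.step[OF q(1) c(1)] by blast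
  qed
next
  case 0
  have "primitive_in R a"
  proof (rule ccontr)
    assume "\<not> ?thesis"
    then obtain q where q: "prime_in R q" "dvd_in (polys_over R) [:q:] a" using 0 by (auto simp: primitive_in_def)
    then obtain b where b: "b \<in> polys_over R" "a = [:q:] * b" by (auto simp: dvd_in_def)
    then have "lead_coeff a = q * lead_coeff b" by (simp add: lead_coeff_smult)
    then show False
      using prime_product_cancel[OF R q(1), of 0 "lead_coeff b"] 0 b by (auto simp: polys_over_def)
  qed
  moreover have "prime_product R 0 1" using R by (intro prime_product.unit) (auto simp: unit_in_def dvd_in_def subringD intro!: bexI[of _ 1])
  ultimately show ?case by (intro exI[of _ 1] exI[of _ 0] exI[of _ a]) auto
qed

text \<open>The leading coefficient of \<open>h\<close> need not be invertible in \<open>R\<close>.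
  The factor \<open>c\<close>, a power of it, replaces division over the fraction field.\<close>

lemma polys_over_pseudo_division:
  assumes R: "subring R" and h: "h \<in> polys_over R" "h \<noteq> 0"
  shows "f \<in> polys_over R \<Longrightarrow> \<exists>c q r. c \<in> R \<and> c \<noteq> 0 \<and> q \<in> polys_over R \<and> r \<in> polys_over R \<and>
    [:c:] * f = h * q + r \<and> (r = 0 \<or> degree r < degree h)"
proof (induction "degree f" arbitrary: f rule: less_induct)
  case less
  note PR = subringD[OF subring_polys_over[OF R]]
  note RR = subringD[OF R]
  show ?case
  proof (cases "f = 0 \<or> degree f < degree h")
    case True
    then show ?thesis using less.prems PR RR by (intro exI[of _ 1] exI[of _ 0] exI[of _ f]) auto
  next
    case False
    define l where "l = lead_coeff h"
    have l: "l \<in> R" "l \<noteq> 0" using h by (auto simp: l_def polys_over_def)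
    define s where "s = monom (lead_coeff f) (degree f - degree h)"
    have s: "s \<in> polys_over R" using less.prems RR by (auto simp: s_def polys_over_def)
    define f' where "f' = [:l:] * f - h * s"
    have f': "f' \<in> polys_over R"
      unfolding f'_def using l s h less.prems const_in_polys_over[OF R] by (blast intro: PR)
    have "degree f' \<le> degree f"
      unfolding f'_def using False degree_mult_le[of h s] degree_monom_le[of "lead_coeff f" "degree f - degree h"]
      by (intro degree_diff_le) (auto simp: s_def)
    moreover have "coeff f' (degree f) = 0"
    proof -
      have "coeff (h * s) (degree f) = lead_coeff h * lead_coeff f"
        unfolding s_def mult.commute[of h] using False by (simp add: coeff_monom_mult)
      then show ?thesis by (simp add: f'_def l_def)
    qed
    ultimately have f'0: "f' = 0 \<or> degree f' < degree f"
      by (metis le_neq_implies_less leading_coeff_0_iff)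
    have "\<exists>c q r. c \<in> R \<and> c \<noteq> 0 \<and> q \<in> polys_over R \<and> r \<in> polys_over R \<and>
      [:c:] * f' = h * q + r \<and> (r = 0 \<or> degree r < degree h)"
    proof (cases "f' = 0")
      case True
      then show ?thesis using PR RR by (intro exI[of _ 1] exI[of _ 0]) auto
    next
      case False
      then show ?thesis using less.hyps[of f'] f'0 f' by blast
    qed
    then obtain c q r where c: "c \<in> R" "c \<noteq> 0" "q \<in> polys_over R" "r \<in> polys_over R"
      "[:c:] * f' = h * q + r" "r = 0 \<or> degree r < degree h" by blast
    have cl: "[:c * l:] = [:c:] * [:l:]" by simp
    have "[:c * l:] * f = [:c:] * f' + h * ([:c:] * s)"
      unfolding f'_def cl by (simp only: algebra_simps)
    also have "\<dots> = h * (q + [:c:] * s) + r" unfolding c(5) by (simp only: algebra_simps)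
    finally have "[:c * l:] * f = h * (q + [:c:] * s) + r" .
    moreover have "q + [:c:] * s \<in> polys_over R"
      using c s const_in_polys_over[OF R] by (blast intro: PR)
    ultimately show ?thesis using c l RR(5)[of c l]
      by (intro exI[of _ "c * l"] exI[of _ "q + [:c:] * s"] exI[of _ r]) auto
  qed
qed

text \<open>Bezout's argument over the fraction field with denominators cleared: a nonzero element
  \<open>h\<close> of least degree in the ideal of \<open>p\<close> and \<open>a\<close> divides
  both up to constants, and the constants cancel by primitivity.\<close>

lemma prime_in_of_irreducible_primitive:
  assumes F: "factorial_in R" and p: "primitive_in R p" and d: "degree p > 0"
    and irr: "\<And>x y. x \<in> polys_over R \<Longrightarrow> y \<in> polys_over R \<Longrightarrow> p = x * y \<Longrightarrow>
      \<not> (degree x < degree p \<and> degree y < degree p)"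
  shows "prime_in (polys_over R) p"
proof -
  have R: "subring R" using F by (simp add: factorial_in_def)
  have fac: "\<exists>n. prime_product R n a" if "a \<in> R" "a \<noteq> 0" for a using F that by (auto simp: factorial_in_def)
  let ?P = "polys_over R"
  have SP: "subring ?P" by (rule subring_polys_over[OF R])
  note PR = subringD[OF SP]
  have pP: "p \<in> ?P" and p0: "p \<noteq> 0" using p d by (auto simp: primitive_in_def)
  have nu: "\<not> unit_in ?P p"
  proof
    assume "unit_in ?P p"
    then obtain c where c: "1 = p * c" by (auto simp: unit_in_def dvd_in_def)
    then have "c \<noteq> 0" by auto
    then have "degree (p * c) = degree p + degree c" by (intro degree_mult_eq p0)
    then show False using d unfolding c[symmetric] by simp
  qed
  have main: "dvd_in ?P p b" if aP: "a \<in> ?P" and bP: "b \<in> ?P" and ab: "dvd_in ?P p (a * b)"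
    and na: "\<not> dvd_in ?P p a" for a b
  proof -
    define J where "J h \<longleftrightarrow> h \<noteq> 0 \<and> (\<exists>\<alpha>\<in>?P. \<exists>\<beta>\<in>?P. h = \<alpha> * p + \<beta> * a)" for h
    have "J p" unfolding J_def using p0 PR by (intro conjI bexI[of _ 1] bexI[of _ 0]) auto
    then obtain h where h: "J h" "\<And>h'. J h' \<Longrightarrow> degree h \<le> degree h'"
      using ex_has_least_nat[of J p degree] by blast
    then obtain \<alpha> \<beta> where ab': "\<alpha> \<in> ?P" "\<beta> \<in> ?P" "h = \<alpha> * p + \<beta> * a" and h0: "h \<noteq> 0"
      by (auto simp: J_def)
    have hP: "h \<in> ?P" unfolding ab'(3) using ab' pP aP by (blast intro: PR)
    have divides: "\<exists>c q. c \<in> R \<and> c \<noteq> 0 \<and> q \<in> ?P \<and> [:c:] * f = h * q"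
      if f: "f = \<gamma> * p + \<delta> * a" "\<gamma> \<in> ?P" "\<delta> \<in> ?P" for f \<gamma> \<delta>
    proof -
      have fP: "f \<in> ?P" unfolding f(1) using f pP aP by (blast intro: PR)
      obtain c q r where c: "c \<in> R" "c \<noteq> 0" "q \<in> ?P" "r \<in> ?P"
        "[:c:] * f = h * q + r" "r = 0 \<or> degree r < degree h"
        using polys_over_pseudo_division[OF R hP h0 fP] by blast
      have cP: "[:c:] \<in> ?P" using c(1) const_in_polys_over[OF R] by blast
      have "r = ([:c:] * \<gamma> - q * \<alpha>) * p + ([:c:] * \<delta> - q * \<beta>) * a"
      proof -
        have "r = [:c:] * f - h * q" using c(5) by simp
        also have "\<dots> = ([:c:] * \<gamma> - q * \<alpha>) * p + ([:c:] * \<delta> - q * \<beta>) * a"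
          unfolding f(1) ab'(3) by (simp only: algebra_simps)
        finally show ?thesis .
      qed
      moreover have "[:c:] * \<gamma> - q * \<alpha> \<in> ?P" "[:c:] * \<delta> - q * \<beta> \<in> ?P"
        using cP f c ab' by (blast intro: PR)+
      ultimately have "r \<noteq> 0 \<Longrightarrow> J r" unfolding J_def by blast
      then have "r = 0" using h(2)[of r] c(6) by force
      then show ?thesis using c by auto
    qed
    have "p = 1 * p + 0 * a" by simp
    from divides[OF this PR(2) PR(1)] obtain c q where c: "c \<in> R" "c \<noteq> 0" "q \<in> ?P" "[:c:] * p = h * q" by blast
    have "a = 0 * p + 1 * a" by simp
    from divides[OF this PR(1) PR(2)] obtain c' q' where c': "c' \<in> R" "c' \<noteq> 0" "q' \<in> ?P" "[:c':] * a = h * q'" by blast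
    have cancel: "\<exists>w\<in>?P. z = [:k:] * w"
      if "primitive_in R g" "k \<in> R" "k \<noteq> 0" "z \<in> ?P" "g * z = [:k:] * y" "y \<in> ?P" for g k z y
      using primitive_cancel[OF R that(1)] fac[OF that(2,3)] that(4-6) unfolding dvd_in_def by blast
    show ?thesis
    proof (cases "degree h = 0")
      case True
      then obtain k where k: "h = [:k:]" by (auto elim: degree_eq_zeroE)
      have kR: "k \<in> R" "k \<noteq> 0" using hP h0 k const_in_polys_over[OF R] by auto
      obtain v where v: "v \<in> ?P" "a * b = p * v" using ab by (auto simp: dvd_in_def)
      \<comment> \<open>The ideal contains the constant \<open>k\<close>. Since \<open>p\<close>
        divides \<open>a * b\<close>, it divides \<open>k * b\<close>, and \<open>k\<close> cancels
        because \<open>p\<close> is primitive.\<close>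
      have eq: "p * (\<alpha> * b + \<beta> * v) = [:k:] * b"
      proof -
        have "[:k:] * b = \<alpha> * p * b + \<beta> * (a * b)" unfolding k[symmetric] ab'(3) by (simp only: algebra_simps)
        then show ?thesis unfolding v(2) by (simp only: algebra_simps)
      qed
      have w: "\<alpha> * b + \<beta> * v \<in> ?P" using ab' bP v by (blast intro: PR)
      from cancel[OF p kR w eq bP] obtain w' where w': "w' \<in> ?P" "\<alpha> * b + \<beta> * v = [:k:] * w'" by blast
      have "[:k:] * (p * w') = [:k:] * b" using eq unfolding w'(2) by (simp only: mult.left_commute)
      then have "p * w' = b" using kR(2) by (simp only: mult_cancel_left) simp
      then show ?thesis using w' by (auto simp: dvd_in_def)
    next
      case False
      \<comment> \<open>The primitive part \<open>h0'\<close> of \<open>h\<close> is a nonconstant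
        factor of \<open>p\<close>, hence equal to \<open>p\<close> up to a unit; as it also divides
        \<open>a\<close>, so does \<open>p\<close>.\<close>
      have "lead_coeff h \<in> R" "lead_coeff h \<noteq> 0" using hP h0 by (auto simp: polys_over_def)
      then obtain k n h0' where k: "prime_product R n k" "primitive_in R h0'" "h = [:k:] * h0'"
        using primitive_decomposition[OF R _ hP] fac by blast
      have kR: "k \<in> R" "k \<noteq> 0" using prime_product_in[OF R k(1)] prime_product_nz[OF k(1)] by auto
      have kP: "[:k:] \<in> ?P" using kR const_in_polys_over[OF R] by blast
      have h0P: "h0' \<in> ?P" using k by (simp add: primitive_in_def)
      have deg: "degree h = degree h0'" using kR unfolding k(3) by simp
      have extr: "\<exists>w\<in>?P. f = h0' * w" if f: "[:e:] * f = h * z" "e \<in> R" "e \<noteq> 0" "z \<in> ?P" "f \<in> ?P" for e f z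
      proof -
        have eq: "h0' * ([:k:] * z) = [:e:] * f" unfolding f(1) k(3) by (simp only: mult.commute mult.left_commute)
        have "[:k:] * z \<in> ?P" using kP f by (blast intro: PR)
        from cancel[OF k(2) f(2,3) this eq f(5)] obtain w where w: "w \<in> ?P" "[:k:] * z = [:e:] * w" by blast
        have "[:e:] * (h0' * w) = [:e:] * f" using eq unfolding w(2) by (simp only: mult.left_commute)
        then have "h0' * w = f" using f(3) by (simp only: mult_cancel_left) simp
        then show ?thesis using w by blast
      qed
      obtain q1 where q1: "q1 \<in> ?P" "p = h0' * q1" using extr[OF c(4,1,2,3) pP] by blast
      obtain a1 where a1: "a1 \<in> ?P" "a = h0' * a1" using extr[OF c'(4,1,2,3) aP] by blast
      have nz: "h0' \<noteq> 0" "q1 \<noteq> 0" using q1 p0 by auto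
      have "degree p = degree h0' + degree q1" unfolding q1(2) by (rule degree_mult_eq[OF nz])
      then have "degree q1 = 0" using irr[OF h0P q1(1) q1(2)] False deg by linarith
      then obtain u where u: "q1 = [:u:]" by (auto elim: degree_eq_zeroE)
      have uR: "u \<in> R" "u \<noteq> 0" using q1 nz u const_in_polys_over[OF R] by auto
      then obtain m where m: "prime_product R m u" using fac by blast
      have "unit_in R u"
        using m
      proof cases
        case (step \<pi> n' a')
        have "[:u:] = [:\<pi>:] * [:a':]" using step by simp
        then have "p = [:\<pi>:] * ([:a':] * h0')" unfolding q1(2) u by (simp only: mult.commute mult.left_commute)
        moreover have "[:a':] * h0' \<in> ?P"
          using h0P prime_product_in[OF R step(4)] const_in_polys_over[OF R] by (blast intro: PR)
        ultimately have "dvd_in ?P [:\<pi>:] p" unfolding dvd_in_def by blast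
        then show ?thesis using p step by (auto simp: primitive_in_def)
      qed
      then obtain v where v: "v \<in> R" "1 = u * v" by (auto simp: unit_in_def dvd_in_def)
      have "[:u:] * [:v:] = 1" using v by (simp add: one_pCons mult.commute)
      then have "h0' = p * [:v:]" unfolding q1(2) u by (simp only: mult.assoc mult_1_right)
      then have "a = p * ([:v:] * a1)" using a1 by (simp only: mult.assoc)
      moreover have "[:v:] * a1 \<in> ?P" using a1 v const_in_polys_over[OF R] by (blast intro: PR)
      ultimately have "dvd_in ?P p a" unfolding dvd_in_def by blast
      then show ?thesis using na by blast
    qed
  qed
  show ?thesis unfolding prime_in_def using pP p0 nu main by blast
qed

lemma prime_product_const:
  assumes R: "subring R"
  shows "prime_product R n c \<Longrightarrow> prime_product (polys_over R) n [:c:]"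
proof (induction rule: prime_product.induct)
  case (unit u n)
  then obtain v where v: "u \<in> R" "v \<in> R" "1 = u * v" by (auto simp: unit_in_def dvd_in_def)
  have "1 = [:u:] * [:v:]" using v by (simp add: one_pCons mult.commute)
  then show ?case using v const_in_polys_over[OF R]
    by (intro prime_product.unit) (unfold unit_in_def dvd_in_def, blast)
next
  case (step p n a)
  from prime_product.step[OF prime_in_const[OF R step(1)] step(3)] show ?case by (simp add: mult.commute)
qed

text \<open>After the content is split off, the primitive part either has a factorization into lower
  degrees, where induction applies, or is prime.\<close>

theorem factorial_in_polys_over:
  assumes F: "factorial_in R"
  shows "factorial_in (polys_over R)"
proof -
  have R: "subring R" using F by (simp add: factorial_in_def)
  have fac: "\<exists>n. prime_product R n a" if "a \<in> R" "a \<noteq> 0" for a using F that by (auto simp: factorial_in_def)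
  let ?P = "polys_over R"
  have SP: "subring ?P" by (rule subring_polys_over[OF R])
  have "\<exists>n. prime_product ?P n a" if "a \<in> ?P" "a \<noteq> 0" for a
    using that
  proof (induction "degree a" arbitrary: a rule: less_induct)
    case less
    have "lead_coeff a \<in> R" "lead_coeff a \<noteq> 0" using less.prems by (auto simp: polys_over_def)
    then obtain k n p where k: "prime_product R n k" "primitive_in R p" "a = [:k:] * p"
      using primitive_decomposition[OF R _ less.prems(1)] fac by blast
    have k0: "k \<noteq> 0" by (rule prime_product_nz[OF k(1)])
    have p0: "p \<noteq> 0" and pP: "p \<in> ?P" using less.prems k by (auto simp: primitive_in_def)
    have deg: "degree a = degree p" using k0 unfolding k(3) by simp
    have "\<exists>m. prime_product ?P m p"
    proof (cases "degree p = 0")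
      case True
      then obtain c where c: "p = [:c:]" by (auto elim: degree_eq_zeroE)
      then have "c \<in> R" "c \<noteq> 0" using pP p0 const_in_polys_over[OF R] by auto
      then show ?thesis using fac prime_product_const[OF R] c by blast
    next
      case False
      show ?thesis
      proof (cases "\<exists>x\<in>?P. \<exists>y\<in>?P. p = x * y \<and> degree x < degree p \<and> degree y < degree p")
        case True
        then obtain x y where xy: "x \<in> ?P" "y \<in> ?P" "p = x * y" "degree x < degree p" "degree y < degree p" by blast
        then have "x \<noteq> 0" "y \<noteq> 0" using p0 by auto
        then obtain m m' where "prime_product ?P m x" "prime_product ?P m' y"
          using less.hyps xy deg by metis
        then show ?thesis using prime_product_mult[OF _ SP] xy(3) by blast
      next
        case False
        then have "prime_in ?P p"
          using prime_in_of_irreducible_primitive[OF F k(2)] \<open>degree p \<noteq> 0\<close> by blast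
        moreover have "prime_product ?P 0 1"
          using SP by (intro prime_product.unit) (auto simp: unit_in_def dvd_in_def subringD intro!: bexI[of _ 1])
        ultimately show ?thesis using prime_product.step by fastforce
      qed
    qed
    then show ?case using prime_product_mult[OF prime_product_const[OF R k(1)] SP] k(3) by blast
  qed
  then show ?thesis using SP by (auto simp: factorial_in_def)
qed

text \<open>Injectivity is asked for on \<open>R\<close> only: evaluation of polynomials at a
  variable is injective just on those whose coefficients are free of that variable.\<close>

lemma factorial_in_transfer:
  fixes \<phi> :: "'a::idom \<Rightarrow> 'b::idom"
  assumes F: "factorial_in R" and add: "\<And>a b. \<phi> (a + b) = \<phi> a + \<phi> b" and mult: "\<And>a b. \<phi> (a * b) = \<phi> a * \<phi> b"
    and one: "\<phi> 1 = 1" and inj: "\<And>a. a \<in> R \<Longrightarrow> \<phi> a = 0 \<Longrightarrow> a = 0"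
  shows "factorial_in (\<phi> ` R)"
proof -
  have R: "subring R" using F by (simp add: factorial_in_def)
  have zero: "\<phi> 0 = 0" using add[of 0 0] by (metis add_cancel_right_right)
  have diff: "\<phi> (a - b) = \<phi> a - \<phi> b" for a b using add[of "a - b" b] by (simp add: algebra_simps)
  have SR: "subring (\<phi> ` R)"
    unfolding subring_def
  proof (intro conjI ballI)
    show "0 \<in> \<phi> ` R" "1 \<in> \<phi> ` R" using zero one R by (auto simp: subringD intro!: rev_image_eqI)
    fix a b assume "a \<in> \<phi> ` R" "b \<in> \<phi> ` R"
    then obtain x y where "x \<in> R" "y \<in> R" "a = \<phi> x" "b = \<phi> y" by blast
    then show "a + b \<in> \<phi> ` R" "a - b \<in> \<phi> ` R" "a * b \<in> \<phi> ` R"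
      using R by (auto simp: add[symmetric] mult[symmetric] diff[symmetric] subringD)
  qed
  have inj2: "a = b" if "a \<in> R" "b \<in> R" "\<phi> a = \<phi> b" for a b
    using inj[of "a - b"] that diff R by (simp add: subringD)
  have dvd: "dvd_in (\<phi> ` R) (\<phi> a) (\<phi> b) \<longleftrightarrow> dvd_in R a b" if "a \<in> R" "b \<in> R" for a b
  proof
    assume "dvd_in (\<phi> ` R) (\<phi> a) (\<phi> b)"
    then obtain c where "c \<in> R" "\<phi> b = \<phi> (a * c)" by (auto simp: dvd_in_def mult)
    then show "dvd_in R a b" using inj2 that R by (auto simp: dvd_in_def subringD intro!: bexI[of _ c])
  qed (auto simp: dvd_in_def mult)
  have unit: "unit_in (\<phi> ` R) (\<phi> a) \<longleftrightarrow> unit_in R a" if "a \<in> R" for a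
    using dvd[OF that subringD(2)[OF R]] that by (auto simp: unit_in_def one)
  have prime: "prime_in (\<phi> ` R) (\<phi> p)" if "prime_in R p" for p
    using that inj[of p] unit[of p] dvd R by (auto simp: prime_in_def mult[symmetric] subringD)
  have "prime_product R n a \<Longrightarrow> prime_product (\<phi> ` R) n (\<phi> a)" for n a
  proof (induction rule: prime_product.induct)
    case (unit u n)
    then show ?case using \<open>\<And>a. a \<in> R \<Longrightarrow> unit_in (\<phi> ` R) (\<phi> a) \<longleftrightarrow> unit_in R a\<close>[of u]
      by (intro prime_product.unit) (auto simp: unit_in_def)
  qed (auto simp: mult intro: prime_product.step prime)
  then have "\<exists>n. prime_product (\<phi> ` R) n b" if "b \<in> \<phi> ` R" "b \<noteq> 0" for b
    using that F zero by (auto simp: factorial_in_def) metis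
  then show ?thesis using SR by (auto simp: factorial_in_def)
qed

section \<open>The integral domain of polynomial functions\<close>

typedef (overloaded) 'a pfun = "{f :: 'a::euclidean_space \<Rightarrow> real. PF f}"
  by (rule exI[of _ "\<lambda>x. 0"]) auto

setup_lifting type_definition_pfun

instantiation pfun :: (euclidean_space) idom
begin

lift_definition zero_pfun :: "'a pfun" is "\<lambda>x. 0" by auto
lift_definition one_pfun :: "'a pfun" is "\<lambda>x. 1" by auto
lift_definition plus_pfun :: "'a pfun \<Rightarrow> 'a pfun \<Rightarrow> 'a pfun" is "\<lambda>f g x. f x + g x"
  by (rule real_polynomial_function.intros(3))
lift_definition minus_pfun :: "'a pfun \<Rightarrow> 'a pfun \<Rightarrow> 'a pfun" is "\<lambda>f g x. f x - g x"
  by (rule real_polynomial_function_diff)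
lift_definition uminus_pfun :: "'a pfun \<Rightarrow> 'a pfun" is "\<lambda>f x. - f x"
  by (rule real_polynomial_function_minus)
lift_definition times_pfun :: "'a pfun \<Rightarrow> 'a pfun \<Rightarrow> 'a pfun" is "\<lambda>f g x. f x * g x"
  by (rule real_polynomial_function.intros(4))

instance
proof
  fix a b c :: "'a pfun"
  show "a * b * c = a * (b * c)" "a * b = b * a" "1 * a = a" "a + b + c = a + (b + c)" "a + b = b + a"
    "0 + a = a" "- a + a = 0" "a - b = a + - b" "(a + b) * c = a * c + b * c"
    "a * (b + c) = a * b + a * c" "0 * a = 0" "a * 0 = 0" "(0::'a pfun) \<noteq> 1"
    by (transfer; simp add: fun_eq_iff algebra_simps)+
  show "a * b \<noteq> 0" if "a \<noteq> 0" "b \<noteq> 0"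
    using that
  proof transfer
    fix f g :: "'a \<Rightarrow> real"
    assume fg: "PF f" "PF g" "f \<noteq> (\<lambda>x. 0)" "g \<noteq> (\<lambda>x. 0)"
    then obtain u v where uv: "f u \<noteq> 0" "g v \<noteq> 0" unfolding fun_eq_iff by blast
    show "(\<lambda>x. f x * g x) \<noteq> (\<lambda>x. 0)"
    proof
      assume "(\<lambda>x. f x * g x) = (\<lambda>x. 0)"
      then have "f x * g x = 0" for x by (rule fun_cong)
      then show False using PF_mult_eq_0[OF fg(1,2) _ uv(1), of v] uv(2) by blast
    qed
  qed
qed

end

lift_definition coord :: "'n \<Rightarrow> (real^'n) pfun" is "\<lambda>i x. x $ i" by (rule PF_nth)

lift_definition const_pfun :: "real \<Rightarrow> 'a::euclidean_space pfun" is "\<lambda>c x. c" by auto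

lift_definition ev :: "'a::euclidean_space pfun \<Rightarrow> 'a \<Rightarrow> real" is "\<lambda>f. f" .

lemma ev_simps [simp]: "ev 0 x = 0" "ev 1 x = 1" "ev (a + b) x = ev a x + ev b x" "ev (a - b) x = ev a x - ev b x"
  "ev (a * b) x = ev a x * ev b x" "ev (const_pfun c) x = c" "ev (coord i) y = y $ i"
  by (transfer; simp)+

lemma ev_power [simp]: "ev (a ^ k) x = ev a x ^ k"
  by (induction k) auto

lemma pfun_eqI: "(\<And>x. ev a x = ev b x) \<Longrightarrow> a = b"
  by transfer (simp add: fun_eq_iff)

lemma PF_ev: "PF (ev a)"
  by transfer simp

lemma PF_ex_pfun: "PF f \<Longrightarrow> \<exists>a. f = ev a"
  by transfer auto

text \<open>Iterated adjunction of variables, realized inside a single type: polynomials whose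
  coefficients involve only the remaining variables are evaluated at \<open>coord i\<close>.\<close>

fun pfuns_in :: "'n::finite list \<Rightarrow> (real^'n) pfun set" where
  "pfuns_in [] = range const_pfun"
| "pfuns_in (i # is) = (\<lambda>p. poly p (coord i)) ` polys_over (pfuns_in is)"

lemma pfuns_in_depend:
  "a \<in> pfuns_in is \<Longrightarrow> (\<And>i. i \<in> set is \<Longrightarrow> x $ i = y $ i) \<Longrightarrow> ev a x = ev a y"
proof (induction "is" arbitrary: a)
  case (Cons i "is")
  then obtain p where p: "p \<in> polys_over (pfuns_in is)" "a = poly p (coord i)" by auto
  then have c: "ev (coeff p k) x = ev (coeff p k) y" for k
    using Cons.IH Cons.prems(2) by (auto simp: polys_over_def)
  have "ev (\<Sum>k\<le>n. coeff p k * coord i ^ k) x = ev (\<Sum>k\<le>n. coeff p k * coord i ^ k) y" for n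
    by (induction n) (use c Cons.prems(2) in auto)
  then show ?case unfolding p(2) poly_altdef by blast
qed auto

lemma ev_poly: "ev (poly p a) x = poly (map_poly (\<lambda>c. ev c x) p) (ev a x)"
  by (induction p) (auto simp: map_poly_pCons)

lemma factorial_pfuns_in: "distinct is \<Longrightarrow> factorial_in (pfuns_in is :: (real^'n) pfun set)"
proof (induction "is")
  case Nil
  have u: "unit_in (range const_pfun) a" if a: "a \<in> range const_pfun" "a \<noteq> 0" for a :: "(real^'n) pfun"
  proof -
    obtain c where c: "a = const_pfun c" using a(1) by blast
    then have "c \<noteq> 0" using a by (auto intro!: pfun_eqI)
    then have "1 = a * const_pfun (1 / c)" using c by (auto intro!: pfun_eqI)
    then show ?thesis using a by (auto simp: unit_in_def dvd_in_def)
  qed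
  have c: "const_pfun a + const_pfun b = const_pfun (a + b)" "const_pfun a - const_pfun b = const_pfun (a - b)"
    "const_pfun a * const_pfun b = const_pfun (a * b)" "0 = const_pfun 0" "1 = const_pfun 1" for a b
    by (auto intro!: pfun_eqI)
  have "subring (range const_pfun)"
    unfolding subring_def by (auto simp: c)
  then show ?case using u by (auto simp: factorial_in_def intro: prime_product.unit)
next
  case (Cons i "is")
  then have F: "factorial_in (polys_over (pfuns_in is))" by (intro factorial_in_polys_over) auto
  show ?case unfolding pfuns_in.simps
  proof (rule factorial_in_transfer[OF F])
    fix p assume p: "p \<in> polys_over (pfuns_in is)" "poly p (coord i) = 0"
    have "coeff p k = 0" for k
    proof (rule pfun_eqI)
      fix x
      have "poly (map_poly (\<lambda>c. ev c x) p) t = 0" for t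
      proof -
        \<comment> \<open>Only the coordinate \<open>i\<close> is moved. The coefficients do not
          depend on it, so one univariate polynomial vanishes at every \<open>t\<close>.\<close>
        define y where "y = (\<chi> j. if j = i then t else x $ j)"
        have "ev (coeff p k) y = ev (coeff p k) x" for k
          by (rule pfuns_in_depend[of _ "is"]) (use p(1) Cons.prems in \<open>auto simp: polys_over_def y_def\<close>)
        then have "map_poly (\<lambda>c. ev c x) p = map_poly (\<lambda>c. ev c y) p"
          by (auto simp: poly_eq_iff coeff_map_poly)
        moreover have "ev (poly p (coord i)) y = 0" using p(2) by simp
        then have "poly (map_poly (\<lambda>c. ev c y) p) (y $ i) = 0" by (simp add: ev_poly)
        ultimately show ?thesis by (simp add: y_def)
      qed
      then have "map_poly (\<lambda>c. ev c x) p = 0" using poly_all_0_iff_0 by blast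
      then show "ev (coeff p k) x = ev 0 x" by (metis coeff_0 coeff_map_poly ev_simps(1))
    qed
    then show "p = 0" by (simp add: poly_eq_iff)
  qed auto
qed

lemma pfuns_in_contains:
  assumes "distinct is"
  shows "const_pfun c \<in> pfuns_in is" "i \<in> set is \<Longrightarrow> coord i \<in> pfuns_in is"
proof -
  show c: "const_pfun c \<in> pfuns_in is" for c using assms
  proof (induction "is")
    case (Cons j js)
    then have "[:const_pfun c:] \<in> polys_over (pfuns_in js)"
      using factorial_pfuns_in[of js] const_in_polys_over by (auto simp: factorial_in_def)
    then show ?case by (auto intro!: rev_image_eqI)
  qed auto
  show "i \<in> set is \<Longrightarrow> coord i \<in> pfuns_in is" using assms
  proof (induction "is")
    case (Cons j js)
    have R: "subring (pfuns_in js)" using factorial_pfuns_in[of js] Cons by (auto simp: factorial_in_def)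
    show ?case
    proof (cases "i = j")
      case True
      have "[:0, 1:] \<in> polys_over (pfuns_in js)"
        using subringD(1,2)[OF R] by (auto simp: polys_over_def coeff_pCons split: nat.splits)
      then show ?thesis using True by (auto intro!: rev_image_eqI)
    next
      case False
      then have "[:coord i:] \<in> polys_over (pfuns_in js)" using Cons const_in_polys_over[OF R] by auto
      then show ?thesis by (auto intro!: rev_image_eqI)
    qed
  qed auto
qed

theorem factorial_pfun: "factorial_in (UNIV :: (real^'n) pfun set)"
proof -
  obtain xs where xs: "set xs = (UNIV :: 'n set)" "distinct xs" using finite_distinct_list[OF finite[of "UNIV :: 'n set"]] by blast
  have F: "factorial_in (pfuns_in xs)" by (rule factorial_pfuns_in[OF xs(2)])
  then have R: "subring (pfuns_in xs)" by (simp add: factorial_in_def)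
  have c: "const_pfun c \<in> pfuns_in xs" "coord i \<in> pfuns_in xs" for c i
    by (rule pfuns_in_contains(1)[OF xs(2)], rule pfuns_in_contains(2)[OF xs(2)]) (simp add: xs(1))
  have pw: "a \<in> pfuns_in xs \<Longrightarrow> a ^ k \<in> pfuns_in xs" for a k by (induction k) (auto simp: subringD[OF R])
  have pr: "(\<And>i. i \<in> S \<Longrightarrow> f i \<in> pfuns_in xs) \<Longrightarrow> prod f S \<in> pfuns_in xs" for f and S :: "'n set"
    by (induction S rule: infinite_finite_induct) (auto simp: subringD[OF R])
  have "a \<in> pfuns_in xs" for a
  proof -
    obtain K c where K: "finite K" "ev a = (\<lambda>x. \<Sum>m\<in>K. c m * monom_fun m x)"
      by (rule PF_monomials[OF PF_ev[of a]])
    have es: "ev (sum f S) x = (\<Sum>i\<in>S. ev (f i) x)" for f :: "('n \<Rightarrow>\<^sub>0 nat) \<Rightarrow> (real^'n) pfun" and S x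
      by (induction S rule: infinite_finite_induct) auto
    have ep: "ev (prod f S) x = (\<Prod>i\<in>S. ev (f i) x)" for f :: "'n \<Rightarrow> (real^'n) pfun" and S x
      by (induction S rule: infinite_finite_induct) auto
    have "a = (\<Sum>m\<in>K. const_pfun (c m) * (\<Prod>i\<in>UNIV. coord i ^ Poly_Mapping.lookup m i))"
      by (rule pfun_eqI) (simp add: K(2) monom_fun_def es ep)
    also have "\<dots> \<in> pfuns_in xs"
      by (intro subring_sum[OF R] subringD(5)[OF R] c pr pw)
    finally show ?thesis .
  qed
  then have "pfuns_in xs = UNIV" by blast
  with F show ?thesis by simp
qed

section \<open>Divisibility and primes among polynomial functions\<close>

definition pdvd :: "(real^'n \<Rightarrow> real) \<Rightarrow> (real^'n \<Rightarrow> real) \<Rightarrow> bool" where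
  "pdvd a b \<longleftrightarrow> (\<exists>c. PF c \<and> (\<forall>x. b x = a x * c x))"

definition pprime :: "(real^'n \<Rightarrow> real) \<Rightarrow> bool" where
  "pprime q \<longleftrightarrow> PF q \<and> (\<exists>x. q x \<noteq> 0) \<and> \<not> pdvd q (\<lambda>x. 1) \<and>
     (\<forall>a b. PF a \<longrightarrow> PF b \<longrightarrow> pdvd q (\<lambda>x. a x * b x) \<longrightarrow> pdvd q a \<or> pdvd q b)"

text \<open>A fraction \<open>p / s\<close> that is not a polynomial has a pole along some prime
  \<open>q\<close>: the multiplicity \<open>m\<close> in the denominator exceeds the multiplicity
  \<open>i\<close> in the numerator.\<close>

theorem not_pdvd_prime:
  fixes s p :: "real^'n \<Rightarrow> real"
  assumes "PF s" "PF p" "\<exists>x. s x \<noteq> 0" "\<not> pdvd s p"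
  obtains q m s' i p' where "pprime q" "i < m" "PF s'" "PF p'" "\<not> pdvd q s'" "\<not> pdvd q p'"
    "\<And>x. s x = q x ^ m * s' x" "\<And>x. p x = q x ^ i * p' x"
proof -
  note F = factorial_pfun[where 'n = 'n]
  then have R: "subring (UNIV :: (real^'n) pfun set)" by (simp add: factorial_in_def)
  have dvd: "pdvd (ev a) (ev b) \<longleftrightarrow> dvd_in UNIV a b" for a b :: "(real^'n) pfun"
  proof
    assume "pdvd (ev a) (ev b)"
    then obtain c where "PF c" "\<forall>x. ev b x = ev a x * c x" by (auto simp: pdvd_def)
    then obtain d where "\<forall>x. ev b x = ev a x * ev d x" using PF_ex_pfun by metis
    then have "b = a * d" by (intro pfun_eqI) simp
    then show "dvd_in UNIV a b" by (auto simp: dvd_in_def)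
  next
    assume "dvd_in UNIV a b"
    then obtain c where "b = a * c" by (auto simp: dvd_in_def)
    then show "pdvd (ev a) (ev b)" using PF_ev[of c] unfolding pdvd_def by (intro exI[of _ "ev c"]) simp
  qed
  have prime: "pprime (ev q)" if q: "prime_in UNIV q" for q :: "(real^'n) pfun"
    unfolding pprime_def
  proof (intro conjI allI impI)
    show "PF (ev q)" by (rule PF_ev)
    show "\<exists>x. ev q x \<noteq> 0" using q by (auto simp: prime_in_def intro: pfun_eqI)
    have "\<not> dvd_in UNIV q 1" using q by (auto simp: prime_in_def unit_in_def)
    moreover have "ev 1 = (\<lambda>x::real^'n. 1)" by auto
    ultimately show "\<not> pdvd (ev q) (\<lambda>x. 1)" using dvd[of q 1] by metis
    fix a b :: "real^'n \<Rightarrow> real" assume "PF a" "PF b" and ab: "pdvd (ev q) (\<lambda>x. a x * b x)"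
    then obtain a' b' where a': "a = ev a'" "b = ev b'" using PF_ex_pfun by metis
    have "(\<lambda>x. a x * b x) = ev (a' * b')" by (auto simp: a')
    then have "dvd_in UNIV q (a' * b')" using ab dvd by metis
    then show "pdvd (ev q) a \<or> pdvd (ev q) b" using q by (auto simp: a' dvd prime_in_def)
  qed
  obtain S P where S: "s = ev S" "p = ev P" using assms PF_ex_pfun by metis
  have nd: "\<not> dvd_in UNIV S P" using assms(4) dvd by (simp add: S)
  have "S \<noteq> 0" using assms(3) by (auto simp: S)
  moreover have "P \<noteq> 0" using nd dvd_in_0[OF R] by auto
  ultimately obtain n n' where n: "prime_product UNIV n S" "prime_product UNIV n' P"
    using F unfolding factorial_in_def by blast
  obtain q k where q: "prime_in UNIV q" "dvd_in UNIV (q ^ Suc k) S" "\<not> dvd_in UNIV (q ^ Suc k) P"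
    using not_dvd_in_prime_power[OF R n(1) UNIV_I nd] by blast
  obtain m S' where m: "S = q ^ m * S'" "\<not> dvd_in UNIV q S'" using prime_multiplicity[OF R q(1) n(1)] by blast
  obtain i P' where i: "P = q ^ i * P'" "\<not> dvd_in UNIV q P'" using prime_multiplicity[OF R q(1) n(2)] by blast
  have q0: "q \<noteq> 0" using q by (simp add: prime_in_def)
  have "i \<le> k"
  proof (rule ccontr)
    assume "\<not> i \<le> k"
    then have "q ^ i = q ^ Suc k * q ^ (i - Suc k)" by (metis le_add_diff_inverse not_less_eq_eq power_add)
    then show False using q(3) i(1) by (auto simp: dvd_in_def mult.assoc)
  qed
  moreover have "Suc k \<le> m"
  proof (rule ccontr)
    assume "\<not> Suc k \<le> m"
    then have "Suc k = m + Suc (k - m)" by simp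
    then have eq: "q ^ Suc k = q ^ m * (q * q ^ (k - m))" by (metis power_add power_Suc)
    obtain c where "S = q ^ Suc k * c" using q(2) by (auto simp: dvd_in_def)
    then have "q ^ m * S' = q ^ m * (q * (q ^ (k - m) * c))" unfolding eq m(1) by (simp only: mult.assoc)
    then have "S' = q * (q ^ (k - m) * c)" using q0 by simp
    then show False using m(2) by (auto simp: dvd_in_def)
  qed
  ultimately have "i < m" by simp
  show ?thesis
  proof (rule that[of "ev q" i m "ev S'" "ev P'"])
    show "\<not> pdvd (ev q) (ev S')" "\<not> pdvd (ev q) (ev P')" using m i by (auto simp: dvd)
    show "s x = ev q x ^ m * ev S' x" "p x = ev q x ^ i * ev P' x" for x by (auto simp: S m i)
  qed (use \<open>i < m\<close> prime q PF_ev in auto)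
qed

section \<open>The Jacobian criterion\<close>

lemma linear_dependence:
  fixes a :: "'e \<Rightarrow> 'm \<Rightarrow> real"
  assumes "finite M" "finite E" "card M < card E"
  shows "\<exists>c. (\<exists>e\<in>E. c e \<noteq> 0) \<and> (\<forall>m\<in>M. (\<Sum>e\<in>E. c e * a e m) = 0)"
  using assms
proof (induction M arbitrary: E a rule: finite_induct)
  case empty
  then have "E \<noteq> {}" by auto
  then show ?case by (intro exI[of _ "\<lambda>_. 1"]) auto
next
  case (insert m M)
  show ?case
  proof (cases "\<forall>e\<in>E. a e m = 0")
    case True
    obtain c where "\<exists>e\<in>E. c e \<noteq> 0" "\<forall>m\<in>M. (\<Sum>e\<in>E. c e * a e m) = 0"
      using insert.IH[of E a] insert.prems insert.hyps by auto
    then show ?thesis using True by (intro exI[of _ c]) auto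
  next
    case False
    then obtain e0 where e0: "e0 \<in> E" "a e0 m \<noteq> 0" by auto
    define b where "b e k = a e k - a e m / a e0 m * a e0 k" for e k
    have "card M < card (E - {e0})" using insert.prems insert.hyps e0 by simp
    then obtain c where c: "\<exists>e\<in>E - {e0}. c e \<noteq> 0" "\<forall>k\<in>M. (\<Sum>e\<in>E - {e0}. c e * b e k) = 0"
      using insert.IH[of "E - {e0}" b] insert.prems by auto
    define c' where "c' e = (if e = e0 then - (\<Sum>e\<in>E - {e0}. c e * a e m) / a e0 m else c e)" for e
    have sum: "(\<Sum>e\<in>E. c' e * a e k) = (\<Sum>e\<in>E - {e0}. c e * b e k)" for k
    proof -
      have "(\<Sum>e\<in>E. c' e * a e k) = c' e0 * a e0 k + (\<Sum>e\<in>E - {e0}. c' e * a e k)"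
        using insert.prems e0 by (intro sum.remove) auto
      also have "(\<Sum>e\<in>E - {e0}. c' e * a e k) = (\<Sum>e\<in>E - {e0}. c e * a e k)"
        by (intro sum.cong) (auto simp: c'_def)
      also have "c' e0 * a e0 k = - (\<Sum>e\<in>E - {e0}. c e * (a e m / a e0 m * a e0 k))"
        by (simp add: c'_def sum_divide_distrib sum_distrib_right sum_distrib_left algebra_simps)
      finally show ?thesis by (simp add: b_def right_diff_distrib sum_subtractf)
    qed
    have "b e m = 0" for e using e0 by (simp add: b_def)
    then have "\<forall>k\<in>insert m M. (\<Sum>e\<in>E. c' e * a e k) = 0" using c(2) sum by simp
    moreover have "\<exists>e\<in>E. c' e \<noteq> 0" using c(1) by (auto simp: c'_def)
    ultimately show ?thesis by blast
  qed
qed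

text \<open>Bounding each exponent rather than the total degree makes the number of monomials an
  exact power, which keeps the dimension count below simple.\<close>

definition low_monomials :: "nat \<Rightarrow> ('n::finite \<Rightarrow>\<^sub>0 nat) set" where
  "low_monomials D = {m. \<forall>k. Poly_Mapping.lookup m k \<le> D}"

lemma lookup_Abs_finite: "Poly_Mapping.lookup (Abs_poly_mapping (f :: 'n::finite \<Rightarrow> nat)) = f"
  by (rule lookup_Abs_poly_mapping) simp

lemma low_monomials_card:
  "finite (low_monomials D :: ('n::finite \<Rightarrow>\<^sub>0 nat) set)"
  "card (low_monomials D :: ('n::finite \<Rightarrow>\<^sub>0 nat) set) = (D + 1) ^ CARD('n)"
proof -
  have bij: "bij_betw Poly_Mapping.lookup (low_monomials D :: ('n \<Rightarrow>\<^sub>0 nat) set) (UNIV \<rightarrow>\<^sub>E {..D})"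
    by (rule bij_betw_byWitness[of _ Abs_poly_mapping])
       (auto simp: low_monomials_def lookup_Abs_finite PiE_def Pi_def)
  have fin: "finite (UNIV \<rightarrow>\<^sub>E {..D} :: ('n \<Rightarrow> nat) set)" by (intro finite_PiE) auto
  show "finite (low_monomials D :: ('n \<Rightarrow>\<^sub>0 nat) set)"
    using bij_betw_finite[OF bij] fin by blast
  show "card (low_monomials D :: ('n \<Rightarrow>\<^sub>0 nat) set) = (D + 1) ^ CARD('n)"
    using bij_betw_same_card[OF bij] by (simp add: card_PiE)
qed

lemma keys_low_mult:
  "Poly_Mapping.keys p \<subseteq> low_monomials A \<Longrightarrow> Poly_Mapping.keys q \<subseteq> low_monomials B \<Longrightarrow>
    Poly_Mapping.keys (p * q :: 'n::finite rpoly) \<subseteq> low_monomials (A + B)"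
  using keys_mult[of p q] by (fastforce simp: low_monomials_def lookup_add intro: add_mono)

lemma keys_low_power:
  "Poly_Mapping.keys p \<subseteq> low_monomials A \<Longrightarrow> Poly_Mapping.keys (p ^ k :: 'n::finite rpoly) \<subseteq> low_monomials (k * A)"
proof (induction k)
  case 0
  then show ?case by (auto simp: low_monomials_def)
next
  case (Suc k)
  from keys_low_mult[OF Suc.prems Suc.IH[OF Suc.prems]] show ?case by simp
qed

lemma keys_low_prod:
  "finite S \<Longrightarrow> (\<And>i. i \<in> S \<Longrightarrow> Poly_Mapping.keys (p i) \<subseteq> low_monomials (A i)) \<Longrightarrow>
    Poly_Mapping.keys (\<Prod>i\<in>S. p i :: 'n::finite rpoly) \<subseteq> low_monomials (\<Sum>i\<in>S. A i)"
proof (induction S rule: finite_induct)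
  case empty
  then show ?case by (auto simp: low_monomials_def)
next
  case (insert i S)
  then show ?case using keys_low_mult[of "p i" "A i" "\<Prod>i\<in>S. p i" "\<Sum>i\<in>S. A i"] by simp
qed

lemma low_monomials_mono: "A \<le> B \<Longrightarrow> low_monomials A \<subseteq> low_monomials B"
  by (auto simp: low_monomials_def intro: order_trans)

text \<open>A dimension count, with n the number of variables: the \<open>(N + 1) ^ (n + 1)\<close>
  products of a power of x^i and a monomial in I with exponents at most \<open>N\<close> lie in a
  space of dimension \<open>(C * N + 1) ^ n\<close>, which is smaller for large
  \<open>N\<close>.\<close>

lemma algebraic_relation:
  fixes I :: "'n::finite \<Rightarrow> real^'n \<Rightarrow> real"
  assumes I: "\<And>j. PF (I j)"
  shows "\<exists>m w. (\<forall>s. PF (w s)) \<and> (\<exists>y. w m y \<noteq> 0) \<and> (\<forall>x. (\<Sum>s\<le>m. (x $ i) ^ s * w s (\<chi> j. I j x)) = 0)"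
proof -
  obtain p where p: "\<And>j. I j = poly_fun (p j)" using PF_imp_poly_fun[OF I] by metis
  have "\<exists>A. Poly_Mapping.keys q \<subseteq> low_monomials A" for q :: "'n rpoly"
  proof -
    have "Poly_Mapping.lookup m k \<le> (\<Sum>m\<in>Poly_Mapping.keys q. \<Sum>k\<in>UNIV. Poly_Mapping.lookup m k)"
      if "m \<in> Poly_Mapping.keys q" for m k
    proof -
      have "Poly_Mapping.lookup m k \<le> (\<Sum>k\<in>UNIV. Poly_Mapping.lookup m k)" by (rule member_le_sum) auto
      also have "\<dots> \<le> (\<Sum>m\<in>Poly_Mapping.keys q. \<Sum>k\<in>UNIV. Poly_Mapping.lookup m k)"
        using that by (intro member_le_sum) auto
      finally show ?thesis .
    qed
    then show ?thesis by (auto simp: low_monomials_def)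
  qed
  then have "\<forall>j. \<exists>A. Poly_Mapping.keys (p j) \<subseteq> low_monomials A" by blast
  from choice[OF this] obtain A where A: "\<And>j. Poly_Mapping.keys (p j) \<subseteq> low_monomials (A j)" by blast
  define C where "C = 1 + (\<Sum>j\<in>UNIV. A j)"
  \<comment> \<open>The dimension \<open>(C * N + 1) ^ n\<close> is at most
    \<open>C ^ n * (N + 1) ^ n\<close>; with \<open>N = C ^ n\<close> this is
    \<open>N * (N + 1) ^ n\<close>, just below the number of products.\<close>
  define N where "N = C ^ CARD('n)"
  define E where "E = {..N} \<times> (low_monomials N :: ('n \<Rightarrow>\<^sub>0 nat) set)"
  define q where "q = (\<lambda>(s, \<alpha>). Poly_Mapping.single (Poly_Mapping.single i 1) 1 ^ s *
      (\<Prod>j\<in>UNIV. p j ^ Poly_Mapping.lookup \<alpha> j))"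
  have finE: "finite E" unfolding E_def using low_monomials_card by auto
  have low: "Poly_Mapping.keys (q e) \<subseteq> low_monomials (C * N)" if e: "e \<in> E" for e
  proof -
    obtain s \<alpha> where s: "e = (s, \<alpha>)" "s \<le> N" "\<And>j. Poly_Mapping.lookup \<alpha> j \<le> N"
      using e by (auto simp: E_def low_monomials_def)
    have "Poly_Mapping.keys (Poly_Mapping.single (Poly_Mapping.single i (1::nat)) (1::real)) \<subseteq> low_monomials 1"
      by (auto simp: low_monomials_def lookup_single when_def)
    from keys_low_mult[OF keys_low_power[OF this, of s] keys_low_prod[of UNIV "\<lambda>j. p j ^ Poly_Mapping.lookup \<alpha> j", OF _ keys_low_power[OF A]]]
    have "Poly_Mapping.keys (q e) \<subseteq> low_monomials (s * 1 + (\<Sum>j\<in>UNIV. Poly_Mapping.lookup \<alpha> j * A j))"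
      by (simp add: q_def s)
    also have "\<dots> \<subseteq> low_monomials (C * N)"
    proof (rule low_monomials_mono)
      have "(\<Sum>j\<in>UNIV. Poly_Mapping.lookup \<alpha> j * A j) \<le> (\<Sum>j\<in>UNIV. N * A j)"
        by (intro sum_mono mult_right_mono s) auto
      then show "s * 1 + (\<Sum>j\<in>UNIV. Poly_Mapping.lookup \<alpha> j * A j) \<le> C * N"
        using s(2) by (simp add: C_def sum_distrib_left algebra_simps)
    qed
    finally show ?thesis .
  qed
  have "card (low_monomials (C * N) :: ('n \<Rightarrow>\<^sub>0 nat) set) < card E"
  proof -
    have "C * N + 1 \<le> C * (N + 1)" by (simp add: C_def)
    then have "(C * N + 1) ^ CARD('n) \<le> (C * (N + 1)) ^ CARD('n)" by (rule power_mono) simp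
    also have "\<dots> = N * (N + 1) ^ CARD('n)" by (simp only: power_mult_distrib N_def)
    also have "\<dots> < (N + 1) * (N + 1) ^ CARD('n)" by simp
    finally show ?thesis unfolding E_def card_cartesian_product low_monomials_card(2) by simp
  qed
  then obtain c where c: "\<exists>e\<in>E. c e \<noteq> 0"
    "\<forall>m\<in>low_monomials (C * N). (\<Sum>e\<in>E. c e * Poly_Mapping.lookup (q e) m) = 0"
    using linear_dependence[OF low_monomials_card(1) finE, of "C * N" "\<lambda>e. Poly_Mapping.lookup (q e)"] by blast
  have rel: "(\<Sum>e\<in>E. c e * poly_fun (q e) x) = 0" for x
  proof -
    have "(\<Sum>e\<in>E. c e * poly_fun (q e) x)
        = (\<Sum>e\<in>E. \<Sum>m\<in>low_monomials (C * N). c e * Poly_Mapping.lookup (q e) m * monom_fun m x)"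
      by (intro sum.cong refl) (simp add: poly_fun_superset[OF low_monomials_card(1) low] sum_distrib_left mult.assoc)
    also have "\<dots> = (\<Sum>m\<in>low_monomials (C * N). (\<Sum>e\<in>E. c e * Poly_Mapping.lookup (q e) m) * monom_fun m x)"
      by (subst sum.swap) (simp add: sum_distrib_right)
    finally show ?thesis using c(2) by simp
  qed
  define P where "P s = (\<Sum>\<alpha>\<in>low_monomials N. Poly_Mapping.single \<alpha> (c (s, \<alpha>)))" for s
  have qx: "poly_fun (q (s, \<alpha>)) x = (x $ i) ^ s * monom_fun \<alpha> (\<chi> j. I j x)" for s \<alpha> x
    using monom_fun_single[of i x]
    by (simp add: q_def poly_fun_mult poly_fun_power poly_fun_prod monom_fun_def[of \<alpha>] p)
  have rel2: "(\<Sum>s\<le>N. (x $ i) ^ s * poly_fun (P s) (\<chi> j. I j x)) = 0" for x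
  proof -
    have "(\<Sum>s\<le>N. \<Sum>\<alpha>\<in>low_monomials N. c (s, \<alpha>) * poly_fun (q (s, \<alpha>)) x) = 0"
      using rel[of x] by (simp add: E_def sum.cartesian_product case_prod_unfold)
    then show ?thesis by (simp add: P_def poly_fun_sum qx sum_distrib_left algebra_simps)
  qed
  obtain s0 \<alpha>0 where s0: "s0 \<le> N" "\<alpha>0 \<in> low_monomials N" "c (s0, \<alpha>0) \<noteq> 0" using c(1) by (auto simp: E_def)
  have "Poly_Mapping.lookup (P s0) \<alpha>0 = c (s0, \<alpha>0)"
    unfolding P_def lookup_sum lookup_single when_def using s0 by (simp add: sum.delta[OF low_monomials_card(1)])
  then have "P s0 \<noteq> 0" using s0 by auto
  \<comment> \<open>Cutting off after the last nonzero coefficient makes the leading coefficient of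
    the relation nonzero.\<close>
  define m where "m = Max {s. s \<le> N \<and> P s \<noteq> 0}"
  have fin: "finite {s. s \<le> N \<and> P s \<noteq> 0}" by simp
  have "m \<in> {s. s \<le> N \<and> P s \<noteq> 0}" unfolding m_def using fin \<open>P s0 \<noteq> 0\<close> s0 by (intro Max_in) auto
  then have m: "m \<le> N" "P m \<noteq> 0" by auto
  have above: "P s = 0" if "s > m" "s \<le> N" for s
  proof (rule ccontr)
    assume "P s \<noteq> 0"
    then have "s \<le> m" unfolding m_def using that(2) by (intro Max_ge[OF fin]) simp
    then show False using that(1) by simp
  qed
  have "(\<Sum>s\<le>m. (x $ i) ^ s * poly_fun (P s) (\<chi> j. I j x)) = 0" for x
  proof -
    have "(\<Sum>s\<le>N. (x $ i) ^ s * poly_fun (P s) (\<chi> j. I j x)) = (\<Sum>s\<le>m. (x $ i) ^ s * poly_fun (P s) (\<chi> j. I j x))"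
      by (rule sum.mono_neutral_right) (use m above in auto)
    then show ?thesis using rel2[of x] by simp
  qed
  moreover have "\<exists>y. poly_fun (P m) y \<noteq> 0" using m(2) poly_fun_eq_0_imp[of "P m"] by (auto simp: fun_eq_iff)
  ultimately show ?thesis using PF_poly_fun by (intro exI[of _ m] exI[of _ "\<lambda>s. poly_fun (P s)"]) blast
qed

lemma PF_common_nonzero:
  fixes u :: "'i \<Rightarrow> 'a::euclidean_space \<Rightarrow> real"
  shows "finite S \<Longrightarrow> (\<And>i. i \<in> S \<Longrightarrow> PF (u i)) \<Longrightarrow> (\<And>i. i \<in> S \<Longrightarrow> \<exists>x. u i x \<noteq> 0) \<Longrightarrow>
    \<exists>x. \<forall>i\<in>S. u i x \<noteq> 0"
proof (induction S rule: finite_induct)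
  case (insert i S)
  then obtain a where a: "\<forall>i\<in>S. u i a \<noteq> 0" by auto
  obtain b where b: "u i b \<noteq> 0" using insert.prems(2)[of i] by blast
  let ?p = "\<lambda>x. \<Prod>i\<in>S. u i x"
  have PFp: "PF ?p" using insert by (auto intro!: real_polynomial_function_prod)
  have "?p a \<noteq> 0" using a insert.hyps by simp
  have "\<exists>x. ?p x * u i x \<noteq> 0"
  proof (rule ccontr)
    assume "\<not> ?thesis"
    then have "?p x * u i x = 0" for x by blast
    from PF_mult_eq_0[OF PFp _ this \<open>?p a \<noteq> 0\<close>, of b] insert b show False by auto
  qed
  then show ?case using insert.hyps by auto
qed auto

definition jac :: "('n::finite \<Rightarrow> real^'n \<Rightarrow> real) \<Rightarrow> real^'n \<Rightarrow> real^'n^'n" where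
  "jac I x = (\<chi> j k. pd k (I j) x)"

text \<open>Take a relation of least degree for x^i over I and differentiate it with respect to x^k.
  The terms in which the power of x^i is differentiated form \<open>u\<close>, nonzero by
  minimality; the others combine the gradients of the I^j. So a matrix times the Jacobian is
  diagonal with the entries \<open>u i\<close>, and these are simultaneously nonzero
  somewhere.\<close>

theorem jacobian_nonzero:
  fixes I :: "'n::finite \<Rightarrow> real^'n \<Rightarrow> real"
  assumes I: "\<And>j. PF (I j)" and indep: "\<And>P y. PF P \<Longrightarrow> (\<And>x. P (\<chi> j. I j x) = 0) \<Longrightarrow> P y = 0"
  shows "\<exists>x. det (jac I x) \<noteq> 0"
proof -
  have PFY: "polynomial_function (\<lambda>x. \<chi> j. I j x)" by (rule polynomial_function_vec) (simp add: I)
  have "\<exists>u v. PF u \<and> (\<exists>x. u x \<noteq> 0) \<and>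
    (\<forall>x k. (if k = i then u x else 0) = (\<Sum>j\<in>UNIV. v j x * pd k (I j) x))" for i
  proof -
    let ?R = "\<lambda>m w. (\<forall>s. PF (w s)) \<and> (\<exists>y. w m y \<noteq> 0) \<and> (\<forall>x. (\<Sum>s\<le>m. (x $ i) ^ s * w s (\<chi> j. I j x)) = 0)"
    define m where "m = (LEAST m. \<exists>w. ?R m w)"
    have "\<exists>w. ?R m w" unfolding m_def by (rule LeastI_ex) (rule algebraic_relation[OF I])
    then obtain w where w: "\<And>s. PF (w s)" "\<exists>y. w m y \<noteq> 0"
      "\<And>x. (\<Sum>s\<le>m. (x $ i) ^ s * w s (\<chi> j. I j x)) = 0" by blast
    have m0: "m \<noteq> 0"
    proof
      assume "m = 0"
      then have "w 0 (\<chi> j. I j x) = 0" for x using w(3)[of x] by simp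
      then have "w 0 y = 0" for y by (rule indep[OF w(1)])
      then show False using w(2) \<open>m = 0\<close> by simp
    qed
    have PFw: "PF (\<lambda>x. w s (\<chi> j. I j x))" for s by (rule PF_compose[OF PFY w(1)])
    have PFx: "PF (\<lambda>x::real^'n. (x $ i) ^ s)" for s by (intro real_polynomial_function_power PF_nth)
    define u where "u x = (\<Sum>s\<le>m. real s * (x $ i) ^ (s - 1) * w s (\<chi> j. I j x))" for x
    define v where "v j x = - (\<Sum>s\<le>m. (x $ i) ^ s * pd j (w s) (\<chi> j. I j x))" for j x
    have "PF u" unfolding u_def
      by (intro real_polynomial_function_sum real_polynomial_function.intros(2,4) PFx PFw) simp
    moreover have "\<exists>x. u x \<noteq> 0"
    proof (rule ccontr)
      assume "\<not> ?thesis"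
      then have u0: "u x = 0" for x by blast
      \<comment> \<open>If \<open>u\<close> vanished, it would itself be a relation, of degree
        \<open>m - 1\<close> and with leading coefficient \<open>m * w m\<close>.\<close>
      have "?R (m - 1) (\<lambda>s y. real (Suc s) * w (Suc s) y)"
      proof (intro conjI allI)
        show "PF (\<lambda>y. real (Suc s) * w (Suc s) y)" for s
          by (intro real_polynomial_function.intros(2,4) w)
        show "\<exists>y. real (Suc (m - 1)) * w (Suc (m - 1)) y \<noteq> 0" using w(2) m0 by auto
        fix x
        have "u x = (\<Sum>s\<in>{Suc 0..m}. real s * (x $ i) ^ (s - 1) * w s (\<chi> j. I j x))"
          unfolding u_def by (rule sum.mono_neutral_right) (auto simp: not_less_eq_eq)
        also have "\<dots> = (\<Sum>s\<in>Suc ` {..m - 1}. real s * (x $ i) ^ (s - 1) * w s (\<chi> j. I j x))"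
          using m0 by (simp add: image_Suc_atMost)
        also have "\<dots> = (\<Sum>s\<le>m - 1. (x $ i) ^ s * (real (Suc s) * w (Suc s) (\<chi> j. I j x)))"
          by (subst sum.reindex) (auto simp: algebra_simps intro!: sum.cong)
        finally show "(\<Sum>s\<le>m - 1. (x $ i) ^ s * (real (Suc s) * w (Suc s) (\<chi> j. I j x))) = 0" using u0 by simp
      qed
      then have "\<exists>w. ?R (m - 1) w" by (intro exI[of _ "\<lambda>s y. real (Suc s) * w (Suc s) y"])
      from Least_le[of "\<lambda>m. \<exists>w. ?R m w", OF this] have "m \<le> m - 1" by (fold m_def)
      then show False using m0 by simp
    qed
    moreover have "(if k = i then u x else 0) = (\<Sum>j\<in>UNIV. v j x * pd k (I j) x)" for x k
    proof -
      have "0 = pd k (\<lambda>x. \<Sum>s\<le>m. (x $ i) ^ s * w s (\<chi> j. I j x)) x" unfolding w(3) by simp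
      also have "\<dots> = (\<Sum>s\<le>m. (x $ i) ^ s * pd k (\<lambda>x. w s (\<chi> j. I j x)) x + pd k (\<lambda>x. (x $ i) ^ s) x * w s (\<chi> j. I j x))"
        by (simp add: pd_sum pd_mult PFx PFw real_polynomial_function.intros(4))
      also have "\<dots> = (\<Sum>s\<le>m. (x $ i) ^ s * (\<Sum>j\<in>UNIV. pd j (w s) (\<chi> j. I j x) * pd k (I j) x)
          + (if k = i then real s * (x $ i) ^ (s - 1) * w s (\<chi> j. I j x) else 0))"
        using pd_compose[OF w(1), of "\<lambda>x. \<chi> j. I j x"] I
        by (intro sum.cong refl) (simp add: pd_power PF_nth pd_nth)
      also have "\<dots> = (\<Sum>s\<le>m. \<Sum>j\<in>UNIV. (x $ i) ^ s * pd j (w s) (\<chi> j. I j x) * pd k (I j) x) + (if k = i then u x else 0)"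
        by (simp add: sum.distrib u_def sum_distrib_left algebra_simps)
      also have "(\<Sum>s\<le>m. \<Sum>j\<in>UNIV. (x $ i) ^ s * pd j (w s) (\<chi> j. I j x) * pd k (I j) x) = - (\<Sum>j\<in>UNIV. v j x * pd k (I j) x)"
        by (subst sum.swap) (simp add: v_def sum_distrib_right sum_negf)
      finally show ?thesis by simp
    qed
    ultimately show ?thesis by blast
  qed
  then obtain u v where uv: "\<And>i. PF (u i)" "\<And>i. \<exists>x. u i x \<noteq> 0"
    "\<And>i x k. (if k = i then u i x else 0) = (\<Sum>j\<in>UNIV. v i j x * pd k (I j) x)"
    by metis
  obtain x where x: "\<And>i. u i x \<noteq> 0" using PF_common_nonzero[of UNIV u] uv by auto
  have "(\<chi> i j. v i j x) ** jac I x = (\<chi> i k. if k = i then u i x else 0)"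
    by (simp add: matrix_matrix_mult_def jac_def uv(3))
  then have "det (\<chi> i j. v i j x) * det (jac I x) = det (\<chi> i k. if k = i then u i x else (0 :: real))"
    by (simp flip: det_mul)
  also have "\<dots> = (\<Prod>i\<in>UNIV. u i x)"
    by (subst det_diagonal) auto
  finally have "det (jac I x) \<noteq> 0" using x by auto
  then show ?thesis by blast
qed

section \<open>The squared radius\<close>

lemma PF_det:
  fixes A :: "'a::euclidean_space \<Rightarrow> real^'n^'n"
  assumes "\<And>i j. PF (\<lambda>x. A x $ i $ j)"
  shows "PF (\<lambda>x. det (A x))"
  unfolding det_def
  by (intro real_polynomial_function_sum real_polynomial_function.intros(2,4) real_polynomial_function_prod assms)
     (auto simp: finite_permutations)

lemma PF_cancel:
  fixes f g h :: "'a::euclidean_space \<Rightarrow> real"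
  assumes "PF f" "PF g" "PF h" "\<And>x. h x * f x = h x * g x" "h a \<noteq> 0"
  shows "f x = g x"
  using PF_mult_eq_0[OF assms(3) real_polynomial_function_diff[OF assms(1,2)] _ assms(5), of x] assms(4)
  by (simp add: right_diff_distrib)

definition gdot :: "(real^'n \<Rightarrow> real) \<Rightarrow> (real^'n \<Rightarrow> real) \<Rightarrow> real^'n \<Rightarrow> real" where
  "gdot f h x = (\<Sum>k\<in>UNIV. pd k f x * pd k h x)"

lemma PF_gdot: "PF f \<Longrightarrow> PF h \<Longrightarrow> PF (gdot f h)"
  unfolding gdot_def by (intro real_polynomial_function_sum real_polynomial_function.intros(4) PF_pd) auto

lemma gdot_mult_left:
  "PF f \<Longrightarrow> PF h \<Longrightarrow> gdot (\<lambda>x. f x * h x) u x = f x * gdot h u x + h x * gdot f u x"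
  by (simp add: gdot_def pd_mult sum_distrib_left sum.distrib algebra_simps)

lemma gdot_commute: "gdot f h x = gdot h f x"
  by (simp add: gdot_def mult.commute)

lemma euler:
  fixes f :: "real^'n \<Rightarrow> real"
  assumes "PF f" "hom d f"
  shows "(\<Sum>k\<in>UNIV. x $ k * pd k f x) = real d * f x"
proof -
  have "((\<lambda>t. f (t *\<^sub>R x)) has_derivative (\<lambda>h. frechet_derivative f (at (1 *\<^sub>R x)) (h *\<^sub>R x))) (at 1)"
    by (rule diff_chain_at[of "\<lambda>t. t *\<^sub>R x" _ _ f, unfolded o_def])
       (auto intro!: derivative_eq_intros PF_has_derivative assms)
  moreover have "((\<lambda>t. f (t *\<^sub>R x)) has_derivative (\<lambda>h. h * (real d * f x))) (at 1)"
    unfolding homD[OF assms(2)] by (auto intro!: derivative_eq_intros)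
  ultimately have "(\<lambda>h. frechet_derivative f (at (1 *\<^sub>R x)) (h *\<^sub>R x)) = (\<lambda>h. h * (real d * f x))"
    by (rule has_derivative_unique)
  from fun_cong[OF this, of 1] show ?thesis by (simp add: frechet_derivative_pd[OF assms(1)])
qed

lemma pd_scale:
  fixes f :: "real^'n \<Rightarrow> real"
  assumes "PF f"
  shows "pd k (\<lambda>x. f (t *\<^sub>R x)) x = t * pd k f (t *\<^sub>R x)"
proof -
  have "pd k (\<lambda>x. f (t *\<^sub>R x)) x = frechet_derivative f (at (t *\<^sub>R x)) (t *\<^sub>R axis k 1)"
    by (rule pd_eqI, rule diff_chain_at[of "\<lambda>x. t *\<^sub>R x" _ _ f, unfolded o_def])
       (auto intro!: derivative_eq_intros PF_has_derivative assms)
  moreover have "(t *\<^sub>R axis k 1) $ i * c = (if i = k then t * c else 0)" for i and c :: real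
    by (simp add: axis_def)
  ultimately show ?thesis by (simp add: frechet_derivative_pd[OF assms])
qed

lemma hom_pd:
  fixes f :: "real^'n \<Rightarrow> real"
  assumes "PF f" "hom d f"
  shows "hom (d - 1) (pd k f)" and "d = 0 \<Longrightarrow> pd k f x = 0"
proof -
  have eq: "t * pd k f (t *\<^sub>R x) = t ^ d * pd k f x" for t x
  proof -
    have "(\<lambda>x. f (t *\<^sub>R x)) = (\<lambda>x. t ^ d * f x)" using homD[OF assms(2)] by blast
    then show ?thesis using pd_scale[OF assms(1), of k t x] pd_cmult[OF assms(1), of k "t ^ d"] by simp
  qed
  show 0: "pd k f x = 0" if "d = 0" for x
  proof -
    have "pd k f x = 0" using eq[of 0 x] that by simp
    then show ?thesis .
  qed
  show "hom (d - 1) (pd k f)"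
    unfolding hom_def
  proof (intro allI)
    fix t :: real and x :: "real^'n"
    show "pd k f (t *\<^sub>R x) = t ^ (d - 1) * pd k f x"
    proof (cases "d = 0")
      case True
      then show ?thesis using 0 by simp
    next
      case False
      have "PF (\<lambda>t::real. pd k f (t *\<^sub>R x))"
        by (rule PF_compose[OF polynomial_function_bounded_linear PF_pd[OF assms(1)]]) (rule bounded_linear_scaleR_left)
      moreover have "PF (\<lambda>t::real. t ^ (d - 1) * pd k f x)"
        by (intro real_polynomial_function.intros(4) real_polynomial_function_power real_polynomial_function.intros(1,2)) (rule bounded_linear_ident)
      moreover have "PF (\<lambda>t::real. t)" by (intro real_polynomial_function.intros(1) bounded_linear_ident)
      moreover have "t * pd k f (t *\<^sub>R x) = t * (t ^ (d - 1) * pd k f x)" for t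
        using eq[of t x] False by (cases d) auto
      \<comment> \<open>The factor \<open>t\<close> is cancelled between polynomial functions of
        \<open>t\<close>, which covers the value \<open>t = 0\<close> as well.\<close>
      ultimately show ?thesis by (rule PF_cancel[of _ _ _ 1]) auto
    qed
  qed
qed

lemma PF_top_component:
  fixes f :: "real^'n \<Rightarrow> real"
  assumes "PF f" "\<exists>x. f x \<noteq> 0"
  obtains F N where "\<And>k. PF (F k)" "\<And>k. hom k (F k)" "\<And>x. f x = (\<Sum>k\<le>N. F k x)" "\<exists>x. F N x \<noteq> 0"
proof -
  obtain F M where F: "\<And>k. PF (F k)" "\<And>k. hom k (F k)" "\<And>x. f x = (\<Sum>k\<le>M. F k x)"
    using PF_homogeneous_components[OF assms(1)] by blast
  define T where "T = {k. k \<le> M \<and> (\<exists>x. F k x \<noteq> 0)}"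
  have fin: "finite T" unfolding T_def by simp
  have "T \<noteq> {}"
  proof
    assume "T = {}"
    then have "F k x = 0" if "k \<le> M" for k x using that by (auto simp: T_def)
    then have "f x = 0" for x unfolding F(3) by (intro sum.neutral) auto
    then show False using assms(2) by blast
  qed
  then have N: "Max T \<in> T" using fin by (intro Max_in)
  have "f x = (\<Sum>k\<le>Max T. F k x)" for x
    unfolding F(3)
  proof (rule sum.mono_neutral_right)
    show "\<forall>k\<in>{..M} - {..Max T}. F k x = 0"
    proof
      fix k assume k: "k \<in> {..M} - {..Max T}"
      then have "k \<notin> T" using Max_ge[OF fin] by fastforce
      then show "F k x = 0" using k by (auto simp: T_def)
    qed
  qed (use N in \<open>auto simp: T_def\<close>)
  then show ?thesis using that[OF F(1,2)] N by (auto simp: T_def)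
qed

text \<open>Here positivity of the Euclidean metric over the reals enters: by degrees \<open>b = 0\<close>, so the
  gradient of \<open>f\<close> is isotropic, hence zero.\<close>

lemma gradient_square_dvd:
  fixes f b :: "real^'n \<Rightarrow> real"
  assumes f: "PF f" and b: "PF b" and eq: "\<And>x. gdot f f x = (f x)\<^sup>2 * b x"
  shows "pd k f x = 0"
proof (cases "\<exists>x. f x \<noteq> 0")
  case False
  then have "f = (\<lambda>x. 0)" by auto
  then show ?thesis by simp
next
  case True
  have b0: "b x = 0" for x
  proof (rule ccontr)
    assume "b x \<noteq> 0"
    then have "\<exists>x. b x \<noteq> 0" by blast
    obtain F N where F: "\<And>k. PF (F k)" "\<And>k. hom k (F k)" "\<And>x. f x = (\<Sum>k\<le>N. F k x)" "\<exists>x. F N x \<noteq> 0"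
      using PF_top_component[OF f True] by blast
    obtain B M where B: "\<And>k. PF (B k)" "\<And>k. hom k (B k)" "\<And>x. b x = (\<Sum>k\<le>M. B k x)" "\<exists>x. B M x \<noteq> 0"
      using PF_top_component[OF b \<open>\<exists>x. b x \<noteq> 0\<close>] by blast
    have "\<exists>x. F N x * B M x \<noteq> 0"
      using PF_mult_eq_0[OF F(1) B(1)] F(4) B(4) by blast
    \<comment> \<open>On the ray through such an \<open>x\<close> both polynomials keep their full
      degree, so degrees can be compared in one variable.\<close>
    then obtain x where x: "F N x \<noteq> 0" "B M x \<noteq> 0" by auto
    define pf where "pf = (\<Sum>k\<le>N. monom (F k x) k)"
    define pb where "pb = (\<Sum>k\<le>M. monom (B k x) k)"
    define pp where "pp j = (\<Sum>k\<in>{1..N}. monom (pd j (F k) x) (k - 1))" for j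
    have pf: "f (t *\<^sub>R x) = poly pf t" for t
      by (simp add: F(3) pf_def poly_sum poly_monom homD[OF F(2)] mult.commute)
    have pb: "b (t *\<^sub>R x) = poly pb t" for t
      by (simp add: B(3) pb_def poly_sum poly_monom homD[OF B(2)] mult.commute)
    have ff: "f = (\<lambda>x. \<Sum>k\<le>N. F k x)" using F(3) by blast
    have pp: "pd j f (t *\<^sub>R x) = poly (pp j) t" for j t
    proof -
      have "pd j f (t *\<^sub>R x) = (\<Sum>k\<le>N. pd j (F k) (t *\<^sub>R x))"
        by (subst ff) (simp add: pd_sum F(1))
      also have "\<dots> = (\<Sum>k\<in>{1..N}. pd j (F k) (t *\<^sub>R x))"
        by (rule sum.mono_neutral_right) (use hom_pd(2)[OF F(1,2)] in \<open>auto simp: not_less_eq_eq\<close>)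
      finally show ?thesis
        by (simp add: pp_def poly_sum poly_monom homD[OF hom_pd(1)[OF F(1,2)]] mult.commute)
    qed
    have "poly (\<Sum>j\<in>UNIV. (pp j)\<^sup>2) t = poly (pf\<^sup>2 * pb) t" for t
      using eq[of "t *\<^sub>R x"] by (simp add: gdot_def pf pb pp poly_sum power2_eq_square)
    then have eq': "(\<Sum>j\<in>UNIV. (pp j)\<^sup>2) = pf\<^sup>2 * pb" using poly_eq_poly_eq_iff by blast
    have cf: "coeff pf N = F N x" "coeff pb M = B M x" by (auto simp: pf_def pb_def coeff_sum)
    then have nz: "pf \<noteq> 0" "pb \<noteq> 0" using x by auto
    have "degree pf \<ge> N" using cf x by (intro le_degree) auto
    then have deg: "2 * N \<le> degree (pf\<^sup>2 * pb)" using nz by (simp add: degree_mult_eq degree_power_eq)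
    have dpp: "degree (pp j) \<le> N - 1" for j
      unfolding pp_def by (intro degree_sum_le) (auto intro!: order_trans[OF degree_monom_le])
    have "degree ((pp j)\<^sup>2) \<le> 2 * (N - 1)" for j
      using degree_power_le[of "pp j" 2] dpp[of j] by linarith
    then have "degree (\<Sum>j\<in>UNIV. (pp j)\<^sup>2) \<le> 2 * (N - 1)" by (intro degree_sum_le) auto
    \<comment> \<open>With truncated subtraction this leaves only \<open>N = 0\<close>. Then the
      gradient vanishes along the ray, while \<open>pf\<^sup>2 * pb\<close> is nonzero.\<close>
    then have "2 * N \<le> 2 * (N - 1)" using deg eq' by simp
    then have "N = 0" by simp
    then have "pp j = 0" for j by (simp add: pp_def)
    then show False using eq' nz by simp
  qed
  have "(\<Sum>k\<in>UNIV. (pd k f x)\<^sup>2) = 0" using eq[of x] b0 by (simp add: gdot_def power2_eq_square)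
  then have "(pd k f x)\<^sup>2 = 0" by (subst (asm) sum_nonneg_eq_0_iff) auto
  then show ?thesis by simp
qed

lemma PF_constant:
  fixes f :: "real^'n \<Rightarrow> real"
  assumes "PF f" "\<And>k x. pd k f x = 0"
  shows "f x = f 0"
proof -
  have "(f has_derivative (\<lambda>h. 0)) (at x)" for x
    using has_derivative_pd[OF assms(1), of x] assms(2) by simp
  then have "\<exists>c. \<forall>x\<in>UNIV. f x = c" by (intro has_derivative_zero_constant) auto
  then show ?thesis by auto
qed

lemma pdvdI: "PF c \<Longrightarrow> (\<And>x. b x = a x * c x) \<Longrightarrow> pdvd a b"
  by (auto simp: pdvd_def)

lemma pprime_dvdD:
  "pprime q \<Longrightarrow> \<not> pdvd q a \<Longrightarrow> PF a \<Longrightarrow> PF b \<Longrightarrow> pdvd q (\<lambda>x. a x * b x) \<Longrightarrow> pdvd q b"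
  by (auto simp: pprime_def)

definition r2 :: "real^'n \<Rightarrow> real" where "r2 x = (\<Sum>k\<in>UNIV. (x $ k)\<^sup>2)"

lemma PF_r2: "PF r2"
  unfolding r2_def by (intro real_polynomial_function_sum real_polynomial_function_power PF_nth) auto

lemma pd_r2: "pd k r2 x = 2 * x $ k"
proof -
  have "pd k r2 = (\<lambda>x. \<Sum>i\<in>UNIV. pd k (\<lambda>x. (x $ i)\<^sup>2) x)"
    unfolding r2_def by (rule pd_sum) (intro real_polynomial_function_power PF_nth)
  then show ?thesis by (simp add: pd_power PF_nth pd_nth if_distrib cong: if_cong)
qed

lemma gdot_r2_r2: "gdot r2 r2 x = 4 * r2 x"
  by (simp add: gdot_def pd_r2 r2_def sum_distrib_left power2_eq_square algebra_simps)

section \<open>The algebra generated by I and its cometric\<close>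

locale gradient_algebra =
  fixes I :: "'n::finite \<Rightarrow> real^'n \<Rightarrow> real" and g :: "'n \<Rightarrow> 'n \<Rightarrow> real^'n \<Rightarrow> real" and d :: "'n \<Rightarrow> nat"
  assumes PF_I: "PF (I j)" and hom_I: "hom (d j) (I j)"
    and indep: "PF P \<Longrightarrow> (\<And>x. P (\<chi> j. I j x) = 0) \<Longrightarrow> P y = 0"
    and PF_g: "PF (g i j)"
    and grad: "(\<Sum>k\<in>UNIV. pd k (I i) x * pd k (I j) x) = g i j (\<chi> j. I j x)"
begin

definition Y :: "real^'n \<Rightarrow> real^'n" where "Y x = (\<chi> j. I j x)"

lemma Y_nth [simp]: "Y x $ j = I j x"
  by (simp add: Y_def)

lemma polynomial_Y: "polynomial_function Y"
  by (rule polynomial_function_vec) (simp add: PF_I)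

lemma PF_Y: "PF P \<Longrightarrow> PF (\<lambda>x. P (Y x))"
  by (rule PF_compose[OF polynomial_Y])

text \<open>The image of \<open>Y\<close> may be a proper part of the target space; identities in
  the variable \<open>y\<close> come from algebraic independence, not from surjectivity.\<close>

lemma eq_of_Y:
  assumes "PF P" "PF Q" "\<And>x. P (Y x) = Q (Y x)"
  shows "P y = Q y"
  using indep[OF real_polynomial_function_diff[OF assms(1,2)], of y] assms(3) by (simp add: Y_def)

lemma pd_Y: "PF P \<Longrightarrow> pd k (\<lambda>x. P (Y x)) x = (\<Sum>j\<in>UNIV. pd j P (Y x) * pd k (I j) x)"
  using pd_compose[of P Y k x] PF_I by simp

text \<open>The cometric \<open>g\<close> on the differentials of \<open>P\<close> and
  \<open>Q\<close>: a symmetric pairing, not a Poisson bracket. By \<open>gdot_Y\<close> it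
  corresponds to the inner product of gradients in the source.\<close>

definition bracket :: "(real^'n \<Rightarrow> real) \<Rightarrow> (real^'n \<Rightarrow> real) \<Rightarrow> real^'n \<Rightarrow> real" where
  "bracket P Q y = (\<Sum>i\<in>UNIV. \<Sum>j\<in>UNIV. pd i P y * pd j Q y * g i j y)"

lemma PF_bracket: "PF P \<Longrightarrow> PF Q \<Longrightarrow> PF (bracket P Q)"
  unfolding bracket_def
  by (intro real_polynomial_function_sum real_polynomial_function.intros(4) PF_pd PF_g) auto

lemma gdot_Y:
  assumes "PF P" "PF Q"
  shows "gdot (\<lambda>x. P (Y x)) (\<lambda>x. Q (Y x)) x = bracket P Q (Y x)"
proof -
  have "gdot (\<lambda>x. P (Y x)) (\<lambda>x. Q (Y x)) x
      = (\<Sum>k\<in>UNIV. \<Sum>i\<in>UNIV. \<Sum>j\<in>UNIV. pd i P (Y x) * pd j Q (Y x) * (pd k (I i) x * pd k (I j) x))"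
    by (simp add: gdot_def pd_Y assms sum_product algebra_simps)
  also have "\<dots> = (\<Sum>i\<in>UNIV. \<Sum>j\<in>UNIV. \<Sum>k\<in>UNIV. pd i P (Y x) * pd j Q (Y x) * (pd k (I i) x * pd k (I j) x))"
    by (subst sum.swap, rule sum.cong[OF refl], subst sum.swap, rule refl)
  also have "\<dots> = bracket P Q (Y x)"
    by (simp add: bracket_def sum_distrib_left[symmetric] grad Y_def)
  finally show ?thesis .
qed

lemma bracket_commute: "PF P \<Longrightarrow> PF Q \<Longrightarrow> bracket P Q y = bracket Q P y"
  by (rule eq_of_Y) (auto simp: PF_bracket gdot_Y[symmetric] gdot_commute)

lemma bracket_mult_left:
  "PF P \<Longrightarrow> PF Q \<Longrightarrow> bracket (\<lambda>y. P y * Q y) u y = P y * bracket Q u y + Q y * bracket P u y"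
  by (simp add: bracket_def pd_mult sum_distrib_left sum.distrib[symmetric] algebra_simps)

lemma bracket_power_left:
  "PF P \<Longrightarrow> bracket (\<lambda>y. P y ^ k) u y = real k * P y ^ (k - 1) * bracket P u y"
  by (simp add: bracket_def pd_power sum_distrib_left algebra_simps)

definition gram_det :: "real^'n \<Rightarrow> real" where "gram_det y = det (\<chi> i j. g i j y :: real^'n^'n)"

lemma PF_gram_det: "PF gram_det"
  unfolding gram_det_def by (rule PF_det) (simp add: PF_g)

lemma PF_D: "PF (\<lambda>x. det (jac I x))"
  by (rule PF_det) (simp add: jac_def PF_pd PF_I)

lemma G_jac: "(\<chi> i j. g i j (Y x)) = jac I x ** transpose (jac I x)"
  by (simp add: vec_eq_iff matrix_matrix_mult_def transpose_def jac_def grad[symmetric] Y_def)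

lemma gram_det_Y: "gram_det (Y x) = (det (jac I x))\<^sup>2"
  by (simp add: gram_det_def G_jac det_mul power2_eq_square)

lemma D_nonzero: "\<exists>x. det (jac I x) \<noteq> 0"
proof (rule jacobian_nonzero)
  show "P y = 0" if "PF P" "\<And>x. P (\<chi> j. I j x) = 0" for P y using that by (rule indep)
qed (rule PF_I)

lemma gram_det_nonzero: "\<exists>y. gram_det y \<noteq> 0"
  using D_nonzero gram_det_Y by (metis power_not_zero)

lemma PF_eq_regular:
  assumes "PF f" "PF h" "\<And>x. det (jac I x) \<noteq> 0 \<Longrightarrow> f x = h x"
  shows "f x = h x"
proof -
  obtain a where "det (jac I a) \<noteq> 0" using D_nonzero by blast
  then show ?thesis by (rule PF_cancel[OF assms(1,2) PF_D, rotated]) (use assms(3) in auto)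
qed

text \<open>The image under \<open>Y\<close> of the Euler field of the source, whose double is the
  gradient of r^2.\<close>

definition weighted_euler :: "(real^'n \<Rightarrow> real) \<Rightarrow> real^'n \<Rightarrow> real" where
  "weighted_euler P y = (\<Sum>j\<in>UNIV. real (d j) * y $ j * pd j P y)"

lemma PF_weighted_euler: "PF P \<Longrightarrow> PF (weighted_euler P)"
  unfolding weighted_euler_def
  by (intro real_polynomial_function_sum real_polynomial_function.intros(2,4) PF_pd PF_nth) auto

lemma gdot_r2:
  assumes "PF P"
  shows "gdot r2 (\<lambda>x. P (Y x)) x = 2 * weighted_euler P (Y x)"
proof -
  have "gdot r2 (\<lambda>x. P (Y x)) x = 2 * (\<Sum>k\<in>UNIV. \<Sum>j\<in>UNIV. pd j P (Y x) * (x $ k * pd k (I j) x))"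
    by (simp add: gdot_def pd_r2 pd_Y assms sum_distrib_left algebra_simps)
  also have "\<dots> = 2 * (\<Sum>j\<in>UNIV. pd j P (Y x) * (\<Sum>k\<in>UNIV. x $ k * pd k (I j) x))"
    by (subst sum.swap) (simp add: sum_distrib_left)
  also have "\<dots> = 2 * weighted_euler P (Y x)"
    by (simp add: euler[OF PF_I hom_I] weighted_euler_def algebra_simps)
  finally show ?thesis .
qed

text \<open>With \<open>e_j = d_j y_j\<close> this is the determinant of \<open>g\<close> times
  \<open>e^T g^-1 e\<close>, with the inverse expanded by Cramer's rule.\<close>

definition r2_numerator :: "real^'n \<Rightarrow> real" where
  "r2_numerator y = (\<Sum>k\<in>UNIV. (real (d k) * y $ k) * det (\<chi> i j. if j = k then real (d i) * y $ i else g i j y :: real^'n^'n))"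

lemma PF_r2_numerator: "PF r2_numerator"
proof -
  have "PF (\<lambda>y. if j = k then real (d i) * y $ i else g i j y)" for i j k
    by (cases "j = k") (auto simp: PF_g intro!: real_polynomial_function.intros(2,4) PF_nth)
  then show ?thesis unfolding r2_numerator_def
    by (intro real_polynomial_function_sum real_polynomial_function.intros(2,4) PF_nth PF_det) auto
qed

text \<open>Euler's identity says \<open>J x = e\<close>. At a regular point
  \<open>x = J^T w\<close> with \<open>g w = e\<close>, hence
  \<open>x . x = J x . w = e . w\<close>.\<close>

lemma r2_gram_det: "r2 x * gram_det (Y x) = r2_numerator (Y x)"
proof (rule PF_eq_regular[of "\<lambda>x. r2 x * gram_det (Y x)" "\<lambda>x. r2_numerator (Y x)" x])
  show "PF (\<lambda>x. r2 x * gram_det (Y x))" "PF (\<lambda>x. r2_numerator (Y x))"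
    by (intro real_polynomial_function.intros(4) PF_r2 PF_Y PF_gram_det PF_r2_numerator)+
  fix x assume nz: "det (jac I x) \<noteq> 0"
  define A where "A = jac I x"
  define e where "e = (\<chi> j. real (d j) * I j x)"
  define w where "w = (\<chi> k. det (\<chi> i j. if j = k then e $ i else (A ** transpose A) $ i $ j) / det (A ** transpose A))"
  have "det (A ** transpose A) \<noteq> 0" using nz by (simp add: A_def det_mul)
  from cramer[OF this, of w e] have "(A ** transpose A) *v w = e" by (simp add: w_def)
  moreover have Ax: "A *v x = e"
    using euler[OF PF_I hom_I] by (simp add: vec_eq_iff matrix_vector_mult_def A_def jac_def e_def mult.commute)
  ultimately have "A *v (transpose A *v w) = A *v x" by (simp only: matrix_vector_mul_assoc)
  moreover have "inj ((*v) A)" using nz by (simp add: A_def inj_matrix_vector_mult invertible_det_nz)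
  ultimately have "x = transpose A *v w" by (auto dest: injD)
  then have "x \<bullet> x = x \<bullet> (transpose A *v w)" by simp
  also have "\<dots> = e \<bullet> w" by (simp add: inner_commute[of x] dot_lmul_matrix Ax inner_commute[of w])
  finally have "r2 x = (\<Sum>k\<in>UNIV. e $ k * w $ k)" by (simp add: r2_def inner_vec_def power2_eq_square)
  moreover have D: "gram_det (Y x) = det (A ** transpose A)" by (simp add: gram_det_def G_jac A_def)
  moreover have "g i j (Y x) = (A ** transpose A) $ i $ j" for i j
    using G_jac[of x] by (simp add: vec_eq_iff A_def)
  then have "(\<chi> i j. if j = k then real (d i) * Y x $ i else g i j (Y x))
      = (\<chi> i j. if j = k then e $ i else (A ** transpose A) $ i $ j)" for k
    by (auto simp: vec_eq_iff e_def)
  ultimately show "r2 x * gram_det (Y x) = r2_numerator (Y x)"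
    using \<open>det (A ** transpose A) \<noteq> 0\<close>
    by (simp add: r2_numerator_def w_def e_def sum_distrib_right)
qed

text \<open>If \<open>r\<^sup>2\<close> had a pole along a prime \<open>q\<close>, comparing pole orders in \<open>|\<nabla>r\<^sup>2|\<^sup>2 = 4r\<^sup>2\<close> would
  force \<open>q\<^sup>2\<close> to divide \<open>|\<nabla>q|\<^sup>2\<close>.\<close>

theorem r2_in_algebra: "\<exists>R. PF R \<and> (\<forall>x. r2 x = R (Y x))"
proof (cases "pdvd gram_det r2_numerator")
  case True
  then obtain R where R: "PF R" "\<And>y. r2_numerator y = gram_det y * R y" by (auto simp: pdvd_def)
  have "r2 x = R (Y x)" for x
  proof (rule PF_eq_regular[of r2 "\<lambda>x. R (Y x)" x])
    fix x assume "det (jac I x) \<noteq> 0"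
    then have "gram_det (Y x) \<noteq> 0" by (simp add: gram_det_Y)
    then show "r2 x = R (Y x)" using r2_gram_det[of x] R(2)[of "Y x"] by simp
  qed (use PF_r2 PF_Y R in auto)
  then show ?thesis using R by blast
next
  case False
  obtain q m s i p where q: "pprime q" "i < m" "PF s" "PF p" "\<not> pdvd q s" "\<not> pdvd q p"
    "\<And>y. gram_det y = q y ^ m * s y" "\<And>y. r2_numerator y = q y ^ i * p y"
    using not_pdvd_prime[OF PF_gram_det PF_r2_numerator gram_det_nonzero False] by metis
  have PFq: "PF q" and nq: "\<exists>y. q y \<noteq> 0" using q(1) by (auto simp: pprime_def)
  have nqY: "\<exists>x. q (Y x) \<noteq> 0" using nq indep[OF PFq] by (auto simp: Y_def)
  define k where "k = m - i"
  have k: "k > 0" "m = i + k" using q(2) by (auto simp: k_def)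
  \<comment> \<open>After cancelling \<open>q ^ i\<close> the fraction becomes
    \<open>r2 = p / W\<close>, with a pole of order exactly \<open>k\<close> along
    \<open>q\<close>.\<close>
  define W where "W y = q y ^ k * s y" for y
  have PFqk: "PF (\<lambda>y. q y ^ j)" for j by (intro real_polynomial_function_power PFq)
  have PFW: "PF W" unfolding W_def by (intro real_polynomial_function.intros(4) PFqk q)
  have rel: "r2 x * W (Y x) = p (Y x)" for x
  proof -
    obtain a where "q (Y a) ^ i \<noteq> 0" using nqY by auto
    then show ?thesis
    proof (rule PF_cancel[of "\<lambda>x. r2 x * W (Y x)" "\<lambda>x. p (Y x)" "\<lambda>x. q (Y x) ^ i", rotated -1])
      show "q (Y x) ^ i * (r2 x * W (Y x)) = q (Y x) ^ i * p (Y x)" for x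
        using r2_gram_det[of x] unfolding q(7,8) W_def k(2) by (simp add: power_add algebra_simps)
    qed (intro real_polynomial_function.intros(4) PF_r2 PF_Y PFW q PFqk[THEN PF_Y])+
  qed
  have pY: "(\<lambda>x. p (Y x)) = (\<lambda>x. r2 x * W (Y x))" using rel by simp
  have brW: "bracket W u y = real k * q y ^ (k - 1) * s y * bracket q u y + q y ^ k * bracket s u y" if "PF u" for u y
    unfolding W_def by (simp add: bracket_mult_left PFqk q bracket_power_left PFq algebra_simps)
  have brp: "bracket p u (Y x) = r2 x * bracket W u (Y x) + W (Y x) * (2 * weighted_euler u (Y x))" if u: "PF u" for u x
    using gdot_Y[OF q(4) u, of x, symmetric] unfolding pY
    by (simp add: gdot_mult_left PF_r2 PF_Y PFW gdot_Y u gdot_r2)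
  have qdvd: "pdvd q (bracket q u)" if u: "PF u" for u
  proof -
    \<comment> \<open>Pairing the gradient of \<open>p = r2 * W\<close> with that of
      \<open>u\<close> shows that \<open>c\<close> is \<open>r2 * bracket W u\<close>. In
      \<open>W * c = p * bracket W u\<close> the left side carries \<open>q ^ k\<close>, while
      modulo \<open>q ^ k\<close> the bracket is \<open>k * q ^ (k - 1) * s * bracket q u\<close>;
      so \<open>q\<close> divides \<open>p * s * bracket q u\<close>.\<close>
    define c where "c y = bracket p u y - 2 * W y * weighted_euler u y" for y
    have PFc: "PF c" unfolding c_def
      by (intro real_polynomial_function_diff real_polynomial_function.intros(2,4) PF_bracket PF_weighted_euler PFW q u)
    have Wc: "W y * c y = p y * bracket W u y" for y
    proof (rule eq_of_Y[of "\<lambda>y. W y * c y" "\<lambda>y. p y * bracket W u y"])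
      fix x
      show "W (Y x) * c (Y x) = p (Y x) * bracket W u (Y x)"
        unfolding c_def brp[OF u] rel[symmetric] by (simp add: algebra_simps)
    qed (intro real_polynomial_function.intros(4) PFc PFW PF_bracket q u)+
    obtain a where a: "q a ^ (k - 1) \<noteq> 0" using nq by auto
    have "q y * (s y * c y - p y * bracket s u y) = real k * (p y * (s y * bracket q u y))" for y
    proof (rule PF_cancel[OF _ _ PFqk[of "k - 1"] _ a])
      fix y
      have qk: "q y ^ k = q y ^ (k - 1) * q y" using k by (cases k) auto
      show "q y ^ (k - 1) * (q y * (s y * c y - p y * bracket s u y))
          = q y ^ (k - 1) * (real k * (p y * (s y * bracket q u y)))"
        using Wc[of y] unfolding brW[OF u] unfolding W_def qk by (simp add: algebra_simps)
    qed (intro real_polynomial_function_diff real_polynomial_function.intros(2,4) PFc PFq PF_bracket q u)+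
    then have "p y * (s y * bracket q u y) = q y * ((s y * c y - p y * bracket s u y) / real k)" for y
      using k by (simp add: field_simps)
    then have "pdvd q (\<lambda>y. p y * (s y * bracket q u y))"
      by (rule pdvdI[rotated])
         (intro real_polynomial_function_divide real_polynomial_function_diff real_polynomial_function.intros(4) PFc PF_bracket q u)
    from pprime_dvdD[OF q(1,6,4) _ this] have "pdvd q (\<lambda>y. s y * bracket q u y)"
      by (simp add: real_polynomial_function.intros(4) PF_bracket PFq q(3) u)
    then show ?thesis by (rule pprime_dvdD[OF q(1,5,3) PF_bracket[OF PFq u]])
  qed
  obtain a where a: "PF a" "\<And>y. bracket q q y = q y * a y" using qdvd[OF PFq] by (auto simp: pdvd_def)
  obtain b where b: "PF b" "\<And>y. bracket q s y = q y * b y" using qdvd[OF q(3)] by (auto simp: pdvd_def)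
  \<comment> \<open>Since |\<nabla>r^2|^2 = 4 r^2, expanding the squared gradient of
    \<open>r2 * W\<close> shows that this \<open>c\<close> is
    \<open>r2\<^sup>2 * bracket W W\<close>. Comparing powers of \<open>q\<close> once more then
    gives that \<open>q\<close> divides \<open>a\<close>, so \<open>bracket q q\<close> is a
    multiple of \<open>q\<^sup>2\<close>.\<close>
  define c where "c y = bracket p p y - 4 * p y * weighted_euler W y - 4 * p y * W y" for y
  have PFc: "PF c" unfolding c_def
    by (intro real_polynomial_function_diff real_polynomial_function.intros(2,4) PF_bracket PF_weighted_euler PFW q)
  have W2: "(W y)\<^sup>2 * c y = (p y)\<^sup>2 * bracket W W y" for y
  proof (rule eq_of_Y[of "\<lambda>y. (W y)\<^sup>2 * c y" "\<lambda>y. (p y)\<^sup>2 * bracket W W y"])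
    fix x
    have "bracket p p (Y x) = gdot (\<lambda>x. r2 x * W (Y x)) (\<lambda>x. r2 x * W (Y x)) x"
      using gdot_Y[OF q(4) q(4), of x, symmetric] unfolding pY .
    also have "\<dots> = r2 x * gdot (\<lambda>x. r2 x * W (Y x)) (\<lambda>x. W (Y x)) x + W (Y x) * gdot (\<lambda>x. r2 x * W (Y x)) r2 x"
      by (subst gdot_mult_left) (auto simp: PF_r2 PF_Y PFW gdot_commute)
    also have "gdot (\<lambda>x. r2 x * W (Y x)) (\<lambda>x. W (Y x)) x = r2 x * bracket W W (Y x) + W (Y x) * (2 * weighted_euler W (Y x))"
      by (subst gdot_mult_left) (auto simp: PF_r2 PF_Y PFW gdot_Y gdot_r2)
    also have "gdot (\<lambda>x. r2 x * W (Y x)) r2 x = r2 x * (2 * weighted_euler W (Y x)) + W (Y x) * (4 * r2 x)"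
      by (subst gdot_mult_left) (auto simp: PF_r2 PF_Y PFW gdot_r2_r2 gdot_commute[of "\<lambda>x. W (Y x)" r2] gdot_r2)
    finally have "bracket p p (Y x) = (r2 x)\<^sup>2 * bracket W W (Y x) + 4 * r2 x * W (Y x) * weighted_euler W (Y x) + 4 * r2 x * (W (Y x))\<^sup>2"
      by (simp add: algebra_simps power2_eq_square)
    then show "(W (Y x))\<^sup>2 * c (Y x) = (p (Y x))\<^sup>2 * bracket W W (Y x)"
      unfolding c_def rel[symmetric] by (simp add: algebra_simps power2_eq_square)
  qed (intro real_polynomial_function.intros(4) real_polynomial_function_power PFc PFW PF_bracket q)+
  define e where "e y = real k * s y * b y + real k * s y * b y + bracket s s y" for y
  have PFe: "PF e" unfolding e_def
    by (intro real_polynomial_function.intros(2,3,4) b q PF_bracket)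
  have brWW: "bracket W W y = q y ^ (2 * k - 1) * ((real k)\<^sup>2 * ((s y)\<^sup>2 * a y) + q y * e y)" for y
  proof -
    obtain l where l: "k = Suc l" using k by (cases k) auto
    have sq: "bracket s q y = q y * b y" using b(2) bracket_commute[OF q(3) PFq] by simp
    have "bracket q W y = real k * q y ^ l * s y * (q y * a y) + q y ^ k * (q y * b y)"
      using bracket_commute[OF PFq PFW] brW[OF PFq, of y] a(2) sq by (simp add: l)
    moreover have "bracket s W y = real k * q y ^ l * s y * (q y * b y) + q y ^ k * bracket s s y"
      using bracket_commute[OF q(3) PFW] brW[OF q(3), of y] b(2) by (simp add: l)
    moreover have "bracket W W y = real k * q y ^ l * s y * bracket q W y + q y ^ k * bracket s W y"
      using brW[OF PFW, of y] by (simp add: l)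
    moreover have "2 * k - 1 = l + l + 1" using l by simp
    then have "q y ^ (2 * k - 1) = q y ^ l * q y ^ l * q y" by (simp add: power_add)
    moreover have "q y ^ k = q y ^ l * q y" using l by simp
    ultimately show ?thesis unfolding e_def by (simp only:) (simp only: power2_eq_square algebra_simps)
  qed
  obtain z where z: "q z ^ (2 * k - 1) \<noteq> 0" using nq by auto
  have "q y * ((s y)\<^sup>2 * c y - (p y)\<^sup>2 * e y) = (real k)\<^sup>2 * ((p y)\<^sup>2 * ((s y)\<^sup>2 * a y))" for y
  proof (rule PF_cancel[OF _ _ PFqk[of "2 * k - 1"] _ z])
    fix y
    have "k + k = Suc (2 * k - 1)" using k by simp
    then have "(q y ^ k)\<^sup>2 = q y ^ (2 * k - 1) * q y" by (metis power_Suc2 power_add power2_eq_square)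
    then have "(W y)\<^sup>2 = q y ^ (2 * k - 1) * q y * (s y)\<^sup>2" by (simp add: W_def power_mult_distrib)
    then show "q y ^ (2 * k - 1) * (q y * ((s y)\<^sup>2 * c y - (p y)\<^sup>2 * e y))
        = q y ^ (2 * k - 1) * ((real k)\<^sup>2 * ((p y)\<^sup>2 * ((s y)\<^sup>2 * a y)))"
      using W2[of y] unfolding brWW by (simp add: algebra_simps)
  qed (intro real_polynomial_function_diff real_polynomial_function.intros(2,4) real_polynomial_function_power PFc PFe PFq a q)+
  then have "(p y)\<^sup>2 * ((s y)\<^sup>2 * a y) = q y * (((s y)\<^sup>2 * c y - (p y)\<^sup>2 * e y) / (real k)\<^sup>2)" for y
    using k by (simp add: field_simps)
  then have "p y * (p y * (s y * (s y * a y))) = q y * (((s y)\<^sup>2 * c y - (p y)\<^sup>2 * e y) / (real k)\<^sup>2)" for y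
    by (simp only: power2_eq_square mult.assoc)
  then have "pdvd q (\<lambda>y. p y * (p y * (s y * (s y * a y))))"
    by (rule pdvdI[rotated])
       (intro real_polynomial_function_divide real_polynomial_function_diff real_polynomial_function_power real_polynomial_function.intros(4) PFc PFe q)
  from pprime_dvdD[OF q(1,6,4) _ this] have "pdvd q (\<lambda>y. p y * (s y * (s y * a y)))"
    by (simp add: real_polynomial_function.intros(4) q(3,4) a(1))
  from pprime_dvdD[OF q(1,6,4) _ this] have "pdvd q (\<lambda>y. s y * (s y * a y))"
    by (simp add: real_polynomial_function.intros(4) q(3) a(1))
  from pprime_dvdD[OF q(1,5,3) _ this] have "pdvd q (\<lambda>y. s y * a y)"
    by (simp add: real_polynomial_function.intros(4) q(3) a(1))
  then have "pdvd q a" by (rule pprime_dvdD[OF q(1,5,3) a(1)])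
  then obtain h where h: "PF h" "\<And>y. a y = q y * h y" by (auto simp: pdvd_def)
  have "pd k (\<lambda>x. q (Y x)) x = 0" for k x
    by (rule gradient_square_dvd[OF PF_Y[OF PFq] PF_Y[OF h(1)]])
       (simp add: gdot_Y PFq a h power2_eq_square)
  then have "q (Y x) = q (Y 0)" for x by (rule PF_constant[OF PF_Y[OF PFq]])
  then obtain e0 where e0: "\<And>x. q (Y x) = e0" by blast
  have qe: "q y = e0" for y
    by (rule eq_of_Y[of q "\<lambda>_. e0"]) (simp_all add: PFq e0 real_polynomial_function.intros(2))
  then have "e0 \<noteq> 0" using nq by blast
  then have "pdvd q (\<lambda>y. 1)"
    by (intro pdvdI[of "\<lambda>y. 1 / e0"]) (simp_all add: qe real_polynomial_function.intros(2))
  then show ?thesis using q(1) by (simp add: pprime_def)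
qed

end

section \<open>Hamiltonian flow and poles\<close>

lemma has_derivative_vec:
  fixes F :: "'a::euclidean_space \<Rightarrow> real^'m"
  assumes "\<And>j. ((\<lambda>x. F x $ j) has_derivative (\<lambda>h. F' h $ j)) (at x)"
  shows "(F has_derivative F') (at x)"
proof (rule iffD2[OF has_derivative_componentwise_within], rule ballI)
  fix b :: "real^'m" assume "b \<in> Basis"
  then obtain j where "b = axis j 1" by (auto simp: Basis_vec_def)
  then show "((\<lambda>x. F x \<bullet> b) has_derivative (\<lambda>h. F' h \<bullet> b)) (at x)"
    using assms[of j] by (simp add: inner_axis)
qed

definition straight :: "(real^'n) \<times> (real^'n) \<Rightarrow> (real^'n) \<times> (real^'n)" where
  "straight z = (snd z, 0)"

lemma polynomial_straight: "polynomial_function straight"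
  unfolding straight_def
  by (intro polynomial_function_Pair polynomial_function_bounded_linear bounded_linear_snd bounded_linear_zero)

lemma PF_lie_iter: "PF f \<Longrightarrow> polynomial_function V \<Longrightarrow> PF ((lie V ^^ s) f)"
  by (induction s) (auto intro: PF_lie)

lemma lie_straight_iter:
  fixes f :: "real^'n \<Rightarrow> real"
  assumes f: "PF f" and q: "\<And>t. f (x + t *\<^sub>R v) = poly q t"
  shows "(lie straight ^^ s) (\<lambda>z. f (fst z)) (x + t *\<^sub>R v, v) = poly ((pderiv ^^ s) q) t"
proof (induction s arbitrary: t)
  case 0
  then show ?case by (simp add: q)
next
  case (Suc s)
  let ?F = "(lie straight ^^ s) (\<lambda>z. f (fst z))"
  have PFF: "PF ?F" by (intro PF_lie_iter polynomial_straight PF_pair_fst f)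
  have "((\<lambda>t. ?F (x + t *\<^sub>R v, v)) has_derivative (\<lambda>h. frechet_derivative ?F (at (x + t *\<^sub>R v, v)) (h *\<^sub>R v, 0))) (at t)"
    by (rule diff_chain_at[of "\<lambda>t. (x + t *\<^sub>R v, v)" _ _ ?F, unfolded o_def, OF _ PF_has_derivative[OF PFF]])
       (auto intro!: derivative_eq_intros)
  moreover have "((\<lambda>t. ?F (x + t *\<^sub>R v, v)) has_derivative (\<lambda>h. h * poly (pderiv ((pderiv ^^ s) q)) t)) (at t)"
    unfolding Suc.IH
    using poly_DERIV[of "(pderiv ^^ s) q" t] by (simp add: has_field_derivative_def mult_commute_abs)
  ultimately have "(\<lambda>h. frechet_derivative ?F (at (x + t *\<^sub>R v, v)) (h *\<^sub>R v, 0)) = (\<lambda>h. h * poly (pderiv ((pderiv ^^ s) q)) t)"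
    by (rule has_derivative_unique)
  from fun_cong[OF this, of 1] have "frechet_derivative ?F (at (x + t *\<^sub>R v, v)) (v, 0) = poly ((pderiv ^^ Suc s) q) t"
    by simp
  moreover have "straight (x + t *\<^sub>R v, v) = (v, 0)" by (simp add: straight_def)
  ultimately have "lie straight ?F (x + t *\<^sub>R v, v) = poly ((pderiv ^^ Suc s) q) t" by (simp only: lie_def)
  then show ?case by simp
qed

text \<open>The Taylor sum will identify the lines over one fibre; the vanishing beyond
  \<open>N\<close>, uniform in \<open>x\<close> and \<open>v\<close>, will exclude poles.\<close>

lemma lie_straight_taylor:
  fixes f :: "real^'n \<Rightarrow> real"
  assumes f: "PF f"
  shows "\<exists>N. (\<forall>s x v. s > N \<longrightarrow> (lie straight ^^ s) (\<lambda>z. f (fst z)) (x, v) = 0) \<and>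
    (\<forall>x v. f (x + v) = (\<Sum>s\<le>N. (lie straight ^^ s) (\<lambda>z. f (fst z)) (x, v) / fact s))"
proof -
  obtain N where N: "\<And>x v. \<exists>q. degree q \<le> N \<and> (\<forall>t. f (x + t *\<^sub>R v) = poly q t)"
    using PF_line[OF f] by blast
  have T: "\<exists>q. degree q \<le> N \<and> (\<forall>t. f (x + t *\<^sub>R v) = poly q t) \<and>
      (\<forall>s. (lie straight ^^ s) (\<lambda>z. f (fst z)) (x, v) = fact s * coeff q s)" for x v
  proof -
    obtain q where q: "degree q \<le> N" "\<And>t. f (x + t *\<^sub>R v) = poly q t" using N by blast
    have "(lie straight ^^ s) (\<lambda>z. f (fst z)) (x, v) = fact s * coeff q s" for s
      using lie_straight_iter[OF f q(2), of s 0]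
      by (simp add: poly_0_coeff_0 coeff_higher_pderiv pochhammer_fact[symmetric])
    then show ?thesis using q by blast
  qed
  show ?thesis
  proof (intro exI[of _ N] conjI allI impI)
    fix s x and v :: "real^'n" assume "s > N"
    then show "(lie straight ^^ s) (\<lambda>z. f (fst z)) (x, v) = 0"
      using T[of x v] by (auto simp: coeff_eq_0)
  next
    fix x v
    obtain q where q: "degree q \<le> N" "\<forall>t. f (x + t *\<^sub>R v) = poly q t"
      "\<forall>s. (lie straight ^^ s) (\<lambda>z. f (fst z)) (x, v) = fact s * coeff q s" using T by blast
    have "f (x + v) = poly q 1" using q(2)[rule_format, of 1] by simp
    also have "\<dots> = (\<Sum>s\<le>degree q. coeff q s)" by (simp add: poly_altdef)
    also have "\<dots> = (\<Sum>s\<le>N. coeff q s)"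
      by (rule sum.mono_neutral_left) (use q(1) in \<open>auto simp: coeff_eq_0\<close>)
    finally show "f (x + v) = (\<Sum>s\<le>N. (lie straight ^^ s) (\<lambda>z. f (fst z)) (x, v) / fact s)"
      using q(3) by simp
  qed
qed

lemma pd_prod:
  "finite S \<Longrightarrow> (\<And>i. i \<in> S \<Longrightarrow> PF (f i)) \<Longrightarrow>
    pd m (\<lambda>x. \<Prod>i\<in>S. f i x) x = (\<Sum>i\<in>S. pd m (f i) x * (\<Prod>r\<in>S - {i}. f r x))"
proof (induction S rule: finite_induct)
  case (insert a S)
  have "(\<Prod>r\<in>insert a S - {i}. f r x) = f a x * (\<Prod>r\<in>S - {i}. f r x)" if "i \<in> S" for i
  proof -
    have "insert a S - {i} = insert a (S - {i})" using that insert.hyps by auto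
    then show ?thesis using insert.hyps by simp
  qed
  moreover have "insert a S - {a} = S" using insert.hyps by auto
  ultimately show ?case using insert
    by (simp add: pd_mult real_polynomial_function_prod sum_distrib_left algebra_simps)
qed auto

text \<open>Jacobi's formula, with an inverse given at the point \<open>x\<close> only. The
  derivative of row \<open>i\<close> is a combination of the rows of \<open>A x\<close> with
  coefficients \<open>c i\<close>, and in the determinant only the multiple of row \<open>i\<close>
  itself survives.\<close>

lemma pd_det:
  fixes A :: "real^'m \<Rightarrow> real^'n^'n"
  assumes A: "\<And>i j. PF (\<lambda>x. A x $ i $ j)" and B: "B ** A x = mat 1"
  shows "pd m (\<lambda>x. det (A x)) x = det (A x) * (\<Sum>i\<in>UNIV. \<Sum>k\<in>UNIV. pd m (\<lambda>x. A x $ i $ k) x * B $ k $ i)"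
proof -
  define v where "v i = (\<chi> k. pd m (\<lambda>x. A x $ i $ k) x)" for i
  define c where "c i = (\<chi> l. \<Sum>k\<in>UNIV. v i $ k * B $ k $ l)" for i
  have fin: "finite {p. p permutes (UNIV :: 'n set)}" by (simp add: finite_permutations)
  have PFp: "PF (\<lambda>x. \<Prod>i\<in>UNIV. A x $ i $ p i)" for p by (auto intro!: real_polynomial_function_prod A)
  have "pd m (\<lambda>x. det (A x)) x = (\<Sum>p\<in>{p. p permutes UNIV}. of_int (sign p) * pd m (\<lambda>x. \<Prod>i\<in>UNIV. A x $ i $ p i) x)"
    unfolding det_def by (simp add: pd_sum pd_cmult PFp real_polynomial_function.intros(2,4))
  also have "\<dots> = (\<Sum>p\<in>{p. p permutes UNIV}. \<Sum>i\<in>UNIV. of_int (sign p) * (\<Prod>r\<in>UNIV. (if r = i then v i else A x $ r) $ p r))"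
  proof (intro sum.cong refl)
    fix p
    have "(\<Prod>r\<in>UNIV. (if r = i then v i else A x $ r) $ p r) = pd m (\<lambda>x. A x $ i $ p i) x * (\<Prod>r\<in>UNIV - {i}. A x $ r $ p r)" for i
    proof -
      have "(\<Prod>r\<in>UNIV. (if r = i then v i else A x $ r) $ p r)
          = (if i = i then v i else A x $ i) $ p i * (\<Prod>r\<in>UNIV - {i}. (if r = i then v i else A x $ r) $ p r)"
        by (rule prod.remove) auto
      also have "(\<Prod>r\<in>UNIV - {i}. (if r = i then v i else A x $ r) $ p r) = (\<Prod>r\<in>UNIV - {i}. A x $ r $ p r)"
        by (rule prod.cong) auto
      finally show ?thesis by (simp add: v_def)
    qed
    then show "of_int (sign p) * pd m (\<lambda>x. \<Prod>i\<in>UNIV. A x $ i $ p i) x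
        = (\<Sum>i\<in>UNIV. of_int (sign p) * (\<Prod>r\<in>UNIV. (if r = i then v i else A x $ r) $ p r))"
      by (simp add: pd_prod A sum_distrib_left)
  qed
  also have "\<dots> = (\<Sum>i\<in>UNIV. det (\<chi> r. if r = i then v i else A x $ r))"
    by (subst sum.swap) (simp add: det_def)
  also have "\<dots> = (\<Sum>i\<in>UNIV. c i $ i * det (A x))"
  proof (intro sum.cong refl)
    fix i
    have "v i = (\<Sum>l\<in>UNIV. c i $ l *s row l (A x))"
    proof -
      have "v i = v i v* (B ** A x)" by (simp add: B)
      also have "\<dots> = (v i v* B) v* A x" by (simp add: vector_matrix_mul_assoc)
      also have "v i v* B = c i" by (simp add: vec_eq_iff vector_matrix_mult_def c_def mult.commute)
      also have "c i v* A x = (\<Sum>l\<in>UNIV. c i $ l *s row l (A x))"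
        by (simp add: vec_eq_iff vector_matrix_mult_def row_def mult.commute)
      finally show ?thesis .
    qed
    then have "(\<chi> r. if r = i then v i else A x $ r) = (\<chi> r. if r = i then (\<Sum>l\<in>UNIV. c i $ l *s row l (A x)) else row r (A x))"
      by (simp add: vec_eq_iff row_def)
    then show "det (\<chi> r. if r = i then v i else A x $ r) = c i $ i * det (A x)"
      using cramer_lemma_transpose[of i "c i" "A x"] by simp
  qed
  finally show ?thesis by (simp add: c_def v_def sum_distrib_left sum_distrib_right algebra_simps)
qed

definition lap :: "(real^'n \<Rightarrow> real) \<Rightarrow> real^'n \<Rightarrow> real" where
  "lap f x = (\<Sum>k\<in>UNIV. pd k (pd k f) x)"

lemma PF_lap: "PF f \<Longrightarrow> PF (lap f)"
  unfolding lap_def by (intro real_polynomial_function_sum PF_pd) auto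

lemma pprime_power_dvd:
  assumes "pprime q" "PF a" "pdvd q (\<lambda>x. a x ^ N)"
  shows "pdvd q a"
  using assms(3)
proof (induction N)
  case 0
  then show ?case using assms(1) by (simp add: pprime_def)
next
  case (Suc N)
  then show ?case
    using pprime_dvdD[OF assms(1) _ assms(2), of "\<lambda>x. a x ^ N"] assms(2)
    by (auto simp: real_polynomial_function_power)
qed

lemma pdvd_diff: "pdvd q a \<Longrightarrow> pdvd q b \<Longrightarrow> pdvd q (\<lambda>x. a x - b x)"
  unfolding pdvd_def by (metis (no_types, lifting) right_diff_distrib real_polynomial_function_diff)

context gradient_algebra
begin

text \<open>Minus the gradient in \<open>y\<close> of the Hamiltonian, half the value of the
  cometric at \<xi>.\<close>

definition force :: "real^'n \<Rightarrow> real^'n \<Rightarrow> real^'n" where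
  "force y \<xi> = (\<chi> k. - (1/2) * (\<Sum>i\<in>UNIV. \<Sum>j\<in>UNIV. \<xi> $ i * \<xi> $ j * pd k (g i j) y))"

definition jac_transpose :: "real^'n \<Rightarrow> real^'n \<Rightarrow> real^'n" where
  "jac_transpose x \<xi> = (\<chi> m. \<Sum>j\<in>UNIV. \<xi> $ j * pd m (I j) x)"

text \<open>The geodesic flow of the cometric \<open>g\<close>: \<open>hamiltonian_field\<close> is its Hamiltonian vector field in the
  coordinates \<open>(y, \<xi>)\<close>, \<open>lifted_field\<close> the same field lifted to \<open>(x, \<xi>)\<close>. In the coordinates \<open>(x, v)\<close>,
  \<open>v = J(x)\<^sup>T \<xi>\<close>, it is the straight-line flow; unlike \<open>\<xi>\<close>, it stays regular where \<open>J\<close> is singular.\<close>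

definition hamiltonian_field :: "(real^'n) \<times> (real^'n) \<Rightarrow> (real^'n) \<times> (real^'n)" where
  "hamiltonian_field z = ((\<chi> i. \<Sum>j\<in>UNIV. g i j (fst z) * snd z $ j), force (fst z) (snd z))"

definition lifted_field :: "(real^'n) \<times> (real^'n) \<Rightarrow> (real^'n) \<times> (real^'n)" where
  "lifted_field z = (jac_transpose (fst z) (snd z), force (Y (fst z)) (snd z))"

lemma polynomial_hamiltonian_field: "polynomial_function hamiltonian_field"
  unfolding hamiltonian_field_def force_def
  by (intro polynomial_function_Pair polynomial_function_vec)
     (auto intro!: real_polynomial_function_sum real_polynomial_function.intros(2,4) PF_pair_fst[OF PF_pd[OF PF_g]]
        PF_pair_fst PF_g PF_pair_snd[OF PF_nth] real_polynomial_function_minus real_polynomial_function_divide)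

lemma Y_has_derivative: "(Y has_derivative (\<lambda>h. \<chi> j. \<Sum>k\<in>UNIV. h $ k * pd k (I j) x)) (at x)"
  by (rule has_derivative_vec) (simp add: has_derivative_pd PF_I)

text \<open>The map \<open>(x, \<xi>) \<mapsto> (Y x, \<xi>)\<close> carries the lifted field to the
  Hamiltonian field because \<open>J J^T = g\<close>.\<close>

lemma lie_Phi:
  assumes "PF R"
  shows "lie lifted_field (\<lambda>z. R (Y (fst z), snd z)) = (\<lambda>z. lie hamiltonian_field R (Y (fst z), snd z))"
proof
  fix z :: "(real^'n) \<times> (real^'n)"
  show "lie lifted_field (\<lambda>z. R (Y (fst z), snd z)) z = lie hamiltonian_field R (Y (fst z), snd z)"
  proof (rule lie_related[OF assms])
    show "((\<lambda>z. (Y (fst z), snd z)) has_derivative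
        (\<lambda>h. (\<chi> j. \<Sum>k\<in>UNIV. fst h $ k * pd k (I j) (fst z), snd h))) (at z)"
      by (rule has_derivative_Pair[OF diff_chain_at[of fst fst z Y, unfolded o_def]])
         (auto intro!: has_derivative_fst has_derivative_snd Y_has_derivative)
    have "(\<Sum>k\<in>UNIV. (\<Sum>i\<in>UNIV. snd z $ i * pd k (I i) (fst z)) * pd k (I j) (fst z))
        = (\<Sum>i\<in>UNIV. g j i (Y (fst z)) * snd z $ i)" for j
    proof -
      have "(\<Sum>k\<in>UNIV. (\<Sum>i\<in>UNIV. snd z $ i * pd k (I i) (fst z)) * pd k (I j) (fst z))
          = (\<Sum>i\<in>UNIV. \<Sum>k\<in>UNIV. (pd k (I j) (fst z) * pd k (I i) (fst z)) * snd z $ i)"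
        by (subst sum.swap) (simp add: sum_distrib_left algebra_simps)
      then show ?thesis by (simp add: grad Y_def flip: sum_distrib_right)
    qed
    then show "(\<chi> j. \<Sum>k\<in>UNIV. fst (lifted_field z) $ k * pd k (I j) (fst z), snd (lifted_field z)) = hamiltonian_field (Y (fst z), snd z)"
      by (simp add: lifted_field_def hamiltonian_field_def jac_transpose_def)
  qed
qed

lemma pd_g_Y:
  "(\<Sum>j\<in>UNIV. pd j (g a b) (Y x) * pd m (I j) x)
    = (\<Sum>k\<in>UNIV. pd m (pd k (I a)) x * pd k (I b) x + pd k (I a) x * pd m (pd k (I b)) x)"
proof -
  have "(\<lambda>x. g a b (Y x)) = (\<lambda>x. \<Sum>k\<in>UNIV. pd k (I a) x * pd k (I b) x)"
    by (simp add: grad Y_def)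
  then have "pd m (\<lambda>x. g a b (Y x)) x = (\<Sum>k\<in>UNIV. pd m (pd k (I a)) x * pd k (I b) x + pd k (I a) x * pd m (pd k (I b)) x)"
    by (simp add: pd_sum pd_mult PF_pd PF_I real_polynomial_function.intros(4) add.commute)
  then show ?thesis by (simp add: pd_Y PF_g)
qed

text \<open>The velocity \<open>J(x)^T \<xi>\<close> is constant along the lifted flow: the Hessian
  terms produced by moving \<open>x\<close> cancel against the force, as differentiating
  \<open>g = J J^T\<close> shows.\<close>

lemma lie_Psi:
  assumes "PF R"
  shows "lie lifted_field (\<lambda>z. R (fst z, jac_transpose (fst z) (snd z))) = (\<lambda>z. lie straight R (fst z, jac_transpose (fst z) (snd z)))"
proof
  fix z :: "(real^'n) \<times> (real^'n)"
  obtain x \<xi> where z: "z = (x, \<xi>)" by (cases z)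
  let ?J' = "\<lambda>h. \<chi> m. \<Sum>j\<in>UNIV. \<xi> $ j * (\<Sum>k\<in>UNIV. fst h $ k * pd k (pd m (I j)) x) + snd h $ j * pd m (I j) x"
  show "lie lifted_field (\<lambda>z. R (fst z, jac_transpose (fst z) (snd z))) z = lie straight R (fst z, jac_transpose (fst z) (snd z))"
  proof (rule lie_related[OF assms])
    have "((\<lambda>z. jac_transpose (fst z) (snd z)) has_derivative ?J') (at z)"
    proof (rule has_derivative_vec)
      fix m
      have "((\<lambda>z. pd m (I j) (fst z)) has_derivative (\<lambda>h. \<Sum>k\<in>UNIV. fst h $ k * pd k (pd m (I j)) x)) (at z)" for j
        using diff_chain_at[of fst fst z "pd m (I j)", unfolded o_def,
            OF bounded_linear_imp_has_derivative[OF bounded_linear_fst] has_derivative_pd[OF PF_pd[OF PF_I]]]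
        by (simp add: z)
      moreover have "((\<lambda>z. snd z $ j) has_derivative (\<lambda>h. snd h $ j)) (at z)" for j
        by (intro bounded_linear_imp_has_derivative bounded_linear_compose[OF bounded_linear_vec_nth bounded_linear_snd, unfolded o_def])
      ultimately have "((\<lambda>z. \<Sum>j\<in>UNIV. snd z $ j * pd m (I j) (fst z)) has_derivative
          (\<lambda>h. \<Sum>j\<in>UNIV. snd z $ j * (\<Sum>k\<in>UNIV. fst h $ k * pd k (pd m (I j)) x) + snd h $ j * pd m (I j) (fst z))) (at z)"
        by (intro has_derivative_sum has_derivative_mult)
      then show "((\<lambda>z. jac_transpose (fst z) (snd z) $ m) has_derivative (\<lambda>h. ?J' h $ m)) (at z)"
        by (simp add: jac_transpose_def z)
    qed
    then show "((\<lambda>z. (fst z, jac_transpose (fst z) (snd z))) has_derivative (\<lambda>h. (fst h, ?J' h))) (at z)"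
      by (intro has_derivative_Pair has_derivative_fst has_derivative_ident)
    have "?J' (lifted_field z) = 0"
    proof -
      have "?J' (lifted_field z) $ m = 0" for m
      proof -
        define H where "H a k = pd m (pd k (I a)) x" for a k
        define J where "J a k = pd k (I a) x" for a k
        have "(\<Sum>j\<in>UNIV. \<xi> $ j * (\<Sum>k\<in>UNIV. jac_transpose x \<xi> $ k * pd k (pd m (I j)) x))
            = (\<Sum>a\<in>UNIV. \<Sum>k\<in>UNIV. \<Sum>b\<in>UNIV. \<xi> $ a * \<xi> $ b * (H a k * J b k))"
          by (simp add: jac_transpose_def H_def J_def pd_commute[OF PF_I, of _ m] sum_distrib_left sum_distrib_right algebra_simps)
        also have "\<dots> = (\<Sum>a\<in>UNIV. \<Sum>b\<in>UNIV. \<Sum>k\<in>UNIV. \<xi> $ a * \<xi> $ b * (H a k * J b k))"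
          by (rule sum.cong[OF refl], rule sum.swap)
        finally have 1: "(\<Sum>j\<in>UNIV. \<xi> $ j * (\<Sum>k\<in>UNIV. jac_transpose x \<xi> $ k * pd k (pd m (I j)) x)) = \<dots>" .
        have "(\<Sum>j\<in>UNIV. force (Y x) \<xi> $ j * pd m (I j) x)
            = - (1/2) * (\<Sum>j\<in>UNIV. \<Sum>a\<in>UNIV. \<Sum>b\<in>UNIV. \<xi> $ a * \<xi> $ b * (pd j (g a b) (Y x) * pd m (I j) x))"
          by (simp add: force_def sum_distrib_left sum_distrib_right sum_negf algebra_simps)
        also have "(\<Sum>j\<in>UNIV. \<Sum>a\<in>UNIV. \<Sum>b\<in>UNIV. \<xi> $ a * \<xi> $ b * (pd j (g a b) (Y x) * pd m (I j) x))
            = (\<Sum>a\<in>UNIV. \<Sum>b\<in>UNIV. \<xi> $ a * \<xi> $ b * (\<Sum>j\<in>UNIV. pd j (g a b) (Y x) * pd m (I j) x))"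
          unfolding sum_distrib_left
          by (rule trans[OF sum.swap], rule sum.cong[OF refl], rule sum.swap)
        also have "\<dots> = (\<Sum>a\<in>UNIV. \<Sum>b\<in>UNIV. \<Sum>k\<in>UNIV. \<xi> $ a * \<xi> $ b * (H a k * J b k))
            + (\<Sum>a\<in>UNIV. \<Sum>b\<in>UNIV. \<Sum>k\<in>UNIV. \<xi> $ a * \<xi> $ b * (J a k * H b k))"
          unfolding pd_g_Y by (simp add: H_def J_def sum_distrib_left sum.distrib distrib_left)
        \<comment> \<open>Exchanging \<open>a\<close> and \<open>b\<close> shows that both Hessian
          terms agree, which absorbs the factor 1/2 of the force.\<close>
        also have "(\<Sum>a\<in>UNIV. \<Sum>b\<in>UNIV. \<Sum>k\<in>UNIV. \<xi> $ a * \<xi> $ b * (J a k * H b k))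
            = (\<Sum>a\<in>UNIV. \<Sum>b\<in>UNIV. \<Sum>k\<in>UNIV. \<xi> $ a * \<xi> $ b * (H a k * J b k))"
          by (subst sum.swap) (intro sum.cong refl, simp add: mult.commute)
        finally have 2: "(\<Sum>j\<in>UNIV. force (Y x) \<xi> $ j * pd m (I j) x)
            = - (\<Sum>a\<in>UNIV. \<Sum>b\<in>UNIV. \<Sum>k\<in>UNIV. \<xi> $ a * \<xi> $ b * (H a k * J b k))" by simp
        show ?thesis using 1 2 by (simp add: lifted_field_def z sum.distrib)
      qed
      then show ?thesis unfolding vec_eq_iff zero_index by blast
    qed
    then show "(fst (lifted_field z), ?J' (lifted_field z)) = straight (fst z, jac_transpose (fst z) (snd z))"
      by (simp add: lifted_field_def straight_def)
  qed
qed

lemma lie_Phi_iter: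
  assumes "PF R"
  shows "(lie lifted_field ^^ s) (\<lambda>z. R (Y (fst z), snd z)) = (\<lambda>z. (lie hamiltonian_field ^^ s) R (Y (fst z), snd z))"
proof (induction s)
  case (Suc s)
  then show ?case using lie_Phi[OF PF_lie_iter[OF assms polynomial_hamiltonian_field, of s]] by simp
qed auto

lemma lie_Psi_iter:
  assumes "PF f"
  shows "(lie lifted_field ^^ s) (\<lambda>z. f (fst z)) = (\<lambda>z. (lie straight ^^ s) (\<lambda>z. f (fst z)) (fst z, jac_transpose (fst z) (snd z)))"
proof (induction s)
  case (Suc s)
  then show ?case using lie_Psi[OF PF_lie_iter[OF PF_pair_fst[OF assms] polynomial_straight, of s]] by simp
qed auto

text \<open>All derivatives of I^j at the start of the line are iterated Hamiltonian derivatives at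
  \<open>(Y x, \<xi>)\<close>, so they depend on the fibre only, and a polynomial is the sum of its
  Taylor series. Singular points of \<open>Y\<close> are included.\<close>

lemma fibre_lines:
  assumes "Y x = Y x'"
  shows "I j (x + jac_transpose x \<xi>) = I j (x' + jac_transpose x' \<xi>)"
proof -
  obtain N where N: "\<forall>x v. I j (x + v) = (\<Sum>s\<le>N. (lie straight ^^ s) (\<lambda>z. I j (fst z)) (x, v) / fact s)"
    using lie_straight_taylor[OF PF_I[of j]] by blast
  have "(lie straight ^^ s) (\<lambda>z. I j (fst z)) (x, jac_transpose x \<xi>) = (lie hamiltonian_field ^^ s) (\<lambda>z. fst z $ j) (Y x, \<xi>)" for s x
    using fun_cong[OF lie_Psi_iter[OF PF_I, of s j], of "(x, \<xi>)"]
      fun_cong[OF lie_Phi_iter[OF PF_pair_fst[OF PF_nth], of s j], of "(x, \<xi>)"] by simp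
  then show ?thesis by (simp add: N assms)
qed

lemma lie_hamiltonian_field_fst: "PF S \<Longrightarrow> lie hamiltonian_field (\<lambda>z. S (fst z)) (y, axis j 1) = bracket S (\<lambda>y. y $ j) y"
proof -
  assume S: "PF S"
  have "lie hamiltonian_field (\<lambda>z. S (fst z)) (y, axis j 1) = (\<Sum>k\<in>UNIV. fst (hamiltonian_field (y, axis j 1)) $ k * pd k S y)"
    by (rule lie_eqI)
       (use diff_chain_at[of fst fst "(y, axis j 1)" S, unfolded o_def,
          OF bounded_linear_imp_has_derivative[OF bounded_linear_fst] has_derivative_pd[OF S]] in simp)
  then show ?thesis
    by (simp add: hamiltonian_field_def bracket_def pd_nth axis_def if_distrib[of "\<lambda>z. _ * z"] if_distrib[of "\<lambda>z. z * _"] mult.commute cong: if_cong)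
qed

text \<open>If \<open>f = P/S\<close> is polynomial in \<open>x\<close>, its derivatives along the straight lines vanish from some
  order on, while their pole order along \<open>S\<close> would grow unless \<open>S\<close> divides \<open>P {S, y\<^sub>j}\<^sup>N\<close>.\<close>

lemma pole_lemma:
  assumes f: "PF f" and S: "PF S" and P: "PF P" and fS: "\<And>x. f x * S (Y x) = P (Y x)"
  shows "\<exists>N. pdvd S (\<lambda>y. P y * bracket S (\<lambda>y. y $ j) y ^ N)"
proof -
  define S1 where "S1 z = S (fst z)" for z :: "(real^'n) \<times> (real^'n)"
  define P1 where "P1 z = P (fst z)" for z :: "(real^'n) \<times> (real^'n)"
  define F where "F s = (lie lifted_field ^^ s) (\<lambda>z. f (fst z))" for s
  have PF1: "PF S1" "PF P1" unfolding S1_def P1_def by (intro PF_pair_fst S P)+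
  define T where "T = lie hamiltonian_field S1"
  have PFT: "PF T" unfolding T_def by (intro PF_lie PF1 polynomial_hamiltonian_field)
  let ?\<Phi> = "\<lambda>z::(real^'n) \<times> (real^'n). (Y (fst z), snd z)"
  have PF\<Phi>: "PF (\<lambda>z. R (?\<Phi> z))" if "PF R" for R
    by (rule PF_compose[OF polynomial_function_Pair that])
       (auto intro!: polynomial_function_bounded_linear bounded_linear_snd
         polynomial_function_compose[OF _ polynomial_Y, of fst, unfolded o_def] bounded_linear_fst)
  have PF\<Psi>: "polynomial_function (\<lambda>z::(real^'n) \<times> (real^'n). (fst z, jac_transpose (fst z) (snd z)))"
    unfolding jac_transpose_def
    by (rule polynomial_function_Pair[OF polynomial_function_bounded_linear[OF bounded_linear_fst] polynomial_function_vec])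
       (auto intro!: real_polynomial_function_sum real_polynomial_function.intros(4)
          PF_pair_fst[OF PF_pd[OF PF_I]] PF_pair_snd[OF PF_nth])
  have PFF: "PF (F s)" for s
    unfolding F_def lie_Psi_iter[OF f]
    by (rule PF_compose[OF PF\<Psi> PF_lie_iter[OF PF_pair_fst[OF f] polynomial_straight]])
  \<comment> \<open>With denominators cleared, this is the leading term modulo \<open>S\<close> of
    the \<open>s\<close>-th derivative of \<open>P / S\<close>: differentiating the inverse of
    \<open>S\<close> repeatedly yields the sign, the factorial and the power of
    \<open>T\<close>.\<close>
  have ind: "\<exists>R. PF R \<and> (\<forall>z. S1 (?\<Phi> z) ^ Suc s * F s z = (-1) ^ s * fact s * (P1 (?\<Phi> z) * T (?\<Phi> z) ^ s) + S1 (?\<Phi> z) * R (?\<Phi> z))" for s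
  proof (induction s)
    case 0
    show ?case using fS by (intro exI[of _ "\<lambda>z. 0"]) (auto simp: F_def S1_def P1_def mult.commute)
  next
    case (Suc s)
    then obtain R where R: "PF R"
      "\<And>z. S1 (?\<Phi> z) ^ Suc s * F s z = (-1) ^ s * fact s * (P1 (?\<Phi> z) * T (?\<Phi> z) ^ s) + S1 (?\<Phi> z) * R (?\<Phi> z)" by blast
    define W where "W z = (-1) ^ s * fact s * (P1 z * T z ^ s) + S1 z * R z" for z
    have PFW: "PF W" unfolding W_def
      by (intro real_polynomial_function.intros(2,3,4) real_polynomial_function_power PF1 PFT R)
    have l1: "lie lifted_field (\<lambda>z. S1 (?\<Phi> z) ^ Suc s * F s z) = (\<lambda>z. lie hamiltonian_field W (?\<Phi> z))"
      unfolding R(2) W_def[symmetric] by (rule lie_Phi[OF PFW])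
    have FS: "lie lifted_field (F s) = F (Suc s)" by (simp add: F_def)
    have l2: "lie lifted_field (\<lambda>z. S1 (?\<Phi> z) ^ Suc s * F s z)
        = (\<lambda>z. S1 (?\<Phi> z) ^ Suc s * F (Suc s) z + real (Suc s) * S1 (?\<Phi> z) ^ s * T (?\<Phi> z) * F s z)"
      by (subst lie_mult)
         (simp_all add: PF\<Phi> PF1 PFF real_polynomial_function_power lie_power lie_Phi[OF PF1(1)] T_def FS del: power_Suc)
    have step: "S1 (?\<Phi> z) ^ Suc s * F (Suc s) z = lie hamiltonian_field W (?\<Phi> z) - real (Suc s) * S1 (?\<Phi> z) ^ s * T (?\<Phi> z) * F s z" for z
      using fun_cong[OF l1, of z] fun_cong[OF l2, of z] by linarith
    define R' where "R' z = lie hamiltonian_field W z - real (Suc s) * T z * R z" for z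
    have "PF R'" unfolding R'_def
      by (intro real_polynomial_function_diff real_polynomial_function.intros(2,4) PF_lie PFW polynomial_hamiltonian_field PFT R)
    moreover have "S1 (?\<Phi> z) ^ Suc (Suc s) * F (Suc s) z
        = (-1) ^ Suc s * fact (Suc s) * (P1 (?\<Phi> z) * T (?\<Phi> z) ^ Suc s) + S1 (?\<Phi> z) * R' (?\<Phi> z)" for z
    proof -
      have "S1 (?\<Phi> z) ^ Suc (Suc s) * F (Suc s) z = S1 (?\<Phi> z) * (S1 (?\<Phi> z) ^ Suc s * F (Suc s) z)"
        by (simp only: power_Suc mult.assoc)
      also have "\<dots> = S1 (?\<Phi> z) * lie hamiltonian_field W (?\<Phi> z) - real (Suc s) * T (?\<Phi> z) * (S1 (?\<Phi> z) ^ Suc s * F s z)"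
        unfolding step by (simp add: algebra_simps)
      also have "\<dots> = (-1) ^ Suc s * fact (Suc s) * (P1 (?\<Phi> z) * T (?\<Phi> z) ^ Suc s) + S1 (?\<Phi> z) * R' (?\<Phi> z)"
        unfolding R(2) R'_def by (simp add: algebra_simps)
      finally show ?thesis .
    qed
    ultimately show ?case by blast
  qed
  obtain N where N: "\<forall>s x v. s > N \<longrightarrow> (lie straight ^^ s) (\<lambda>z. f (fst z)) (x, v) = 0"
    using lie_straight_taylor[OF f] by blast
  have F0: "F (Suc N) z = 0" for z unfolding F_def lie_Psi_iter[OF f] using N by blast
  obtain R where R: "PF R" "\<And>z. S1 (?\<Phi> z) ^ Suc (Suc N) * F (Suc N) z
      = (-1) ^ Suc N * fact (Suc N) * (P1 (?\<Phi> z) * T (?\<Phi> z) ^ Suc N) + S1 (?\<Phi> z) * R (?\<Phi> z)"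
    using ind[of "Suc N"] by blast
  define c :: real where "c = (-1) ^ Suc N * fact (Suc N)"
  have c: "c \<noteq> 0" by (simp add: c_def)
  \<comment> \<open>Freezing \<xi> at the \<open>j\<close>-th unit vector turns \<open>T\<close>
    into the bracket of \<open>S\<close> with the \<open>j\<close>-th coordinate.\<close>
  have PFax: "PF (\<lambda>y. R' (y, axis j 1))" if "PF R'" for R' :: "(real^'n) \<times> (real^'n) \<Rightarrow> real"
    by (rule PF_compose[OF polynomial_function_Pair[OF polynomial_function_id polynomial_function_const] that])
  have "P y * bracket S (\<lambda>y. y $ j) y ^ Suc N = S y * (- R (y, axis j 1) / c)" for y
  proof (rule eq_of_Y[of "\<lambda>y. P y * bracket S (\<lambda>y. y $ j) y ^ Suc N" "\<lambda>y. S y * (- R (y, axis j 1) / c)"])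
    show "PF (\<lambda>y. P y * bracket S (\<lambda>y. y $ j) y ^ Suc N)"
      by (intro real_polynomial_function.intros(4) real_polynomial_function_power P PF_bracket S PF_nth)
    show "PF (\<lambda>y. S y * (- R (y, axis j 1) / c))"
      by (intro real_polynomial_function.intros(4) real_polynomial_function_divide real_polynomial_function_minus S PFax R)
    fix x
    have "0 = c * (P (Y x) * T (Y x, axis j 1) ^ Suc N) + S (Y x) * R (Y x, axis j 1)"
      using R(2)[of "(x, axis j 1)"] unfolding F0 c_def[symmetric] by (simp add: P1_def S1_def del: power_Suc)
    moreover have "T (Y x, axis j 1) = bracket S (\<lambda>y. y $ j) (Y x)"
      unfolding T_def S1_def by (rule lie_hamiltonian_field_fst[OF S])
    ultimately show "P (Y x) * bracket S (\<lambda>y. y $ j) (Y x) ^ Suc N = S (Y x) * (- R (Y x, axis j 1) / c)"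
      using c by (simp add: field_simps del: power_Suc)
  qed
  moreover have "PF (\<lambda>y. - R (y, axis j 1) / c)"
    by (intro real_polynomial_function_divide real_polynomial_function_minus PFax R)
  ultimately show ?thesis by (intro exI[of _ "Suc N"] pdvdI)
qed

text \<open>The function \<open>f\<close> has a simple pole along \<open>q\<close>. By
  \<open>pole_lemma\<close> for \<open>S = q * s\<close>, \<open>q\<close> divides a power of the
  bracket of \<open>S\<close>, hence the bracket itself, and modulo \<open>q\<close> this is
  \<open>s\<close> times the bracket of \<open>q\<close>.\<close>

lemma prime_pole_dvd_bracket:
  assumes f: "PF f" and q: "pprime q" and s: "PF s" "\<not> pdvd q s" and p: "PF p" "\<not> pdvd q p"
    and eq: "\<And>x. f x * (q (Y x) * s (Y x)) = p (Y x)"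
  shows "pdvd q (bracket q (\<lambda>y. y $ j))"
proof -
  have PFq: "PF q" using q by (simp add: pprime_def)
  let ?u = "\<lambda>y::real^'n. y $ j"
  have PFb: "PF (bracket q ?u)" "PF (bracket s ?u)" by (intro PF_bracket PFq s PF_nth)+
  define S where "S y = q y * s y" for y
  have PFS: "PF S" unfolding S_def by (intro real_polynomial_function.intros(4) PFq s)
  obtain N where N: "pdvd S (\<lambda>y. p y * bracket S ?u y ^ N)"
    using pole_lemma[OF f PFS p(1)] eq unfolding S_def by blast
  then obtain c where c: "PF c" "\<And>y. p y * bracket S ?u y ^ N = q y * (s y * c y)"
    by (auto simp: pdvd_def S_def mult.assoc)
  have "pdvd q (\<lambda>y. p y * bracket S ?u y ^ N)"
    by (rule pdvdI[OF _ c(2)]) (intro real_polynomial_function.intros(4) c s)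
  then have "pdvd q (\<lambda>y. bracket S ?u y ^ N)"
    by (rule pprime_dvdD[OF q p(2,1), rotated]) (intro real_polynomial_function_power PF_bracket PFS PF_nth)
  then have "pdvd q (bracket S ?u)" by (rule pprime_power_dvd[OF q PF_bracket[OF PFS PF_nth]])
  moreover have "bracket S ?u y = q y * bracket s ?u y + s y * bracket q ?u y" for y
    unfolding S_def by (rule bracket_mult_left[OF PFq s(1)])
  moreover have "pdvd q (\<lambda>y. q y * bracket s ?u y)" by (rule pdvdI[OF PFb(2)]) simp
  ultimately have "pdvd q (\<lambda>y. s y * bracket q ?u y)"
    using pdvd_diff[of q "bracket S ?u" "\<lambda>y. q y * bracket s ?u y"] by simp
  then show ?thesis by (rule pprime_dvdD[OF q s(2,1) PFb(1)])
qed

end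

section \<open>The Laplacian\<close>

context gradient_algebra
begin

definition div_cometric :: "'n \<Rightarrow> real^'n \<Rightarrow> real" where
  "div_cometric j y = (\<Sum>i\<in>UNIV. pd i (g i j) y)"

lemma PF_div_cometric: "PF (div_cometric j)"
  unfolding div_cometric_def by (intro real_polynomial_function_sum PF_pd PF_g) auto

text \<open>The divergence of the gradient of I^j under the change of variables \<open>Y\<close>. At
  regular points derivatives in \<open>y\<close> are derivatives in \<open>x\<close> contracted with
  \<open>B\<close>, the inverse of J. The Hessians of the I^i then add up to the logarithmic
  derivative of det J by Jacobi's formula, and the Hessian of I^j to its Laplacian.\<close>

lemma div_cometric_jacobian:
  "det (jac I x) * div_cometric j (Y x) = gdot (\<lambda>x. det (jac I x)) (I j) x + det (jac I x) * lap (I j) x"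
proof (rule PF_eq_regular[of "\<lambda>x. det (jac I x) * div_cometric j (Y x)" "\<lambda>x. gdot (\<lambda>x. det (jac I x)) (I j) x + det (jac I x) * lap (I j) x" x])
  fix x assume nz: "det (jac I x) \<noteq> 0"
  have "invertible (jac I x)" using nz by (simp add: invertible_det_nz)
  then obtain B where B: "B ** jac I x = mat 1" "jac I x ** B = mat 1"
    unfolding invertible_def by blast
  have BJ: "(\<Sum>i\<in>UNIV. B $ k $ i * pd m (I i) x) = (if k = m then 1 else 0)" for k m
    using arg_cong[OF B(1), of "\<lambda>M. M $ k $ m"] by (simp add: matrix_matrix_mult_def jac_def mat_def)
  have JB: "(\<Sum>k\<in>UNIV. pd k (I l) x * B $ k $ i) = (if l = i then 1 else 0)" for l i
    using arg_cong[OF B(2), of "\<lambda>M. M $ l $ i"] by (simp add: matrix_matrix_mult_def jac_def mat_def)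
  have "pd i (g i j) (Y x) = (\<Sum>k\<in>UNIV. B $ k $ i * (\<Sum>l\<in>UNIV. pd l (g i j) (Y x) * pd k (I l) x))" for i
  proof -
    have "(\<Sum>k\<in>UNIV. B $ k $ i * (\<Sum>l\<in>UNIV. pd l (g i j) (Y x) * pd k (I l) x))
        = (\<Sum>l\<in>UNIV. pd l (g i j) (Y x) * (\<Sum>k\<in>UNIV. pd k (I l) x * B $ k $ i))"
      unfolding sum_distrib_left by (subst sum.swap) (simp add: algebra_simps)
    then show ?thesis by (simp add: JB if_distrib cong: if_cong)
  qed
  then have "div_cometric j (Y x) = (\<Sum>i\<in>UNIV. \<Sum>k\<in>UNIV. B $ k $ i *
      (\<Sum>m\<in>UNIV. pd k (pd m (I i)) x * pd m (I j) x + pd m (I i) x * pd k (pd m (I j)) x))"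
    by (simp add: div_cometric_def pd_g_Y)
  also have "\<dots> = (\<Sum>i\<in>UNIV. \<Sum>k\<in>UNIV. \<Sum>m\<in>UNIV. B $ k $ i * (pd k (pd m (I i)) x * pd m (I j) x))
      + (\<Sum>i\<in>UNIV. \<Sum>k\<in>UNIV. \<Sum>m\<in>UNIV. B $ k $ i * (pd m (I i) x * pd k (pd m (I j)) x))"
    by (simp add: sum_distrib_left sum.distrib distrib_left)
  also have "(\<Sum>i\<in>UNIV. \<Sum>k\<in>UNIV. \<Sum>m\<in>UNIV. B $ k $ i * (pd k (pd m (I i)) x * pd m (I j) x))
      = (\<Sum>m\<in>UNIV. (\<Sum>i\<in>UNIV. \<Sum>k\<in>UNIV. pd m (pd k (I i)) x * B $ k $ i) * pd m (I j) x)"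
  proof -
    have "(\<Sum>i\<in>UNIV. \<Sum>k\<in>UNIV. \<Sum>m\<in>UNIV. B $ k $ i * (pd k (pd m (I i)) x * pd m (I j) x))
        = (\<Sum>i\<in>UNIV. \<Sum>m\<in>UNIV. \<Sum>k\<in>UNIV. B $ k $ i * (pd k (pd m (I i)) x * pd m (I j) x))"
      by (rule sum.cong[OF refl], rule sum.swap)
    also have "\<dots> = (\<Sum>m\<in>UNIV. \<Sum>i\<in>UNIV. \<Sum>k\<in>UNIV. B $ k $ i * (pd k (pd m (I i)) x * pd m (I j) x))"
      by (rule sum.swap)
    also have "\<dots> = (\<Sum>m\<in>UNIV. (\<Sum>i\<in>UNIV. \<Sum>k\<in>UNIV. pd m (pd k (I i)) x * B $ k $ i) * pd m (I j) x)"
      unfolding sum_distrib_right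
      by (intro sum.cong refl) (simp add: fun_cong[OF pd_commute[OF PF_I]] mult.commute mult.left_commute)
    finally show ?thesis .
  qed
  also have "(\<Sum>i\<in>UNIV. \<Sum>k\<in>UNIV. \<Sum>m\<in>UNIV. B $ k $ i * (pd m (I i) x * pd k (pd m (I j)) x)) = lap (I j) x"
  proof -
    have "(\<Sum>i\<in>UNIV. \<Sum>k\<in>UNIV. \<Sum>m\<in>UNIV. B $ k $ i * (pd m (I i) x * pd k (pd m (I j)) x))
        = (\<Sum>k\<in>UNIV. \<Sum>i\<in>UNIV. \<Sum>m\<in>UNIV. B $ k $ i * (pd m (I i) x * pd k (pd m (I j)) x))"
      by (rule sum.swap)
    also have "\<dots> = (\<Sum>k\<in>UNIV. \<Sum>m\<in>UNIV. (\<Sum>i\<in>UNIV. B $ k $ i * pd m (I i) x) * pd k (pd m (I j)) x)"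
      unfolding sum_distrib_right mult.assoc by (rule sum.cong[OF refl], rule sum.swap)
    finally show ?thesis by (simp add: BJ lap_def if_distrib[of "\<lambda>z. z * _"] cong: if_cong)
  qed
  finally have d: "div_cometric j (Y x) = (\<Sum>m\<in>UNIV. (\<Sum>i\<in>UNIV. \<Sum>k\<in>UNIV. pd m (pd k (I i)) x * B $ k $ i) * pd m (I j) x) + lap (I j) x" .
  have "pd m (\<lambda>x. det (jac I x)) x = det (jac I x) * (\<Sum>i\<in>UNIV. \<Sum>k\<in>UNIV. pd m (pd k (I i)) x * B $ k $ i)" for m
    using pd_det[of "jac I" B x m] B(1) by (simp add: jac_def PF_pd PF_I)
  then have "gdot (\<lambda>x. det (jac I x)) (I j) x = det (jac I x) * (\<Sum>m\<in>UNIV. (\<Sum>i\<in>UNIV. \<Sum>k\<in>UNIV. pd m (pd k (I i)) x * B $ k $ i) * pd m (I j) x)"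
    unfolding gdot_def sum_distrib_left[of "det (jac I x)" "\<lambda>m. _ m * pd m (I j) x"] by (simp only: mult.assoc)
  then show "det (jac I x) * div_cometric j (Y x) = gdot (\<lambda>x. det (jac I x)) (I j) x + det (jac I x) * lap (I j) x"
    unfolding d by (simp add: distrib_left)
qed (intro real_polynomial_function.intros(3,4) PF_D PF_Y[OF PF_div_cometric] PF_gdot PF_lap PF_I)+

text \<open>The determinant of J need not be a polynomial in I, but its square is. Multiplying by
  twice the determinant turns its derivative into a derivative of \<open>gram_det\<close>.\<close>

lemma lap_I_gram_det: "2 * (div_cometric j (Y x) - lap (I j) x) * gram_det (Y x) = bracket gram_det (\<lambda>y. y $ j) (Y x)"
proof -
  let ?D = "\<lambda>x. det (jac I x)"
  have "bracket gram_det (\<lambda>y. y $ j) (Y x) = gdot (\<lambda>x. gram_det (Y x)) (\<lambda>x. Y x $ j) x"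
    using gdot_Y[OF PF_gram_det PF_nth[of j]] by simp
  also have "\<dots> = gdot (\<lambda>x. ?D x * ?D x) (I j) x"
    by (simp add: gram_det_Y power2_eq_square)
  also have "\<dots> = 2 * ?D x * gdot ?D (I j) x"
    by (simp add: gdot_mult_left PF_D)
  also have "\<dots> = 2 * ?D x * (?D x * div_cometric j (Y x) - ?D x * lap (I j) x)"
    unfolding div_cometric_jacobian by simp
  finally show ?thesis by (simp add: gram_det_Y power2_eq_square algebra_simps)
qed

text \<open>A pole along a prime \<open>q\<close> would make \<open>q\<close> divide its own bracket
  with the coordinate. By the Leibniz rule \<open>q ^ m\<close> would then divide the bracket of
  \<open>gram_det\<close>, which leaves no pole along \<open>q\<close>.\<close>

lemma lap_I: "\<exists>L. PF L \<and> (\<forall>x. lap (I j) x = L (Y x))"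
proof (cases "pdvd gram_det (bracket gram_det (\<lambda>y. y $ j))")
  case True
  then obtain h where h: "PF h" "\<And>y. bracket gram_det (\<lambda>y. y $ j) y = gram_det y * h y" by (auto simp: pdvd_def)
  define L where "L y = div_cometric j y - h y / 2" for y
  have PFL: "PF L" unfolding L_def
    by (intro real_polynomial_function_diff real_polynomial_function_divide PF_div_cometric h)
  have "lap (I j) x = L (Y x)" for x
  proof (rule PF_eq_regular[of "lap (I j)" "\<lambda>x. L (Y x)" x])
    fix x assume "det (jac I x) \<noteq> 0"
    then have "gram_det (Y x) \<noteq> 0" by (simp add: gram_det_Y)
    moreover have "2 * (div_cometric j (Y x) - lap (I j) x) * gram_det (Y x) = h (Y x) * gram_det (Y x)"
      using lap_I_gram_det[of j x] h(2)[of "Y x"] by (simp add: mult.commute)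
    ultimately have "2 * (div_cometric j (Y x) - lap (I j) x) = h (Y x)" by (metis mult_right_cancel)
    then show "lap (I j) x = L (Y x)" by (simp add: L_def)
  qed (auto intro: PF_lap PF_I PF_Y PFL)
  then show ?thesis using PFL by blast
next
  case False
  let ?u = "\<lambda>y::real^'n. y $ j"
  obtain q m s i p where q: "pprime q" "i < m" "PF s" "PF p" "\<not> pdvd q s" "\<not> pdvd q p"
    "\<And>y. gram_det y = q y ^ m * s y" "\<And>y. bracket gram_det ?u y = q y ^ i * p y"
    using not_pdvd_prime[OF PF_gram_det PF_bracket[OF PF_gram_det PF_nth] gram_det_nonzero False] by metis
  have PFq: "PF q" and nq: "\<exists>y. q y \<noteq> 0" using q(1) by (auto simp: pprime_def)
  have nqY: "\<exists>x. q (Y x) \<noteq> 0" using nq indep[OF PFq] by (auto simp: Y_def)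
  have PFqk: "PF (\<lambda>y. q y ^ j)" for j by (intro real_polynomial_function_power PFq)
  obtain k where k: "m = i + Suc k" using q(2) less_iff_Suc_add by auto
  \<comment> \<open>The pole has order \<open>m - i = Suc k\<close>; the factor \<open>q ^ k\<close>
    leaves a simple one, as \<open>prime_pole_dvd_bracket\<close> requires.\<close>
  define f where "f x = 2 * (div_cometric j (Y x) - lap (I j) x) * q (Y x) ^ k" for x
  have PFf: "PF f" unfolding f_def
    by (intro real_polynomial_function.intros(2,4) real_polynomial_function_diff PF_Y[OF PF_div_cometric] PF_lap PF_I PF_Y[OF PFqk])
  have f: "f x * (q (Y x) * s (Y x)) = p (Y x)" for x
  proof -
    obtain a where "q (Y a) ^ i \<noteq> 0" using nqY by auto
    then show ?thesis
    proof (rule PF_cancel[of "\<lambda>x. f x * (q (Y x) * s (Y x))" "\<lambda>x. p (Y x)" "\<lambda>x. q (Y x) ^ i", rotated -1])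
      show "q (Y x) ^ i * (f x * (q (Y x) * s (Y x))) = q (Y x) ^ i * p (Y x)" for x
        using lap_I_gram_det[of j x] unfolding q(7,8) f_def k by (simp add: power_add algebra_simps)
    qed (intro real_polynomial_function.intros(4) PFf PF_Y[OF PFq] PF_Y[OF q(3)] PF_Y[OF q(4)] PF_Y[OF PFqk])+
  qed
  have "pdvd q (bracket q ?u)" by (rule prime_pole_dvd_bracket[OF PFf q(1,3,5,4,6) f])
  then obtain h where h: "PF h" "\<And>y. bracket q ?u y = q y * h y" by (auto simp: pdvd_def)
  have "bracket gram_det ?u y = q y ^ m * (real m * h y * s y + bracket s ?u y)" for y
  proof -
    have "gram_det = (\<lambda>y. q y ^ m * s y)" using q(7) by blast
    moreover have "q y ^ m = q y ^ (m - 1) * q y" using k by simp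
    ultimately show ?thesis
      by (simp add: bracket_mult_left PFqk q(3) bracket_power_left PFq h(2) algebra_simps)
  qed
  then have eq: "q y ^ i * p y = q y ^ i * (q y * (q y ^ k * (real m * h y * s y + bracket s ?u y)))" for y
    unfolding q(8)[symmetric] k by (simp add: power_add mult.assoc)
  obtain a where a: "q a ^ i \<noteq> 0" using nq by auto
  have PFr: "PF (\<lambda>y. q y ^ k * (real m * h y * s y + bracket s ?u y))"
    by (intro real_polynomial_function.intros(2,3,4) PFqk h q PF_bracket PF_nth)
  have "p y = q y * (q y ^ k * (real m * h y * s y + bracket s ?u y))" for y
    by (rule PF_cancel[OF q(4) _ PFqk eq a]) (intro real_polynomial_function.intros(4) PFq PFr)
  then have "pdvd q p" by (rule pdvdI[OF PFr])
  then show ?thesis using q(6) by blast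
qed

text \<open>By the chain rule only brackets occur besides the Laplacians of the generators.\<close>

theorem lap_in_algebra:
  assumes P: "PF P"
  shows "\<exists>L. PF L \<and> (\<forall>x. lap (\<lambda>x. P (Y x)) x = L (Y x))"
proof -
  obtain L where L: "\<And>j. PF (L j)" "\<And>j x. lap (I j) x = L j (Y x)" using lap_I by metis
  define M where "M y = (\<Sum>j\<in>UNIV. bracket (pd j P) (\<lambda>y. y $ j) y + pd j P y * L j y)" for y
  have "PF M" unfolding M_def
    by (intro real_polynomial_function_sum real_polynomial_function.intros(3,4) PF_bracket PF_pd P PF_nth L) auto
  moreover have "lap (\<lambda>x. P (Y x)) x = M (Y x)" for x
  proof -
    have 1: "pd k (\<lambda>x. P (Y x)) = (\<lambda>x. \<Sum>j\<in>UNIV. pd j P (Y x) * pd k (I j) x)" for k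
      using pd_Y[OF P] by blast
    have "lap (\<lambda>x. P (Y x)) x = (\<Sum>k\<in>UNIV. \<Sum>j\<in>UNIV. pd k (\<lambda>x. pd j P (Y x)) x * pd k (I j) x + pd j P (Y x) * pd k (pd k (I j)) x)"
      unfolding lap_def 1 by (simp add: pd_sum pd_mult real_polynomial_function.intros(4) PF_Y PF_pd P PF_I add.commute)
    also have "\<dots> = (\<Sum>j\<in>UNIV. gdot (\<lambda>x. pd j P (Y x)) (\<lambda>x. Y x $ j) x + pd j P (Y x) * lap (I j) x)"
      by (subst sum.swap) (simp add: gdot_def lap_def sum.distrib sum_distrib_left)
    also have "\<dots> = M (Y x)"
      using gdot_Y[OF PF_pd[OF P] PF_nth] by (simp add: M_def L)
    finally show ?thesis .
  qed
  ultimately show ?thesis by blast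
qed

end

section \<open>The Gaussian functional\<close>

text \<open>Deliberately not normalized: multiplying the product density by exp(-r^2) is then
  exactly the step from \<open>s\<close> to \<open>s + 1\<close>.\<close>

definition damped_normal :: "real \<Rightarrow> real \<Rightarrow> real" where
  "damped_normal s x = std_normal_density x * exp (- s * x\<^sup>2)"

definition normal_moment :: "nat \<Rightarrow> real" where
  "normal_moment m = (\<integral>x. std_normal_density x * x ^ m \<partial>lborel)"

lemma normal_moment_odd: "odd m \<Longrightarrow> normal_moment m = 0"
  using integral_std_normal_moment_odd by (auto simp: normal_moment_def elim!: oddE)

text \<open>Integration by parts in one variable, read off from the closed forms of the moments. For
  \<open>m = 0\<close> the factor \<open>real m\<close> neutralizes the truncated index.\<close>

lemma normal_moment_Suc: "normal_moment (Suc m) = real m * normal_moment (m - 1)"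
proof (cases "even m")
  case True
  then show ?thesis by (cases m) (auto simp: normal_moment_odd)
next
  case False
  then obtain k where k: "m = 2 * k + 1" by (auto elim: oddE)
  have e: "normal_moment (2 * k) = fact (2 * k) / (2 ^ k * fact k)" for k
    unfolding normal_moment_def by (rule integral_std_normal_moment_even)
  have "normal_moment (2 * Suc k) = fact (2 * Suc k) / (2 ^ Suc k * fact (Suc k))" by (rule e)
  also have "\<dots> = real (2 * k + 1) * (fact (2 * k) / (2 ^ k * fact k))"
  proof -
    have "fact (2 * Suc k) = real (2 * Suc k) * (real (2 * k + 1) * fact (2 * k))" by simp
    moreover have "2 ^ Suc k * fact (Suc k) = real (2 * Suc k) * (2 ^ k * fact k)" by (simp add: algebra_simps)
    ultimately show ?thesis by (simp only: times_divide_eq_right mult_divide_mult_cancel_left_if) simp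
  qed
  finally show ?thesis using k by (simp add: e)
qed

lemma damped_normal_moment:
  assumes s: "s \<ge> 0"
  shows "integrable lborel (\<lambda>x. damped_normal s x * x ^ m)"
    and "(\<integral>x. damped_normal s x * x ^ m \<partial>lborel) = (1 / sqrt (1 + 2 * s)) ^ Suc m * normal_moment m"
proof -
  \<comment> \<open>Since \<open>x^2 / 2 + s x^2 = (c x)^2 / 2\<close>, the substitution
    \<open>c * x\<close> reduces everything to \<open>s = 0\<close>. The form
    \<open>0 + c * x\<close> below matches the affine substitution rule.\<close>
  define c where "c = sqrt (1 + 2 * s)"
  have c: "c > 0" "c\<^sup>2 = 1 + 2 * s" using s by (auto simp: c_def)
  have damped_normal: "damped_normal s x = std_normal_density (0 + c * x)" for x
    using c(2) by (simp add: damped_normal_def std_normal_density_def power_mult_distrib exp_add[symmetric] algebra_simps)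
  have eq: "(\<lambda>x. damped_normal s x * x ^ m) = (\<lambda>x. (1 / c) ^ m * (std_normal_density (0 + c * x) * (0 + c * x) ^ m))"
    using c(1) unfolding damped_normal by (auto simp: fun_eq_iff power_mult_distrib power_divide)
  show "integrable lborel (\<lambda>x. damped_normal s x * x ^ m)"
    unfolding eq using c(1)
    by (intro integrable_mult_right lborel_integrable_real_affine[OF integrable_std_normal_moment]) simp
  have "normal_moment m = c * (\<integral>x. std_normal_density (0 + c * x) * (0 + c * x) ^ m \<partial>lborel)"
    unfolding normal_moment_def using lborel_integral_real_affine[of c "\<lambda>x. std_normal_density x * x ^ m" 0] c(1) by simp
  then show "(\<integral>x. damped_normal s x * x ^ m \<partial>lborel) = (1 / sqrt (1 + 2 * s)) ^ Suc m * normal_moment m"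
    unfolding eq c_def[symmetric] using c(1)
    by (simp only: integral_mult_right_zero) (simp add: power_divide)
qed

section \<open>Gaussian integrals of polynomials in several variables\<close>

interpretation lborel_pi: product_sigma_finite "\<lambda>_::'n::finite. lborel :: real measure"
  by standard

abbreviation lborel_pi :: "('n::finite \<Rightarrow> real) measure" where
  "lborel_pi \<equiv> Pi\<^sub>M UNIV (\<lambda>_. lborel)"

definition vec_of :: "('n::finite \<Rightarrow> real) \<Rightarrow> real^'n" where
  "vec_of \<omega> = (\<chi> i. \<omega> i)"

definition gauss_density :: "real \<Rightarrow> ('n::finite \<Rightarrow> real) \<Rightarrow> real" where
  "gauss_density s \<omega> = (\<Prod>i\<in>UNIV. damped_normal s (\<omega> i))"

definition gauss_integral :: "real \<Rightarrow> (real^'n \<Rightarrow> real) \<Rightarrow> real" where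
  "gauss_integral s f = (\<integral>\<omega>. gauss_density s \<omega> * f (vec_of \<omega>) \<partial>lborel_pi)"

lemma gauss_integral_monom:
  assumes "s \<ge> 0"
  shows "integrable lborel_pi (\<lambda>\<omega>. gauss_density s \<omega> * monom_fun m (vec_of \<omega>))"
    and "gauss_integral s (monom_fun m) = (\<Prod>i\<in>UNIV. (1 / sqrt (1 + 2 * s)) ^ Suc (Poly_Mapping.lookup m i) * normal_moment (Poly_Mapping.lookup m i))"
proof -
  have eq: "gauss_density s \<omega> * monom_fun m (vec_of \<omega>) = (\<Prod>i\<in>UNIV. damped_normal s (\<omega> i) * \<omega> i ^ Poly_Mapping.lookup m i)" for \<omega>
    by (simp add: gauss_density_def monom_fun_def vec_of_def prod.distrib)
  show "integrable lborel_pi (\<lambda>\<omega>. gauss_density s \<omega> * monom_fun m (vec_of \<omega>))"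
    unfolding eq by (rule lborel_pi.product_integrable_prod) (auto intro: damped_normal_moment assms)
  show "gauss_integral s (monom_fun m) = (\<Prod>i\<in>UNIV. (1 / sqrt (1 + 2 * s)) ^ Suc (Poly_Mapping.lookup m i) * normal_moment (Poly_Mapping.lookup m i))"
    unfolding gauss_integral_def eq
    by (subst lborel_pi.product_integral_prod) (auto intro!: prod.cong simp: damped_normal_moment assms)
qed

lemma gauss_integral_integrable:
  fixes f :: "real^'n \<Rightarrow> real"
  assumes "s \<ge> 0" "PF f"
  shows "integrable lborel_pi (\<lambda>\<omega>. gauss_density s \<omega> * f (vec_of \<omega>))"
proof -
  obtain K c where K: "finite K" "f = (\<lambda>x. \<Sum>m\<in>K. c m * monom_fun m x)"
    using PF_monomials[OF assms(2)] by blast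
  have "(\<lambda>\<omega>. gauss_density s \<omega> * f (vec_of \<omega>)) = (\<lambda>\<omega>. \<Sum>m\<in>K. c m * (gauss_density s \<omega> * monom_fun m (vec_of \<omega>)))"
    by (simp add: K(2) sum_distrib_left algebra_simps)
  then show ?thesis
    by (simp only:) (intro Bochner_Integration.integrable_sum integrable_mult_right gauss_integral_monom(1) assms(1))
qed

lemma gauss_integral_add:
  assumes "s \<ge> 0" "PF f" "PF h"
  shows "gauss_integral s (\<lambda>x. f x + h x) = gauss_integral s f + gauss_integral s h"
  unfolding gauss_integral_def distrib_left
  by (rule Bochner_Integration.integral_add) (intro gauss_integral_integrable assms)+

lemma gauss_integral_cmult: "gauss_integral s (\<lambda>x. c * f x) = c * gauss_integral s f"
  unfolding gauss_integral_def by (simp add: mult.left_commute)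

lemma gauss_integral_diff:
  assumes "s \<ge> 0" "PF f" "PF h"
  shows "gauss_integral s (\<lambda>x. f x - h x) = gauss_integral s f - gauss_integral s h"
  unfolding gauss_integral_def right_diff_distrib
  by (rule Bochner_Integration.integral_diff) (intro gauss_integral_integrable assms)+

lemma gauss_integral_0 [simp]: "gauss_integral s (\<lambda>x. 0) = 0"
  by (simp add: gauss_integral_def)

lemma gauss_integral_sum:
  assumes "s \<ge> 0" "\<And>i. i \<in> S \<Longrightarrow> PF (f i)"
  shows "gauss_integral s (\<lambda>x. \<Sum>i\<in>S. f i x) = (\<Sum>i\<in>S. gauss_integral s (f i))"
  using assms(2)
  by (induction S rule: infinite_finite_induct) (auto simp: gauss_integral_add assms(1) real_polynomial_function_sum)

lemma gauss_density_nonneg: "gauss_density s \<omega> \<ge> 0"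
  unfolding gauss_density_def damped_normal_def by (intro prod_nonneg) auto

lemma gauss_integral_nonneg: "(\<And>x. f x \<ge> 0) \<Longrightarrow> gauss_integral s f \<ge> 0"
  unfolding gauss_integral_def by (intro Bochner_Integration.integral_nonneg mult_nonneg_nonneg gauss_density_nonneg)

text \<open>Checked on monomials, where the integral factorizes and only the moment in the variable
  \<open>i\<close> changes.\<close>

lemma gauss_integral_parts:
  fixes f :: "real^'n \<Rightarrow> real"
  assumes "PF f"
  shows "gauss_integral 0 (\<lambda>x. x $ i * f x) = gauss_integral 0 (pd i f)"
proof -
  obtain K c where K: "finite K" "f = (\<lambda>x. \<Sum>m\<in>K. c m * monom_fun m x)"
    using PF_monomials[OF assms] by blast
  let ?e = "Poly_Mapping.single i (1::nat)"
  have m: "gauss_integral 0 (monom_fun (?e + m)) = real (Poly_Mapping.lookup m i) * gauss_integral 0 (monom_fun (m - ?e))" for m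
  proof -
    let ?l = "Poly_Mapping.lookup m"
    have "gauss_integral 0 (monom_fun (?e + m)) = normal_moment (Suc (?l i)) * (\<Prod>j\<in>UNIV - {i}. normal_moment (?l j))"
      unfolding gauss_integral_monom(2)[OF order_refl]
      by (subst prod.remove[of _ i]) (auto simp: lookup_add lookup_single when_def intro!: prod.cong)
    moreover have "gauss_integral 0 (monom_fun (m - ?e)) = normal_moment (?l i - 1) * (\<Prod>j\<in>UNIV - {i}. normal_moment (?l j))"
      unfolding gauss_integral_monom(2)[OF order_refl]
      by (subst prod.remove[of _ i]) (auto simp: lookup_minus lookup_single when_def intro!: prod.cong)
    ultimately show ?thesis by (simp add: normal_moment_Suc)
  qed
  have PFm: "PF (\<lambda>x. c m * monom_fun m' x)" for m m'
    by (intro real_polynomial_function.intros(2,4) PF_monom_fun)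
  have "gauss_integral 0 (\<lambda>x. x $ i * f x) = gauss_integral 0 (\<lambda>x. \<Sum>m\<in>K. c m * monom_fun (?e + m) x)"
    using monom_fun_single[of i] by (simp add: K(2) monom_fun_add sum_distrib_left algebra_simps)
  also have "\<dots> = (\<Sum>m\<in>K. c m * gauss_integral 0 (monom_fun (?e + m)))"
    by (simp add: gauss_integral_sum PFm gauss_integral_cmult)
  also have "\<dots> = gauss_integral 0 (\<lambda>x. \<Sum>m\<in>K. (c m * real (Poly_Mapping.lookup m i)) * monom_fun (m - ?e) x)"
    by (subst gauss_integral_sum) (auto simp: m[unfolded One_nat_def] gauss_integral_cmult mult.assoc intro!: real_polynomial_function.intros(2,4) PF_monom_fun)
  also have "(\<lambda>x. \<Sum>m\<in>K. (c m * real (Poly_Mapping.lookup m i)) * monom_fun (m - ?e) x) = pd i f"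
    unfolding K(2) by (subst pd_sum) (auto simp: pd_cmult PF_monom_fun pd_monom_fun PFm mult.assoc)
  finally show ?thesis .
qed

text \<open>Integrate x^i times (x^i q) by parts: differentiating the factors x^i contributes the
  number of variables, and Euler's identity contributes \<open>d\<close>. The positivity of the
  resulting factor is what matters later.\<close>

lemma gauss_integral_r2:
  fixes q :: "real^'n \<Rightarrow> real"
  assumes q: "PF q" "hom d q"
  shows "gauss_integral 0 (\<lambda>x. r2 x * q x) = (real CARD('n) + real d) * gauss_integral 0 q"
proof -
  have PFx: "PF (\<lambda>x. x $ i * q x)" for i by (intro real_polynomial_function.intros(4) PF_nth q)
  have "gauss_integral 0 (\<lambda>x. r2 x * q x) = gauss_integral 0 (\<lambda>x. \<Sum>i\<in>UNIV. x $ i * (x $ i * q x))"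
    by (simp add: r2_def sum_distrib_right power2_eq_square mult.assoc)
  also have "\<dots> = (\<Sum>i\<in>UNIV. gauss_integral 0 (\<lambda>x. x $ i * (x $ i * q x)))"
    by (rule gauss_integral_sum) (auto intro!: real_polynomial_function.intros(4) PF_nth q)
  also have "\<dots> = (\<Sum>i\<in>UNIV. gauss_integral 0 (\<lambda>x. x $ i * pd i q x + q x))"
    by (simp add: gauss_integral_parts[OF PFx] pd_mult PF_nth q pd_nth)
  also have "\<dots> = (\<Sum>i\<in>UNIV. gauss_integral 0 (\<lambda>x. x $ i * pd i q x) + gauss_integral 0 q)"
    by (intro sum.cong refl gauss_integral_add) (auto intro!: real_polynomial_function.intros(4) PF_nth q PF_pd)
  also have "\<dots> = gauss_integral 0 (\<lambda>x. \<Sum>i\<in>UNIV. x $ i * pd i q x) + real CARD('n) * gauss_integral 0 q"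
    by (subst gauss_integral_sum) (auto simp: sum.distrib intro!: real_polynomial_function.intros(4) PF_nth q PF_pd)
  also have "(\<lambda>x. \<Sum>i\<in>UNIV. x $ i * pd i q x) = (\<lambda>x. real d * q x)"
    by (simp add: euler[OF q])
  finally show ?thesis by (simp add: gauss_integral_cmult algebra_simps)
qed

text \<open>Against the Gaussian, the integrals of div V and of x . V agree. For V = p \<nabla>a - a
  \<nabla>p Euler's identity turns x . V into (l - k) p a.\<close>

lemma gauss_integral_green:
  fixes p a :: "real^'n \<Rightarrow> real"
  assumes p: "PF p" "hom k p" and a: "PF a" "hom l a"
  shows "(real l - real k) * gauss_integral 0 (\<lambda>x. p x * a x) = gauss_integral 0 (\<lambda>x. p x * lap a x) - gauss_integral 0 (\<lambda>x. lap p x * a x)"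
proof -
  have PF1: "PF (\<lambda>x. p x * pd i a x - a x * pd i p x)" for i
    by (intro real_polynomial_function_diff real_polynomial_function.intros(4) PF_pd p a)
  have "(\<Sum>i\<in>UNIV. x $ i * (p x * pd i a x - a x * pd i p x)) = (real l - real k) * (p x * a x)" for x
  proof -
    have "(\<Sum>i\<in>UNIV. x $ i * (p x * pd i a x - a x * pd i p x))
        = p x * (\<Sum>i\<in>UNIV. x $ i * pd i a x) - a x * (\<Sum>i\<in>UNIV. x $ i * pd i p x)"
      by (simp add: sum_distrib_left sum_subtractf algebra_simps)
    then show ?thesis by (simp add: euler[OF p] euler[OF a] algebra_simps)
  qed
  then have "(real l - real k) * gauss_integral 0 (\<lambda>x. p x * a x) = gauss_integral 0 (\<lambda>x. \<Sum>i\<in>UNIV. x $ i * (p x * pd i a x - a x * pd i p x))"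
    by (simp add: gauss_integral_cmult)
  also have "\<dots> = (\<Sum>i\<in>UNIV. gauss_integral 0 (pd i (\<lambda>x. p x * pd i a x - a x * pd i p x)))"
    by (subst gauss_integral_sum) (auto simp: gauss_integral_parts[OF PF1] intro!: real_polynomial_function.intros(4) PF_nth PF1)
  also have "\<dots> = gauss_integral 0 (\<lambda>x. \<Sum>i\<in>UNIV. pd i (\<lambda>x. p x * pd i a x - a x * pd i p x) x)"
    by (rule gauss_integral_sum[symmetric]) (auto intro: PF_pd PF1)
  also have "(\<lambda>x. \<Sum>i\<in>UNIV. pd i (\<lambda>x. p x * pd i a x - a x * pd i p x) x) = (\<lambda>x. p x * lap a x - lap p x * a x)"
  proof
    fix x
    have "pd i (\<lambda>x. p x * pd i a x - a x * pd i p x) x = p x * pd i (pd i a) x - pd i (pd i p) x * a x" for i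
      by (subst pd_diff) (auto simp: pd_mult PF_pd p a intro!: real_polynomial_function.intros(4))
    then show "(\<Sum>i\<in>UNIV. pd i (\<lambda>x. p x * pd i a x - a x * pd i p x) x) = p x * lap a x - lap p x * a x"
      by (simp add: lap_def sum_distrib_left sum_distrib_right sum_subtractf)
  qed
  also have "gauss_integral 0 (\<lambda>x. p x * lap a x - lap p x * a x) = gauss_integral 0 (\<lambda>x. p x * lap a x) - gauss_integral 0 (\<lambda>x. lap p x * a x)"
    by (rule gauss_integral_diff) (auto intro!: real_polynomial_function.intros(4) PF_lap p a)
  finally show ?thesis .
qed

lemma hom_part:
  fixes f :: "real^'n \<Rightarrow> real"
  assumes "hom d f" "\<And>k. k \<in> K \<Longrightarrow> hom (e k) (F k)" "finite K" "\<And>x. f x = (\<Sum>k\<in>K. F k x)"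
  shows "f x = (\<Sum>k\<in>{k\<in>K. e k = d}. F k x)"
proof -
  have "poly (\<Sum>k\<in>K. monom (F k x) (e k)) t = poly (monom (f x) d) t" for t
    using assms(4)[of "t *\<^sub>R x"]
    by (simp add: poly_sum poly_monom homD[OF assms(1)] homD[OF assms(2)] mult.commute)
  then have "(\<Sum>k\<in>K. monom (F k x) (e k)) = monom (f x) d" using poly_eq_poly_eq_iff by blast
  then have "coeff (\<Sum>k\<in>K. monom (F k x) (e k)) d = f x" by simp
  then show ?thesis using assms(3) by (simp add: coeff_sum sum.If_cases Int_def)
qed

lemma hom_monomials:
  fixes f :: "real^'n \<Rightarrow> real"
  assumes "PF f" "hom d f"
  obtains K c where "finite K" "\<And>m. m \<in> K \<Longrightarrow> wdeg (\<lambda>_. 1) m = d" "f = (\<lambda>x. \<Sum>m\<in>K. c m * monom_fun m x)"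
proof -
  obtain K c where K: "finite K" "f = (\<lambda>x. \<Sum>m\<in>K. c m * monom_fun m x)"
    using PF_monomials[OF assms(1)] by blast
  have "f x = (\<Sum>m\<in>{m\<in>K. wdeg (\<lambda>_. 1) m = d}. c m * monom_fun m x)" for x
    by (rule hom_part[OF assms(2) _ K(1)]) (use homD[OF hom_monom_fun] in \<open>auto simp: hom_def K(2)\<close>)
  then show ?thesis using K(1) by (intro that[of "{m\<in>K. wdeg (\<lambda>_. 1) m = d}" c]) auto
qed

text \<open>A change of width only rescales the integral of a homogeneous function, so orthogonality
  for \<open>s = 0\<close> will carry over to every \<open>s\<close>.\<close>

lemma gauss_integral_scale:
  fixes f :: "real^'n \<Rightarrow> real"
  assumes s: "s \<ge> 0" and f: "PF f" "hom d f"
  shows "gauss_integral s f = (1 / sqrt (1 + 2 * s)) ^ (d + CARD('n)) * gauss_integral 0 f"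
proof -
  obtain K c where K: "finite K" "\<And>m. m \<in> K \<Longrightarrow> wdeg (\<lambda>_. 1) m = d" "f = (\<lambda>x. \<Sum>m\<in>K. c m * monom_fun m x)"
    using hom_monomials[OF f] by blast
  have g: "gauss_integral s f = (\<Sum>m\<in>K. c m * gauss_integral s (monom_fun m))" if "s \<ge> 0" for s
    unfolding K(3) by (subst gauss_integral_sum) (auto simp: gauss_integral_cmult that intro!: real_polynomial_function.intros(2,4) PF_monom_fun)
  have "gauss_integral s (monom_fun m) = (1 / sqrt (1 + 2 * s)) ^ (d + CARD('n)) * gauss_integral 0 (monom_fun m)" if "m \<in> K" for m
  proof -
    have "(\<Sum>i\<in>UNIV. Suc (Poly_Mapping.lookup m i)) = d + CARD('n)"
      using K(2)[OF that] by (simp add: wdeg_def sum_Suc)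
    then have pw: "(\<Prod>i\<in>UNIV. c ^ Suc (Poly_Mapping.lookup m i)) = c ^ (d + CARD('n))" for c :: real
      by (simp only: power_sum[symmetric])
    show ?thesis
      unfolding gauss_integral_monom(2)[OF s] gauss_integral_monom(2)[OF order_refl] prod.distrib pw by simp
  qed
  then show ?thesis unfolding g[OF s] g[OF order_refl] by (simp add: sum_distrib_left mult.left_commute)
qed

lemma gauss_integral_odd:
  fixes f :: "real^'n \<Rightarrow> real"
  assumes f: "PF f" "hom d f" and d: "odd d"
  shows "gauss_integral 0 f = 0"
proof -
  obtain K c where K: "finite K" "\<And>m. m \<in> K \<Longrightarrow> wdeg (\<lambda>_. 1) m = d" "f = (\<lambda>x. \<Sum>m\<in>K. c m * monom_fun m x)"
    using hom_monomials[OF f] by blast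
  have "gauss_integral 0 (monom_fun m) = 0" if "m \<in> K" for m
  proof -
    have "\<exists>i. odd (Poly_Mapping.lookup m i)"
    proof (rule ccontr)
      assume "\<not> ?thesis"
      then have "even (wdeg (\<lambda>_. 1) m)" unfolding wdeg_def by (intro dvd_sum) auto
      then show False using K(2)[OF that] d by simp
    qed
    then obtain i where "normal_moment (Poly_Mapping.lookup m i) = 0" using normal_moment_odd by blast
    then show ?thesis unfolding gauss_integral_monom(2)[OF order_refl] by (intro prod_zero) auto
  qed
  then show ?thesis
    unfolding K(3) by (subst gauss_integral_sum) (auto simp: gauss_integral_cmult intro!: real_polynomial_function.intros(2,4) PF_monom_fun)
qed

text \<open>Semidefiniteness alone makes null vectors orthogonal to everything, so Gram-Schmidt runs
  without knowing that the Gaussian form is definite.\<close>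

lemma gauss_integral_cauchy_schwarz_0:
  fixes f v :: "real^'n \<Rightarrow> real"
  assumes f: "PF f" and v: "PF v" and 0: "gauss_integral 0 (\<lambda>x. v x * v x) = 0"
  shows "gauss_integral 0 (\<lambda>x. f x * v x) = 0"
proof (rule ccontr)
  define A where "A = gauss_integral 0 (\<lambda>x. f x * f x)"
  define B where "B = gauss_integral 0 (\<lambda>x. f x * v x)"
  assume "\<not> ?thesis"
  then have B: "B \<noteq> 0" by (simp add: B_def)
  have PFs: "PF (\<lambda>x. f x * f x)" "PF (\<lambda>x. f x * v x)" "PF (\<lambda>x. v x * v x)"
    by (intro real_polynomial_function.intros(4) f v)+
  have "0 \<le> A + 2 * t * B" for t
  proof -
    have "0 \<le> gauss_integral 0 (\<lambda>x. (f x + t * v x) * (f x + t * v x))" by (rule gauss_integral_nonneg) simp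
    also have "(\<lambda>x. (f x + t * v x) * (f x + t * v x)) = (\<lambda>x. f x * f x + (2 * t * (f x * v x) + t * t * (v x * v x)))"
      by (simp add: algebra_simps)
    also have "gauss_integral 0 \<dots> = A + (2 * t * B + t * t * 0)"
      by (simp add: gauss_integral_add gauss_integral_cmult PFs real_polynomial_function.intros(2,3,4) A_def B_def 0)
    finally show ?thesis by simp
  qed
  \<comment> \<open>This \<open>t\<close> makes the bound \<open>A + 2 * t * B\<close> equal to
    -1.\<close>
  from this[of "- (A + 1) / (2 * B)"] show False using B by (simp add: field_simps)
qed

text \<open>Gram-Schmidt with \<open>v\<close>, the part of \<open>b m\<close> orthogonal to the
  earlier functions, as the new direction. The functions may be linearly dependent, so a null
  \<open>v\<close> is treated separately.\<close>

lemma gauss_integral_projection: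
  fixes f :: "real^'n \<Rightarrow> real"
  assumes "finite K"
  shows "(\<And>m. m \<in> K \<Longrightarrow> PF (b m)) \<Longrightarrow> PF f \<Longrightarrow>
    \<exists>c. \<forall>j\<in>K. gauss_integral 0 (\<lambda>x. (f x - (\<Sum>m\<in>K. c m * b m x)) * b j x) = 0"
  using assms
proof (induction K arbitrary: f rule: finite_induct)
  case (insert m K)
  obtain c where c: "\<forall>j\<in>K. gauss_integral 0 (\<lambda>x. (f x - (\<Sum>m\<in>K. c m * b m x)) * b j x) = 0"
    using insert.IH[of f] insert.prems by auto
  obtain e where e: "\<forall>j\<in>K. gauss_integral 0 (\<lambda>x. (b m x - (\<Sum>m\<in>K. e m * b m x)) * b j x) = 0"
    using insert.IH[of "b m"] insert.prems by auto
  define u where "u x = f x - (\<Sum>m\<in>K. c m * b m x)" for x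
  define v where "v x = b m x - (\<Sum>m\<in>K. e m * b m x)" for x
  have PFb: "PF (b j)" if "j \<in> insert m K" for j using insert.prems that by blast
  have PFu: "PF u" and PFv: "PF v" unfolding u_def v_def using insert.hyps(1)
    by (intro real_polynomial_function_diff real_polynomial_function_sum real_polynomial_function.intros(2,4) insert.prems; simp)+
  define t where "t = gauss_integral 0 (\<lambda>x. u x * v x) / gauss_integral 0 (\<lambda>x. v x * v x)"
  define w where "w x = u x - t * v x" for x
  have PFw: "PF w" unfolding w_def by (intro real_polynomial_function_diff real_polynomial_function.intros(2,4) PFu PFv)
  have wb: "gauss_integral 0 (\<lambda>x. w x * b j x) = 0" if "j \<in> K" for j
  proof -
    have "gauss_integral 0 (\<lambda>x. w x * b j x) = gauss_integral 0 (\<lambda>x. u x * b j x - t * (v x * b j x))"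
      by (simp add: w_def algebra_simps)
    also have "\<dots> = gauss_integral 0 (\<lambda>x. u x * b j x) - t * gauss_integral 0 (\<lambda>x. v x * b j x)"
      using that by (subst gauss_integral_diff) (auto simp: gauss_integral_cmult intro!: real_polynomial_function.intros(2,4) PFu PFv PFb)
    also have "\<dots> = 0" using c e that by (simp add: u_def v_def)
    finally show ?thesis .
  qed
  have wv: "gauss_integral 0 (\<lambda>x. w x * v x) = 0"
  proof (cases "gauss_integral 0 (\<lambda>x. v x * v x) = 0")
    case True
    then show ?thesis by (rule gauss_integral_cauchy_schwarz_0[OF PFw PFv])
  next
    case False
    have "gauss_integral 0 (\<lambda>x. w x * v x) = gauss_integral 0 (\<lambda>x. u x * v x - t * (v x * v x))"
      by (simp add: w_def algebra_simps)
    also have "\<dots> = gauss_integral 0 (\<lambda>x. u x * v x) - t * gauss_integral 0 (\<lambda>x. v x * v x)"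
      by (subst gauss_integral_diff) (auto simp: gauss_integral_cmult intro!: real_polynomial_function.intros(2,4) PFu PFv)
    also have "\<dots> = 0" using False by (simp add: t_def)
    finally show ?thesis .
  qed
  have "gauss_integral 0 (\<lambda>x. w x * b m x) = gauss_integral 0 (\<lambda>x. w x * v x + (\<Sum>j\<in>K. e j * (w x * b j x)))"
    by (simp add: v_def right_diff_distrib sum_distrib_left mult.left_commute)
  also have "\<dots> = gauss_integral 0 (\<lambda>x. w x * v x) + (\<Sum>j\<in>K. e j * gauss_integral 0 (\<lambda>x. w x * b j x))"
    by (subst gauss_integral_add)
       (auto simp: gauss_integral_sum gauss_integral_cmult insert.hyps PFw PFv PFb real_polynomial_function.intros(2,4) intro!: real_polynomial_function_sum)
  also have "\<dots> = 0" using wv wb by simp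
  finally have wm: "gauss_integral 0 (\<lambda>x. w x * b m x) = 0" .
  define c' where "c' j = (if j = m then t else c j - t * e j)" for j
  have weq: "w x = f x - (\<Sum>j\<in>insert m K. c' j * b j x)" for x
  proof -
    have "(\<Sum>j\<in>K. c' j * b j x) = (\<Sum>j\<in>K. c j * b j x) - t * (\<Sum>j\<in>K. e j * b j x)"
      unfolding sum_distrib_left sum_subtractf[symmetric] using insert.hyps
      by (intro sum.cong) (auto simp: c'_def algebra_simps)
    then show ?thesis using insert.hyps by (simp add: w_def u_def v_def c'_def algebra_simps)
  qed
  show ?case using wb wm unfolding weq by (intro exI[of _ c']) blast
qed auto

section \<open>Fibres\<close>

lemma PF_line_constant:
  fixes f :: "'a::euclidean_space \<Rightarrow> real"
  assumes f: "PF f" and c: "\<And>t. t \<noteq> 0 \<Longrightarrow> f (x + t *\<^sub>R v) = c"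
  shows "f (x + t *\<^sub>R v) = c"
proof -
  obtain q where q: "\<forall>t. f (x + t *\<^sub>R v) = poly q t" using PF_line[OF f] by metis
  have "poly ([:0, 1:] * (q - [:c:])) s = 0" for s
    using c[of s] q by (cases "s = 0") auto
  then have "[:0, 1:] * (q - [:c:]) = 0" using poly_all_0_iff_0 by blast
  then have "q - [:c:] = 0" by simp
  then show ?thesis using q by simp
qed

context gradient_algebra
begin

lemma jac_transpose_matrix: "jac_transpose x \<xi> = transpose (jac I x) *v \<xi>"
  by (simp add: jac_transpose_def vec_eq_iff matrix_vector_mult_def transpose_def jac_def mult.commute)

text \<open>The straight lines through \<open>p\<close> and \<open>p'\<close> match under an affine map preserving every \<open>I\<^sup>j\<close>; homogeneity
  removes its translation part.\<close>

lemma fibre_orbit: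
  assumes Y: "Y p = Y p'" and nz: "det (jac I p) \<noteq> 0"
  shows "\<exists>M. linear M \<and> bij M \<and> (\<forall>j x. I j (M x) = I j x) \<and> p' = M p"
proof -
  have nz': "det (jac I p') \<noteq> 0" using nz gram_det_Y[of p] gram_det_Y[of p'] Y by auto
  have "invertible (transpose (jac I p))" using nz by (simp add: invertible_det_nz)
  then obtain B where B: "transpose (jac I p) ** B = mat 1" "B ** transpose (jac I p) = mat 1"
    unfolding invertible_def by blast
  \<comment> \<open>\<open>N\<close> sends the velocity \<open>J(p)^T \<xi>\<close> to
    \<open>J(p')^T \<xi>\<close>; together with \<open>b\<close> it forms the affine map matching
    the lines through \<open>p\<close> with those through \<open>p'\<close>.\<close>
  define N where "N = transpose (jac I p') ** B"
  define b where "b = p' - N *v p"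
  have "det B \<noteq> 0"
  proof
    assume "det B = 0"
    then have "det (transpose (jac I p) ** B) = 0" by (simp add: det_mul)
    then show False using B(1) by simp
  qed
  then have invN: "invertible N" by (simp add: invertible_det_nz N_def det_mul nz')
  have 1: "I j (N *v z + b) = I j z" for j z
  proof -
    define \<xi> where "\<xi> = B *v (z - p)"
    have "jac_transpose p \<xi> = z - p" by (simp add: jac_transpose_matrix \<xi>_def matrix_vector_mul_assoc B)
    moreover have "jac_transpose p' \<xi> = N *v (z - p)" by (simp add: jac_transpose_matrix \<xi>_def matrix_vector_mul_assoc N_def)
    ultimately show ?thesis
      using fibre_lines[OF Y, of j \<xi>] by (simp add: b_def matrix_vector_mult_diff_distrib add_diff_eq add.commute)
  qed
  \<comment> \<open>Conjugation by the dilation by \<open>t\<close> scales the translation part, and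
    homogeneity absorbs the dilation. The value \<open>t = 0\<close>, reached because I^j is
    polynomial along the line, is the linear part alone.\<close>
  have 2: "I j (N *v z + t *\<^sub>R b) = I j z" for j z t
  proof (rule PF_line_constant[OF PF_I])
    fix t :: real assume t: "t \<noteq> 0"
    have "N *v z + t *\<^sub>R b = t *\<^sub>R (N *v ((1 / t) *\<^sub>R z) + b)"
      using t by (simp add: matrix_vector_mult_scaleR algebra_simps)
    then have "I j (N *v z + t *\<^sub>R b) = t ^ d j * I j ((1 / t) *\<^sub>R z)"
      by (simp only: homD[OF hom_I] 1)
    also have "\<dots> = I j z" using t by (simp add: homD[OF hom_I] power_divide)
    finally show "I j (N *v z + t *\<^sub>R b) = I j z" .
  qed
  have 3: "I j (N *v z) = I j z" for j z using 2[of j z 0] by simp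
  have bij: "bij ((*v) N)" using invN by (simp add: invertible_eq_bij)
  \<comment> \<open>As \<open>p\<close> lies in the range of \<open>N\<close>, every I^j is constant
    on the line through \<open>p\<close> in direction \<open>b\<close>. Hence J(p) annihilates
    \<open>b\<close>, and regularity of \<open>p\<close> gives \<open>b = 0\<close>.\<close>
  have 4: "I j (p + t *\<^sub>R b) = I j p" for j t
  proof -
    obtain z where z: "p = N *v z" using bij by (metis bij_pointE)
    show ?thesis unfolding z 2 3 ..
  qed
  have "(jac I p *v b) $ j = 0" for j
  proof -
    have a: "((\<lambda>t. p + t *\<^sub>R b) has_derivative (\<lambda>t. t *\<^sub>R b)) (at 0)"
      by (auto intro!: derivative_eq_intros)
    have "((\<lambda>t. I j (p + t *\<^sub>R b)) has_derivative (\<lambda>t. \<Sum>k\<in>UNIV. (t *\<^sub>R b) $ k * pd k (I j) p)) (at 0)"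
      using has_derivative_compose[OF a, of "I j" "\<lambda>h. \<Sum>k\<in>UNIV. h $ k * pd k (I j) p"] has_derivative_pd[OF PF_I] by simp
    then have "((\<lambda>t::real. I j p) has_derivative (\<lambda>t. \<Sum>k\<in>UNIV. (t *\<^sub>R b) $ k * pd k (I j) p)) (at 0)"
      by (simp only: 4)
    then have "(\<lambda>t::real. \<Sum>k\<in>UNIV. (t *\<^sub>R b) $ k * pd k (I j) p) = (\<lambda>t. 0)"
      using has_derivative_unique has_derivative_const by blast
    then have "(\<Sum>k\<in>UNIV. (1 *\<^sub>R b) $ k * pd k (I j) p) = 0" by meson
    then show ?thesis by (simp add: jac_def matrix_vector_mult_def mult.commute)
  qed
  then have "jac I p *v b = 0" by (simp add: vec_eq_iff)
  then have "b = 0" using nz by (metis invertible_det_nz inj_matrix_vector_mult injD matrix_vector_mult_0_right)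
  then have "p' = N *v p" by (simp add: b_def)
  then show ?thesis using bij 3 by (intro exI[of _ "(*v) N"]) auto
qed

text \<open>Degree 0 would make a row of the Jacobian vanish identically. Positive degrees ensure
  that only finitely many monomials in I have a given degree in x.\<close>

lemma d_pos: "d j > 0"
proof (rule ccontr)
  assume "\<not> ?thesis"
  then have "I j x = I j 0" for x using homD[OF hom_I[of j], of 0 x] by simp
  then have "I j = (\<lambda>x. I j 0)" by blast
  then have "pd k (I j) x = 0" for k x by (metis pd_const)
  then have "det (jac I x) = 0" for x
    by (intro det_zero_row(2)[of j]) (simp add: jac_def row_def vec_eq_iff)
  then show False using D_nonzero by blast
qed

end

section \<open>Orthogonality to the algebra\<close>

lemma hom_mult: "hom k f \<Longrightarrow> hom l h \<Longrightarrow> hom (k + l) (\<lambda>x. f x * h x)"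
  by (simp add: hom_def power_add mult_ac)

lemma hom_power_r2: "hom (2 * i) (\<lambda>x. r2 x ^ i)"
  by (simp add: hom_def r2_def power_mult_distrib sum_distrib_left[symmetric] power_mult)

lemma lap_hom_0:
  assumes "PF f" "hom 0 f"
  shows "lap f = (\<lambda>x. 0)"
proof -
  have "pd k f = (\<lambda>_. 0)" for k using hom_pd(2)[OF assms refl] by auto
  then show ?thesis by (intro ext) (simp add: lap_def)
qed

lemma hom_lap:
  assumes "PF f" "hom k f"
  shows "hom (k - 2) (lap f)"
proof -
  have "hom (k - 2) (pd i (pd i f))" for i
    using hom_pd(1)[OF PF_pd[OF assms(1)] hom_pd(1)[OF assms]] by (simp add: numeral_2_eq_2)
  then show ?thesis by (simp add: hom_def lap_def sum_distrib_left)
qed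

lemma lap_iter:
  assumes "PF f" "hom k f"
  shows "PF ((lap ^^ s) f)" "hom (k - 2 * s) ((lap ^^ s) f)"
proof (induction s)
  case (Suc s)
  { case 1 then show ?case using Suc by (simp add: PF_lap) }
  { case 2 then show ?case using hom_lap[OF Suc] by (simp add: diff_diff_left add.commute) }
qed (use assms in simp_all)

lemma lap_iter_zero:
  assumes "PF f" "hom k f"
  shows "(lap ^^ Suc k) f = (\<lambda>x. 0)"
  using lap_hom_0[OF lap_iter(1)[OF assms, of k]] lap_iter(2)[OF assms, of k] by simp

lemma gauss_integral_r2_power:
  fixes q :: "real^'n \<Rightarrow> real"
  assumes q: "PF q" "hom d q"
  shows "\<exists>C>0. gauss_integral 0 (\<lambda>x. r2 x ^ i * q x) = C * gauss_integral 0 q"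
proof (induction i)
  case 0
  then show ?case by (intro exI[of _ 1]) simp
next
  case (Suc i)
  then obtain C where C: "C > 0" "gauss_integral 0 (\<lambda>x. r2 x ^ i * q x) = C * gauss_integral 0 q" by blast
  have P: "PF (\<lambda>x. r2 x ^ i * q x)"
    by (intro real_polynomial_function.intros(4) real_polynomial_function_power PF_r2 q)
  have "gauss_integral 0 (\<lambda>x. r2 x ^ Suc i * q x) = (real CARD('n) + real (2 * i + d)) * (C * gauss_integral 0 q)"
    using gauss_integral_r2[OF P hom_mult[OF hom_power_r2 q(2)]] C(2) by (simp add: mult.assoc)
  moreover have "(real CARD('n) + real (2 * i + d)) * C > 0" using C(1) by (simp add: add_pos_nonneg)
  ultimately show ?case by (intro exI[of _ "(real CARD('n) + real (2 * i + d)) * C"]) simp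
qed

context gradient_algebra
begin

lemma hom_monom_Y: "hom (wdeg d m) (\<lambda>x. monom_fun m (Y x))"
  unfolding hom_def
proof (intro allI)
  fix t x
  have "Y (t *\<^sub>R x) = (\<chi> i. t ^ d i * Y x $ i)" by (simp add: vec_eq_iff homD[OF hom_I])
  then show "monom_fun m (Y (t *\<^sub>R x)) = t ^ wdeg d m * monom_fun m (Y x)"
    by (simp only: monom_fun_weighted)
qed

lemma hom_Y_monomials:
  assumes "PF P" "hom l (\<lambda>x. P (Y x))"
  obtains K c where "finite K" "\<And>m. m \<in> K \<Longrightarrow> wdeg d m = l" "\<And>x. P (Y x) = (\<Sum>m\<in>K. c m * monom_fun m (Y x))"
proof -
  obtain K c where K: "finite K" "P = (\<lambda>x. \<Sum>m\<in>K. c m * monom_fun m x)"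
    using PF_monomials[OF assms(1)] by blast
  have "P (Y x) = (\<Sum>m\<in>{m\<in>K. wdeg d m = l}. c m * monom_fun m (Y x))" for x
    by (rule hom_part[OF assms(2) _ K(1)]) (use homD[OF hom_monom_Y] in \<open>auto simp: hom_def K(2)\<close>)
  then show ?thesis using K(1) by (intro that[of "{m\<in>K. wdeg d m = l}" c]) auto
qed

lemma lap_iter_in_algebra:
  assumes "PF P"
  shows "\<exists>L. PF L \<and> (lap ^^ i) (\<lambda>x. P (Y x)) = (\<lambda>x. L (Y x))"
proof (induction i)
  case 0
  then show ?case using assms by auto
next
  case (Suc i)
  then obtain L where L: "PF L" "(lap ^^ i) (\<lambda>x. P (Y x)) = (\<lambda>x. L (Y x))" by blast
  obtain L' where "PF L'" "\<forall>x. lap (\<lambda>x. L (Y x)) x = L' (Y x)" using lap_in_algebra[OF L(1)] by blast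
  then show ?case using L(2) by (intro exI[of _ L']) auto
qed

text \<open>In degree \<open>l > k\<close>, Green's formula relates the pairings of \<open>\<Delta>\<^sup>s p\<close> with \<open>\<Delta>\<^sup>i b\<close>; those with \<open>i > 0\<close>
  vanish by induction, and the recursion in \<open>s\<close> ends since \<open>\<Delta>\<^sup>s p = 0\<close> for large \<open>s\<close>.\<close>

lemma orthogonal_homogeneous:
  assumes p: "PF p" "hom k p"
    and orth: "\<And>m. wdeg d m = k \<Longrightarrow> gauss_integral 0 (\<lambda>x. p x * monom_fun m (Y x)) = 0"
  shows "PF P \<Longrightarrow> hom l (\<lambda>x. P (Y x)) \<Longrightarrow> gauss_integral 0 (\<lambda>x. p x * P (Y x)) = 0"
proof (induction l arbitrary: P rule: less_induct)
  case (less l)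
  note b = PF_Y[OF less.prems(1)] less.prems(2)
  have PFpb: "PF (\<lambda>x. p x * P (Y x))" by (intro real_polynomial_function.intros(4) p b)
  have top: "gauss_integral 0 (\<lambda>x. p x * Q (Y x)) = 0" if Q: "PF Q" "hom k (\<lambda>x. Q (Y x))" for Q
  proof -
    obtain K c where K: "finite K" "\<And>m. m \<in> K \<Longrightarrow> wdeg d m = k" "\<And>x. Q (Y x) = (\<Sum>m\<in>K. c m * monom_fun m (Y x))"
      using hom_Y_monomials[OF Q] by blast
    have "gauss_integral 0 (\<lambda>x. p x * Q (Y x)) = gauss_integral 0 (\<lambda>x. \<Sum>m\<in>K. c m * (p x * monom_fun m (Y x)))"
      by (simp add: K(3) sum_distrib_left mult.left_commute)
    also have "\<dots> = (\<Sum>m\<in>K. c m * gauss_integral 0 (\<lambda>x. p x * monom_fun m (Y x)))"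
      by (subst gauss_integral_sum) (auto simp: gauss_integral_cmult intro!: real_polynomial_function.intros(2,4) p PF_Y[OF PF_monom_fun])
    also have "\<dots> = 0" using K(2) orth by simp
    finally show ?thesis .
  qed
  consider "odd (k + l)" | "even (k + l)" "l \<le> k" | "k < l" by linarith
  then show ?case
  proof cases
    case 1
    then show ?thesis using gauss_integral_odd[OF PFpb hom_mult[OF p(2) b(2)]] by blast
  next
    case 2
    \<comment> \<open>Multiplication by \<open>r2 ^ i\<close> lifts degree \<open>l\<close> to
      \<open>k\<close> within the algebra and changes the pairing by a positive factor only.\<close>
    then obtain i where i: "k = 2 * i + l" by (metis add.commute dvd_def even_diff_nat le_add_diff_inverse linorder_not_le even_add)
    obtain R where R: "PF R" "\<And>x. r2 x = R (Y x)" using r2_in_algebra by blast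
    obtain C where C: "C > 0" "gauss_integral 0 (\<lambda>x. r2 x ^ i * (p x * P (Y x))) = C * gauss_integral 0 (\<lambda>x. p x * P (Y x))"
      using gauss_integral_r2_power[OF PFpb hom_mult[OF p(2) b(2)]] by blast
    have "gauss_integral 0 (\<lambda>x. p x * ((R (Y x)) ^ i * P (Y x))) = 0"
    proof (rule top)
      show "PF (\<lambda>y. R y ^ i * P y)"
        by (intro real_polynomial_function.intros(4) real_polynomial_function_power R less.prems)
      show "hom k (\<lambda>x. R (Y x) ^ i * P (Y x))"
        using hom_mult[OF hom_power_r2[of i] b(2)] unfolding R(2) i .
    qed
    moreover have "(\<lambda>x. p x * ((R (Y x)) ^ i * P (Y x))) = (\<lambda>x. r2 x ^ i * (p x * P (Y x)))"
      by (simp add: R(2) mult.left_commute)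
    ultimately show ?thesis using C by simp
  next
    case 3
    define b where "b = (\<lambda>x. P (Y x))"
    note b = b[folded b_def]
    define X where "X s i = gauss_integral 0 (\<lambda>x. (lap ^^ s) p x * (lap ^^ i) b x)" for s i
    have green: "(real (l - 2 * i) - real (k - 2 * s)) * X s i = X s (Suc i) - X (Suc s) i" for s i
      using gauss_integral_green[OF lap_iter[OF p, of s] lap_iter[OF b, of i]] by (simp add: X_def)
    have "X s (Suc i) = 0" for s i
    proof (induction s arbitrary: i)
      case 0
      obtain L where L: "PF L" "(lap ^^ Suc i) b = (\<lambda>x. L (Y x))"
        using lap_iter_in_algebra[OF less.prems(1)] unfolding b_def by blast
      have "hom (l - 2 * Suc i) (\<lambda>x. L (Y x))" using lap_iter(2)[OF b, of "Suc i"] L(2) by simp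
      then show ?case using less.IH[of "l - 2 * Suc i", OF _ L(1)] 3 L(2) by (simp add: X_def)
    next
      case (Suc s)
      then show ?case using green[of "Suc i" s] by simp
    qed
    \<comment> \<open>The factor in Green's formula is nonzero here: \<open>l\<close> exceeds
      \<open>k\<close>, hence also \<open>k - 2 * s\<close>.\<close>
    then have step: "X s 0 = 0" if "X (Suc s) 0 = 0" for s
      using green[of 0 s] that 3 by auto
    have "X (Suc k - s) 0 = 0" for s
    proof (induction s)
      case 0
      have "X (Suc k) 0 = gauss_integral 0 (\<lambda>x. (\<lambda>x. 0) x * b x)" unfolding X_def lap_iter_zero[OF p] by simp
      then show ?case by simp
    next
      case (Suc s)
      then show ?case using step[of "Suc k - Suc s"] by (cases "s < Suc k") (auto simp: Suc_diff_le)
    qed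
    from this[of "Suc k"] show ?thesis by (simp add: X_def b_def)
  qed
qed

lemma orthogonal_algebra:
  assumes p: "PF p" "hom k p"
    and orth: "\<And>m. wdeg d m = k \<Longrightarrow> gauss_integral 0 (\<lambda>x. p x * monom_fun m (Y x)) = 0"
    and P: "PF P" and s: "s \<ge> 0"
  shows "gauss_integral s (\<lambda>x. p x * P (Y x)) = 0"
proof -
  obtain K c where K: "finite K" "P = (\<lambda>x. \<Sum>m\<in>K. c m * monom_fun m x)"
    using PF_monomials[OF P] by blast
  have PFm: "PF (\<lambda>x. p x * monom_fun m (Y x))" for m
    by (intro real_polynomial_function.intros(4) p PF_Y[OF PF_monom_fun])
  have "gauss_integral s (\<lambda>x. p x * monom_fun m (Y x)) = 0" for m
    using gauss_integral_scale[OF s PFm hom_mult[OF p(2) hom_monom_Y[of m]]]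
      orthogonal_homogeneous[OF p orth PF_monom_fun hom_monom_Y[of m]] by simp
  moreover have "gauss_integral s (\<lambda>x. p x * P (Y x)) = (\<Sum>m\<in>K. c m * gauss_integral s (\<lambda>x. p x * monom_fun m (Y x)))"
    unfolding K(2) sum_distrib_left mult.left_commute[of "p _" "c _"]
    by (subst gauss_integral_sum[OF s]) (auto simp: gauss_integral_cmult intro!: real_polynomial_function.intros(2,4) PFm)
  ultimately show ?thesis by simp
qed

lemma finite_wdeg: "finite {m. wdeg d m = k}"
proof -
  have "{m. wdeg d m = k} \<subseteq> {m. \<forall>i. Poly_Mapping.lookup m i \<le> k}"
  proof safe
    fix m i assume "k = wdeg d m"
    moreover have "d i * Poly_Mapping.lookup m i \<le> wdeg d m" unfolding wdeg_def by (rule member_le_sum) auto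
    moreover have "Poly_Mapping.lookup m i \<le> d i * Poly_Mapping.lookup m i" using d_pos[of i] by simp
    ultimately show "Poly_Mapping.lookup m i \<le> wdeg d m" by linarith
  qed
  moreover have "finite {m :: 'n \<Rightarrow>\<^sub>0 nat. \<forall>i. Poly_Mapping.lookup m i \<le> k}"
  proof (rule finite_imageD)
    have "Poly_Mapping.lookup ` {m :: 'n \<Rightarrow>\<^sub>0 nat. \<forall>i. Poly_Mapping.lookup m i \<le> k} \<subseteq> (UNIV :: 'n set) \<rightarrow>\<^sub>E {..k}" by auto
    then show "finite (Poly_Mapping.lookup ` {m :: 'n \<Rightarrow>\<^sub>0 nat. \<forall>i. Poly_Mapping.lookup m i \<le> k})"
      by (rule finite_subset) (intro finite_PiE; simp)
  qed (simp add: inj_on_def poly_mapping_eqI)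
  ultimately show ?thesis by (rule finite_subset)
qed

end

section \<open>Density\<close>

lemma r2_norm: "r2 x = (norm x)\<^sup>2"
  unfolding r2_def power2_norm_eq_inner inner_vec_def by (simp add: power2_eq_square)

lemma PF_growth:
  fixes f :: "real^'n \<Rightarrow> real"
  assumes "PF f"
  shows "\<exists>C N. C \<ge> 0 \<and> (\<forall>x. \<bar>f x\<bar> \<le> C * (1 + r2 x) ^ N)"
  using assms
proof (induction f)
  case (linear f)
  then obtain K where K: "\<And>x. norm (f x) \<le> norm x * K" "K > 0" using bounded_linear.pos_bounded by blast
  have "\<bar>f x\<bar> \<le> K * (1 + r2 x) ^ 1" for x
  proof -
    have "norm x \<le> 1 + r2 x"
    proof (cases "norm x \<le> 1")
      case True
      then show ?thesis by (simp add: r2_norm add_increasing2)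
    next
      case False
      then show ?thesis unfolding r2_norm using self_le_power[of "norm x" 2] by simp
    qed
    then have "norm x * K \<le> (1 + r2 x) * K" using K(2) by simp
    then show ?thesis using K(1)[of x] by (simp add: mult.commute)
  qed
  then show ?case using K(2) by (intro exI[of _ K] exI[of _ 1]) auto
next
  case (const c)
  then show ?case by (intro exI[of _ "\<bar>c\<bar>"] exI[of _ 0]) auto
next
  case (add f g)
  then obtain C N C' N' where C: "C \<ge> 0" "\<And>x. \<bar>f x\<bar> \<le> C * (1 + r2 x) ^ N"
    and C': "C' \<ge> 0" "\<And>x. \<bar>g x\<bar> \<le> C' * (1 + r2 x) ^ N'" by blast
  have "\<bar>f x + g x\<bar> \<le> (C + C') * (1 + r2 x) ^ (N + N')" for x
  proof -
    have 1: "1 \<le> 1 + r2 x" by (simp add: r2_norm)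
    have "C * (1 + r2 x) ^ N \<le> C * (1 + r2 x) ^ (N + N')"
      by (rule mult_left_mono[OF power_increasing[OF _ 1] C(1)]) simp
    moreover have "C' * (1 + r2 x) ^ N' \<le> C' * (1 + r2 x) ^ (N + N')"
      by (rule mult_left_mono[OF power_increasing[OF _ 1] C'(1)]) simp
    ultimately show ?thesis using C(2)[of x] C'(2)[of x] by (simp add: distrib_right)
  qed
  then show ?case using C(1) C'(1) by (intro exI[of _ "C + C'"] exI[of _ "N + N'"]) auto
next
  case (mult f g)
  then obtain C N C' N' where C: "C \<ge> 0" "\<And>x. \<bar>f x\<bar> \<le> C * (1 + r2 x) ^ N"
    and C': "C' \<ge> 0" "\<And>x. \<bar>g x\<bar> \<le> C' * (1 + r2 x) ^ N'" by blast
  have "\<bar>f x * g x\<bar> \<le> (C * C') * (1 + r2 x) ^ (N + N')" for x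
  proof -
    have "\<bar>f x\<bar> * \<bar>g x\<bar> \<le> (C * (1 + r2 x) ^ N) * (C' * (1 + r2 x) ^ N')"
      by (intro mult_mono C C' mult_nonneg_nonneg) (auto simp: r2_norm)
    then show ?thesis by (simp add: abs_mult power_add mult_ac)
  qed
  then show ?case using C(1) C'(1) by (intro exI[of _ "C * C'"] exI[of _ "N + N'"]) auto
qed

lemma PF_exp_bounded:
  fixes f :: "real^'n \<Rightarrow> real"
  assumes "PF f"
  shows "\<exists>B. \<forall>x. \<bar>exp (- r2 x) * f x\<bar> \<le> B"
proof -
  obtain C N where C: "C \<ge> 0" "\<And>x. \<bar>f x\<bar> \<le> C * (1 + r2 x) ^ N" using PF_growth[OF assms] by blast
  \<comment> \<open>\<open>Suc N\<close> rather than \<open>N\<close> keeps the divisor in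
    \<open>1 + r / ?M\<close> positive, so that the power is bounded by the exponential.\<close>
  let ?M = "Suc N"
  have "\<bar>exp (- r2 x) * f x\<bar> \<le> C * real ?M ^ ?M" for x
  proof -
    define r where "r = r2 x"
    have r: "r \<ge> 0" by (simp add: r_def r2_norm)
    have "(1 + r) ^ N \<le> (1 + r) ^ ?M" using r by (intro power_increasing) auto
    also have "\<dots> \<le> (real ?M * (1 + r / real ?M)) ^ ?M"
      using r by (intro power_mono) (auto simp: field_simps)
    also have "\<dots> = real ?M ^ ?M * (1 + r / real ?M) ^ ?M" by (rule power_mult_distrib)
    also have "\<dots> \<le> real ?M ^ ?M * exp r"
      using r by (intro mult_left_mono exp_ge_one_plus_x_over_n_power_n) auto
    finally have "C * (1 + r) ^ N \<le> C * (real ?M ^ ?M * exp r)" by (rule mult_left_mono[OF _ C(1)])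
    then have "\<bar>f x\<bar> \<le> C * (real ?M ^ ?M * exp r)" using C(2)[of x] by (simp add: r_def)
    then have "exp (- r) * \<bar>f x\<bar> \<le> exp (- r) * (C * (real ?M ^ ?M * exp r))" by (rule mult_left_mono) simp
    also have "\<dots> = C * real ?M ^ ?M * (exp (- r) * exp r)" by (simp only: mult_ac)
    also have "\<dots> = C * real ?M ^ ?M" by (simp add: exp_minus_inverse mult.commute[of "exp (- r)"])
    finally show ?thesis by (simp add: abs_mult r_def)
  qed
  then show ?thesis by blast
qed

lemma vec_of_measurable [measurable]: "(vec_of :: ('n::finite \<Rightarrow> real) \<Rightarrow> real^'n) \<in> borel_measurable lborel_pi"
  unfolding borel_measurable_euclidean_space[of vec_of]
proof
  fix b :: "real^'n" assume "b \<in> Basis"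
  then obtain i where "b = axis i 1" by (auto simp: Basis_vec_def)
  then have "(\<lambda>\<omega>. vec_of \<omega> \<bullet> b) = (\<lambda>\<omega>. \<omega> i)" by (simp add: vec_of_def inner_axis)
  moreover have "(\<lambda>\<omega>. \<omega> i) \<in> borel_measurable lborel_pi" by measurable
  ultimately show "(\<lambda>\<omega>. vec_of \<omega> \<bullet> b) \<in> borel_measurable lborel_pi" by simp
qed

lemma gauss_density_shift: "gauss_density s \<omega> * exp (- r2 (vec_of \<omega>)) = gauss_density (s + 1) \<omega>"
proof -
  have "exp (- r2 (vec_of \<omega>)) = (\<Prod>i\<in>UNIV. exp (- (\<omega> i)\<^sup>2))"
    by (simp add: r2_def vec_of_def sum_negf[symmetric] exp_sum)
  then show ?thesis
    by (simp add: gauss_density_def damped_normal_def prod.distrib[symmetric] mult_exp_exp left_diff_distrib mult.assoc)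
qed

lemma gauss_density_pos: "gauss_density 0 \<omega> > 0"
  by (simp add: gauss_density_def damped_normal_def prod_pos normal_density_pos)

lemma lborel_pi_null_open:
  fixes h :: "real^'n \<Rightarrow> real"
  assumes h: "continuous_on UNIV h" and AE: "AE \<omega> in lborel_pi. h (vec_of \<omega>) = 0"
  shows "h x = 0"
proof (rule ccontr)
  assume "h x \<noteq> 0"
  then obtain e where e: "e > 0" "\<And>y. dist y x < e \<Longrightarrow> h y \<noteq> 0"
    using continuous_on_open_avoid[OF h open_UNIV, of x 0] by (auto simp: dist_commute)
  \<comment> \<open>With this half-width the l1 norm of the deviation inside the box is at most
    \<open>e / 2\<close>; the box is where \<open>h\<close> cannot vanish, and it has positive
    measure.\<close>
  define a where "a = e / (2 * real CARD('n))"
  have a: "a > 0" using e(1) by (simp add: a_def)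
  let ?U = "Pi\<^sub>E UNIV (\<lambda>i. {x $ i - a <..< x $ i + a})"
  have "h (vec_of \<omega>) \<noteq> 0" if "\<omega> \<in> ?U" for \<omega>
  proof (rule e(2))
    have "norm (vec_of \<omega> - x) \<le> (\<Sum>i\<in>UNIV. \<bar>(vec_of \<omega> - x) $ i\<bar>)" by (rule norm_le_l1_cart)
    also have "\<dots> \<le> (\<Sum>i\<in>(UNIV::'n set). a)"
    proof (rule sum_mono)
      fix i
      have "\<omega> i \<in> {x $ i - a <..< x $ i + a}" using that by blast
      then show "\<bar>(vec_of \<omega> - x) $ i\<bar> \<le> a" by (auto simp: vec_of_def)
    qed
    also have "\<dots> < e" using e(1) by (simp add: a_def)
    finally show "dist (vec_of \<omega>) x < e" by (simp add: dist_norm)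
  qed
  moreover have "AE \<omega> in lborel_pi. \<not> h (vec_of \<omega>) \<noteq> 0" using AE by simp
  ultimately have "AE \<omega> in lborel_pi. \<omega> \<notin> ?U" by (auto elim: eventually_mono)
  moreover have U: "?U \<in> sets lborel_pi" by (rule sets_PiM_I_finite) auto
  ultimately have "emeasure lborel_pi ?U = 0" using AE_iff_measurable[OF U, of "\<lambda>\<omega>. \<omega> \<notin> ?U"] U
    by (simp add: space_PiM)
  moreover have "emeasure lborel_pi ?U = (\<Prod>i\<in>UNIV. emeasure lborel {x $ i - a <..< x $ i + a})"
    by (rule lborel_pi.emeasure_PiM) auto
  ultimately show False using a by (simp add: prod_ennreal)
qed

context gradient_algebra
begin

text \<open>\<open>Y\<close> is unbounded, while Stone-Weierstrass asks for a compact set. After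
  damping the range is bounded; the first component still recovers r^2, and dividing by it recovers
  \<open>Y\<close>.\<close>

definition Z :: "real^'n \<Rightarrow> real \<times> (real^'n)" where
  "Z x = (exp (- r2 x), exp (- r2 x) *\<^sub>R Y x)"

lemma continuous_Y: "continuous_on S Y"
  using polynomial_Y by (rule continuous_on_polymonial_function)

lemma continuous_Z: "continuous_on S Z"
  unfolding Z_def
  by (intro continuous_intros continuous_Y PF_continuous PF_r2)

lemma bounded_Z: "bounded (range Z)"
proof -
  obtain B where B: "\<forall>x::real^'n. \<bar>exp (- r2 x) * 1\<bar> \<le> B"
    using PF_exp_bounded[where 'n = 'n, OF real_polynomial_function.intros(2)[of 1]] by blast
  have "\<forall>j. \<exists>C. \<forall>x. \<bar>exp (- r2 x) * I j x\<bar> \<le> C" using PF_exp_bounded[OF PF_I] by blast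
  then obtain C where C: "\<forall>j x. \<bar>exp (- r2 x) * I j x\<bar> \<le> C j" by (auto dest: choice)
  have "norm (Z x) \<le> B + (\<Sum>j\<in>UNIV. C j)" for x
  proof -
    have "norm (Z x) \<le> norm (exp (- r2 x)) + norm (exp (- r2 x) *\<^sub>R Y x)" unfolding Z_def by (rule norm_Pair_le)
    also have "norm (exp (- r2 x) *\<^sub>R Y x) \<le> (\<Sum>j\<in>UNIV. \<bar>(exp (- r2 x) *\<^sub>R Y x) $ j\<bar>)" by (rule norm_le_l1_cart)
    also have "\<dots> \<le> (\<Sum>j\<in>UNIV. C j)" by (rule sum_mono) (use C in simp)
    finally show ?thesis using B[rule_format, of x] by simp
  qed
  then show ?thesis unfolding bounded_iff by blast
qed

lemma integral_Z_polynomial: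
  assumes p: "PF p" and orth: "\<And>P s. PF P \<Longrightarrow> s \<ge> 0 \<Longrightarrow> gauss_integral s (\<lambda>x. p x * P (Y x)) = 0"
    and Q: "PF Q"
  shows "has_bochner_integral lborel_pi (\<lambda>\<omega>. gauss_density 0 \<omega> * (p (vec_of \<omega>) * Q (Z (vec_of \<omega>)))) 0"
proof -
  \<comment> \<open>Strengthened for the induction: a further factor \<open>P (Y x)\<close> and
    every \<open>s\<close> are allowed, so that the factors of \<open>Q\<close> can be absorbed one
    after another.\<close>
  define W where "W u \<longleftrightarrow> (\<forall>P s. PF P \<longrightarrow> s \<ge> 0 \<longrightarrow>
    has_bochner_integral lborel_pi (\<lambda>\<omega>. gauss_density s \<omega> * (p (vec_of \<omega>) * P (Y (vec_of \<omega>)) * u (vec_of \<omega>))) 0)" for u :: "real^'n \<Rightarrow> real"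
  have one: "W (\<lambda>x. 1)"
    unfolding W_def using orth gauss_integral_integrable[OF _ real_polynomial_function.intros(4)[OF p PF_Y]]
    by (auto simp: has_bochner_integral_iff gauss_integral_def)
  have M: "W u \<Longrightarrow> W (\<lambda>x. u x * Q (Z x))" for u
    using Q
  proof (induction Q arbitrary: u)
    case (linear f)
    \<comment> \<open>Linearity extracts the factor exp(-r^2), which raises \<open>s\<close> by one;
      what remains is a polynomial in \<open>Y\<close>.\<close>
    have f: "f (Z x) = exp (- r2 x) * f (1, Y x)" for x
    proof -
      have "Z x = exp (- r2 x) *\<^sub>R (1, Y x)" by (simp add: Z_def)
      then show ?thesis by (simp only: linear_cmul[OF bounded_linear.linear[OF linear.hyps]]) simp
    qed
    have "PF (\<lambda>y. f (1, y))"
    proof -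
      have "polynomial_function (\<lambda>y::real^'n. (1::real, y))"
        by (intro polynomial_function_Pair) (auto simp: polynomial_function_id)
      then show ?thesis by (rule PF_compose) (rule real_polynomial_function.intros(1)[OF linear.hyps])
    qed
    then have Pf: "PF (\<lambda>y. P y * f (1, y))" if "PF P" for P using that by (intro real_polynomial_function.intros(4))
    show ?case unfolding W_def
    proof (intro allI impI)
      fix P :: "real^'n \<Rightarrow> real" and s :: real assume P: "PF P" and s: "0 \<le> s"
      have eq: "gauss_density s \<omega> * (p (vec_of \<omega>) * P (Y (vec_of \<omega>)) * (u (vec_of \<omega>) * f (Z (vec_of \<omega>))))
        = gauss_density (s + 1) \<omega> * (p (vec_of \<omega>) * (P (Y (vec_of \<omega>)) * f (1, Y (vec_of \<omega>))) * u (vec_of \<omega>))" for \<omega>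
        by (simp add: f gauss_density_shift[symmetric] mult_ac)
      show "has_bochner_integral lborel_pi (\<lambda>\<omega>. gauss_density s \<omega> * (p (vec_of \<omega>) * P (Y (vec_of \<omega>)) * (u (vec_of \<omega>) * f (Z (vec_of \<omega>))))) 0"
        unfolding eq using linear.prems[unfolded W_def, rule_format, OF Pf[OF P], of "s + 1"] s by simp
    qed
  next
    case (const c)
    show ?case unfolding W_def
    proof (intro allI impI)
      fix P :: "real^'n \<Rightarrow> real" and s :: real assume P: "PF P" and s: "0 \<le> s"
      from has_bochner_integral_mult_right[OF const.prems[unfolded W_def, rule_format, OF P s], of c]
      show "has_bochner_integral lborel_pi (\<lambda>\<omega>. gauss_density s \<omega> * (p (vec_of \<omega>) * P (Y (vec_of \<omega>)) * (u (vec_of \<omega>) * c))) 0"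
        by (simp add: mult_ac)
    qed
  next
    case (add f g)
    show ?case unfolding W_def
    proof (intro allI impI)
      fix P :: "real^'n \<Rightarrow> real" and s :: real assume P: "PF P" and s: "0 \<le> s"
      from has_bochner_integral_add[OF add.IH(1)[OF add.prems, unfolded W_def, rule_format, OF P s]
          add.IH(2)[OF add.prems, unfolded W_def, rule_format, OF P s]]
      show "has_bochner_integral lborel_pi (\<lambda>\<omega>. gauss_density s \<omega> * (p (vec_of \<omega>) * P (Y (vec_of \<omega>)) * (u (vec_of \<omega>) * (f (Z (vec_of \<omega>)) + g (Z (vec_of \<omega>)))))) 0"
        by (simp add: distrib_left)
    qed
  next
    case (mult f g)
    show ?case using mult.IH(2)[OF mult.IH(1)[OF mult.prems]] by (simp add: mult.assoc)
  qed
  show ?thesis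
    using M[OF one, unfolded W_def, rule_format, OF real_polynomial_function.intros(2)[of 1] order_refl] by simp
qed

lemma integral_Z_continuous:
  fixes \<psi> :: "real \<times> (real^'n) \<Rightarrow> real"
  assumes p: "PF p" and orth: "\<And>P s. PF P \<Longrightarrow> s \<ge> 0 \<Longrightarrow> gauss_integral s (\<lambda>x. p x * P (Y x)) = 0"
    and \<psi>: "continuous_on UNIV \<psi>"
  shows "has_bochner_integral lborel_pi (\<lambda>\<omega>. gauss_density 0 \<omega> * (p (vec_of \<omega>) * \<psi> (Z (vec_of \<omega>)))) 0"
proof -
  let ?w = "\<lambda>\<omega>. gauss_density 0 \<omega> * p (vec_of \<omega>)"
  have int: "integrable lborel_pi ?w" by (rule gauss_integral_integrable[OF order_refl p])
  have K: "compact (closure (range Z))" using bounded_Z by (simp add: compact_closure)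
  have meas: "(\<lambda>\<omega>. \<psi> (Z (vec_of \<omega>))) \<in> borel_measurable lborel_pi"
  proof -
    have "continuous_on UNIV (\<lambda>x. \<psi> (Z x))"
      using continuous_on_compose[OF continuous_Z continuous_on_subset[OF \<psi>], of UNIV] by (simp add: o_def)
    then show ?thesis by (rule borel_measurable_continuous_on[OF _ vec_of_measurable])
  qed
  obtain B where B: "\<And>x. \<bar>\<psi> (Z x)\<bar> \<le> B"
  proof -
    have "bounded (\<psi> ` closure (range Z))"
      by (intro compact_imp_bounded compact_continuous_image continuous_on_subset[OF \<psi>] K) auto
    then obtain B where "\<forall>z\<in>\<psi> ` closure (range Z). norm z \<le> B" by (auto simp: bounded_iff)
    then show ?thesis using closure_subset[of "range Z"] by (intro that[of B]) auto
  qed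
  have int': "integrable lborel_pi (\<lambda>\<omega>. ?w \<omega> * \<psi> (Z (vec_of \<omega>)))"
  proof (rule Bochner_Integration.integrable_bound)
    show "integrable lborel_pi (\<lambda>\<omega>. B * ?w \<omega>)" using int by simp
    show "(\<lambda>\<omega>. ?w \<omega> * \<psi> (Z (vec_of \<omega>))) \<in> borel_measurable lborel_pi"
      using borel_measurable_integrable[OF int] meas by (rule borel_measurable_times)
    have "B \<ge> 0" using B[of 0] by linarith
    then have "\<bar>?w \<omega>\<bar> * \<bar>\<psi> (Z (vec_of \<omega>))\<bar> \<le> \<bar>?w \<omega>\<bar> * \<bar>B\<bar>" for \<omega>
      using B[of "vec_of \<omega>"] by (intro mult_left_mono) auto
    then show "AE \<omega> in lborel_pi. norm (?w \<omega> * \<psi> (Z (vec_of \<omega>))) \<le> norm (B * ?w \<omega>)"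
      by (intro AE_I2) (simp add: abs_mult mult_ac)
  qed
  define A where "A = (\<integral>\<omega>. \<bar>?w \<omega>\<bar> \<partial>lborel_pi)"
  define J where "J = (\<integral>\<omega>. ?w \<omega> * \<psi> (Z (vec_of \<omega>)) \<partial>lborel_pi)"
  have bound: "\<bar>J\<bar> \<le> e * A" if e: "e > 0" for e
  proof -
    obtain Q where Q: "PF Q" "\<And>z. z \<in> closure (range Z) \<Longrightarrow> \<bar>\<psi> z - Q z\<bar> < e"
      using Stone_Weierstrass_real_polynomial_function[OF K continuous_on_subset[OF \<psi> subset_UNIV] e] by blast
    have hb: "has_bochner_integral lborel_pi (\<lambda>\<omega>. ?w \<omega> * Q (Z (vec_of \<omega>))) 0"
      using integral_Z_polynomial[OF p orth Q(1)] by (simp add: mult.assoc)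
    have "J = (\<integral>\<omega>. ?w \<omega> * \<psi> (Z (vec_of \<omega>)) - ?w \<omega> * Q (Z (vec_of \<omega>)) \<partial>lborel_pi)"
      using hb int' by (simp add: has_bochner_integral_iff J_def)
    also have "\<bar>\<dots>\<bar> \<le> (\<integral>\<omega>. e * \<bar>?w \<omega>\<bar> \<partial>lborel_pi)"
    proof (rule order_trans[OF integral_abs_bound], rule integral_mono)
      show "integrable lborel_pi (\<lambda>\<omega>. \<bar>?w \<omega> * \<psi> (Z (vec_of \<omega>)) - ?w \<omega> * Q (Z (vec_of \<omega>))\<bar>)"
        using hb int' by (intro integrable_abs Bochner_Integration.integrable_diff) (simp_all add: has_bochner_integral_iff)
      show "integrable lborel_pi (\<lambda>\<omega>. e * \<bar>?w \<omega>\<bar>)" using int by (intro integrable_mult_right integrable_abs)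
      fix \<omega> :: "'n \<Rightarrow> real"
      have "Z (vec_of \<omega>) \<in> closure (range Z)" using closure_subset[of "range Z"] by auto
      then have "\<bar>\<psi> (Z (vec_of \<omega>)) - Q (Z (vec_of \<omega>))\<bar> \<le> e" using Q(2) by (intro less_imp_le) simp
      then have le: "\<bar>?w \<omega>\<bar> * \<bar>\<psi> (Z (vec_of \<omega>)) - Q (Z (vec_of \<omega>))\<bar> \<le> \<bar>?w \<omega>\<bar> * e"
        by (rule mult_left_mono) simp
      have "?w \<omega> * \<psi> (Z (vec_of \<omega>)) - ?w \<omega> * Q (Z (vec_of \<omega>)) = ?w \<omega> * (\<psi> (Z (vec_of \<omega>)) - Q (Z (vec_of \<omega>)))"
        by (rule right_diff_distrib[symmetric])
      then show "\<bar>?w \<omega> * \<psi> (Z (vec_of \<omega>)) - ?w \<omega> * Q (Z (vec_of \<omega>))\<bar> \<le> e * \<bar>?w \<omega>\<bar>"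
        using le by (simp only: abs_mult mult.commute[of e])
    qed
    finally show ?thesis by (simp add: A_def)
  qed
  have "J = 0"
  proof (rule ccontr)
    assume "J \<noteq> 0"
    have "A \<ge> 0" by (simp add: A_def)
    then have "\<bar>J\<bar> / (2 * (A + 1)) * A < \<bar>J\<bar>"
      using \<open>J \<noteq> 0\<close> by (simp add: divide_less_eq)
    moreover have "\<bar>J\<bar> / (2 * (A + 1)) > 0" using \<open>A \<ge> 0\<close> \<open>J \<noteq> 0\<close> by simp
    ultimately show False using bound[of "\<bar>J\<bar> / (2 * (A + 1))"] by linarith
  qed
  then show ?thesis using int' by (simp add: has_bochner_integral_iff J_def mult.assoc)
qed

text \<open>Convergence of \<open>Z\<close> forces convergence of r^2, so a sequence of
  counterexamples is bounded. A limit point of it lies in the fibre of \<open>x0\<close>, where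
  \<open>p\<close> has the value \<open>p x0\<close>.\<close>

lemma fibre_neighbourhood:
  assumes p: "PF p" and inv: "\<And>x. Y x = Y x0 \<Longrightarrow> p x = p x0" and nz: "p x0 \<noteq> 0"
  shows "\<exists>\<delta>>0. \<forall>x. dist (Z x) (Z x0) < \<delta> \<longrightarrow> p x0 * p x > 0"
proof (rule ccontr)
  assume neg: "\<not> ?thesis"
  have "\<exists>x. dist (Z x) (Z x0) < 1 / real (Suc n) \<and> p x0 * p x \<le> 0" for n
    using neg by (auto simp: not_less dest!: spec[of _ "1 / real (Suc n)"])
  then obtain x where x: "\<And>n. dist (Z (x n)) (Z x0) < 1 / real (Suc n)" "\<And>n. p x0 * p (x n) \<le> 0" by metis
  have Z: "(\<lambda>n. Z (x n)) \<longlonglongrightarrow> Z x0"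
  proof (rule metric_LIMSEQ_I)
    fix e :: real assume "e > 0"
    then obtain N where N: "1 / real (Suc N) < e" using nat_approx_posE by blast
    have "dist (Z (x n)) (Z x0) < e" if "n \<ge> N" for n
    proof -
      have "1 / real (Suc n) \<le> 1 / real (Suc N)" using that by (simp add: frac_le)
      then show ?thesis using x(1)[of n] N by linarith
    qed
    then show "\<exists>N. \<forall>n\<ge>N. dist (Z (x n)) (Z x0) < e" by blast
  qed
  have E: "(\<lambda>n. exp (- r2 (x n))) \<longlonglongrightarrow> exp (- r2 x0)"
    using tendsto_fst[OF Z] by (simp add: Z_def)
  have "(\<lambda>n. - ln (exp (- r2 (x n)))) \<longlonglongrightarrow> - ln (exp (- r2 x0))"
    by (intro tendsto_intros E) simp
  then have R: "(\<lambda>n. r2 (x n)) \<longlonglongrightarrow> r2 x0" by simp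
  have "(\<lambda>n. inverse (exp (- r2 (x n))) *\<^sub>R snd (Z (x n))) \<longlonglongrightarrow> inverse (exp (- r2 x0)) *\<^sub>R snd (Z x0)"
    by (intro tendsto_intros E Z) simp
  then have Y: "(\<lambda>n. Y (x n)) \<longlonglongrightarrow> Y x0" by (simp add: Z_def)
  have "(\<lambda>n. norm (x n)) \<longlonglongrightarrow> norm x0"
    using tendsto_real_sqrt[OF R] by (simp add: r2_norm)
  then have "Bseq x" using convergent_imp_Bseq[of "\<lambda>n. norm (x n)"] by (auto simp: convergent_def Bseq_def)
  then have "bounded (range x)" by (simp add: Bseq_eq_bounded)
  then obtain l r where l: "strict_mono r" "(\<lambda>n. x (r n)) \<longlonglongrightarrow> l"
    using bounded_imp_convergent_subsequence[of x] by (auto simp: o_def)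
  have "(\<lambda>n. Y (x (r n))) \<longlonglongrightarrow> Y l"
    using continuous_on_tendsto_compose[OF continuous_Y l(2), of UNIV] by simp
  moreover have "(\<lambda>n. Y (x (r n))) \<longlonglongrightarrow> Y x0" using LIMSEQ_subseq_LIMSEQ[OF Y l(1)] by (simp add: o_def)
  ultimately have "Y l = Y x0" by (rule LIMSEQ_unique)
  then have pl: "p l = p x0" by (rule inv)
  have "(\<lambda>n. p x0 * p (x (r n))) \<longlonglongrightarrow> p x0 * p l"
    using continuous_on_tendsto_compose[OF PF_continuous[OF p] l(2), of UNIV] by (intro tendsto_intros) simp
  then have "p x0 * p l \<le> 0" by (rule LIMSEQ_le_const2) (use x(2) in auto)
  then show False using nz pl by (auto simp: mult_le_0_iff)
qed

text \<open>Test against a bump function of \<open>Z\<close> around \<open>Z x0\<close>: multiplied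
  by \<open>p x0\<close>, the integrand is nonnegative, continuous and positive at
  \<open>x0\<close>, yet its integral is 0.\<close>

lemma orthogonal_invariant_zero:
  assumes p: "PF p" and orth: "\<And>P s. PF P \<Longrightarrow> s \<ge> 0 \<Longrightarrow> gauss_integral s (\<lambda>x. p x * P (Y x)) = 0"
    and inv: "\<And>M x. linear M \<Longrightarrow> bij M \<Longrightarrow> (\<And>j x. I j (M x) = I j x) \<Longrightarrow> p (M x) = p x"
  shows "p x = 0"
proof (rule PF_eq_regular[OF p real_polynomial_function.intros(2)])
  fix x0 assume x0: "det (jac I x0) \<noteq> 0"
  show "p x0 = 0"
  proof (rule ccontr)
    assume nz: "p x0 \<noteq> 0"
    have "p x = p x0" if "Y x = Y x0" for x
      using fibre_orbit[OF that[symmetric] x0] inv by auto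
    then obtain \<delta> where \<delta>: "\<delta> > 0" "\<And>x. dist (Z x) (Z x0) < \<delta> \<Longrightarrow> p x0 * p x > 0"
      using fibre_neighbourhood[OF p _ nz] by blast
    define \<psi> where "\<psi> z = max 0 (\<delta> - dist z (Z x0))" for z
    have \<psi>: "continuous_on UNIV \<psi>" unfolding \<psi>_def by (intro continuous_intros)
    define h where "h x = p x0 * (p x * \<psi> (Z x))" for x
    have hb: "has_bochner_integral lborel_pi (\<lambda>\<omega>. gauss_density 0 \<omega> * h (vec_of \<omega>)) 0"
      using has_bochner_integral_mult_right[OF integral_Z_continuous[OF p orth \<psi>], of "p x0"]
      by (simp add: h_def mult.left_commute)
    have h: "h x \<ge> 0" for x
    proof (cases "dist (Z x) (Z x0) < \<delta>")
      case True
      then show ?thesis using \<delta>(2)[OF True] by (simp add: h_def \<psi>_def mult.assoc[symmetric] del: zero_le_mult_iff)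
    qed (simp add: h_def \<psi>_def max_def)
    have "AE \<omega> in lborel_pi. gauss_density 0 \<omega> * h (vec_of \<omega>) = 0"
      using hb unfolding has_bochner_integral_iff
      by (subst integral_nonneg_eq_0_iff_AE[symmetric]) (auto intro!: mult_nonneg_nonneg h gauss_density_nonneg)
    then have "AE \<omega> in lborel_pi. h (vec_of \<omega>) = 0"
      by (rule eventually_mono) (use gauss_density_pos in \<open>auto simp: less_le\<close>)
    moreover have "continuous_on UNIV h"
      using continuous_on_compose[OF continuous_Z continuous_on_subset[OF \<psi>], of UNIV] PF_continuous[OF p]
      unfolding h_def by (intro continuous_intros) (auto simp: o_def)
    ultimately have "h x0 = 0" by (rule lborel_pi_null_open[rotated])
    then show False using nz \<delta>(1) by (simp add: h_def \<psi>_def)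
  qed
qed

end

section \<open>Invariants are polynomials in the generators\<close>

context gradient_algebra
begin

lemma homogeneous_invariant_in_algebra:
  assumes f: "PF f" "hom k f"
    and inv: "\<And>M x. linear M \<Longrightarrow> bij M \<Longrightarrow> (\<And>j x. I j (M x) = I j x) \<Longrightarrow> f (M x) = f x"
  shows "\<exists>P. PF P \<and> (\<forall>x. f x = P (Y x))"
proof -
  define K where "K = {m. wdeg d m = k}"
  define b where "b m x = monom_fun m (Y x)" for m x
  have K: "finite K" unfolding K_def by (rule finite_wdeg)
  have PFb: "PF (b m)" for m unfolding b_def by (rule PF_Y[OF PF_monom_fun])
  obtain c where c: "\<forall>j\<in>K. gauss_integral 0 (\<lambda>x. (f x - (\<Sum>m\<in>K. c m * b m x)) * b j x) = 0"
    using gauss_integral_projection[of K b, OF K PFb f(1)] by blast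
  define p where "p x = f x - (\<Sum>m\<in>K. c m * b m x)" for x
  have p: "PF p" unfolding p_def
    by (intro real_polynomial_function_diff real_polynomial_function_sum real_polynomial_function.intros(2,4) f PFb K)
  have "b m (t *\<^sub>R x) = t ^ k * b m x" if "m \<in> K" for m t x
    using homD[OF hom_monom_Y[of m], of t x] that by (simp add: b_def K_def)
  then have homp: "hom k p"
    by (simp add: hom_def p_def homD[OF f(2)] sum_distrib_left right_diff_distrib mult.left_commute)
  have "p x = 0" for x
  proof (rule orthogonal_invariant_zero[OF p])
    fix P :: "real^'n \<Rightarrow> real" and s :: real assume P: "PF P" "0 \<le> s"
    show "gauss_integral s (\<lambda>x. p x * P (Y x)) = 0"
      by (rule orthogonal_algebra[OF p homp _ P]) (use c in \<open>simp add: p_def K_def b_def\<close>)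
  next
    fix M :: "real^'n \<Rightarrow> real^'n" and x
    assume M: "linear M" "bij M" "\<And>j x. I j (M x) = I j x"
    then have "Y (M x) = Y x" by (simp add: Y_def)
    then show "p (M x) = p x" using inv[OF M] by (simp add: p_def b_def)
  qed
  then have "f x = (\<Sum>m\<in>K. c m * monom_fun m (Y x))" for x by (simp add: p_def b_def)
  moreover have "PF (\<lambda>y. \<Sum>m\<in>K. c m * monom_fun m y)"
    by (intro real_polynomial_function_sum real_polynomial_function.intros(2,4) PF_monom_fun K)
  ultimately show ?thesis by blast
qed

theorem invariant_in_algebra:
  assumes f: "PF f"
    and inv: "\<And>M x. linear M \<Longrightarrow> bij M \<Longrightarrow> (\<And>j x. I j (M x) = I j x) \<Longrightarrow> f (M x) = f x"
  shows "\<exists>P. PF P \<and> (\<forall>x. f x = P (Y x))"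
proof -
  obtain F N where F: "\<And>k. PF (F k)" "\<And>k. hom k (F k)" "\<And>x. f x = (\<Sum>k\<le>N. F k x)"
    using PF_homogeneous_components[OF f] by blast
  \<comment> \<open>A linear \<open>M\<close> commutes with dilations, so comparing powers of
    \<open>t\<close> along a ray makes each homogeneous component invariant.\<close>
  have "F k (M x) = F k x" if M: "linear M" "bij M" "\<And>j x. I j (M x) = I j x" and k: "k \<le> N" for k M x
  proof -
    have "poly (\<Sum>k\<le>N. monom (F k (M x)) k) t = poly (\<Sum>k\<le>N. monom (F k x) k) t" for t
      using inv[OF M, of "t *\<^sub>R x"] linear_cmul[OF M(1), of t x]
      by (simp add: F(3) homD[OF F(2)] poly_sum poly_monom mult.commute)
    then have "(\<Sum>k\<le>N. monom (F k (M x)) k) = (\<Sum>k\<le>N. monom (F k x) k)"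
      using poly_eq_poly_eq_iff by blast
    then have "coeff (\<Sum>k\<le>N. monom (F k (M x)) k) k = coeff (\<Sum>k\<le>N. monom (F k x) k) k" by simp
    then show ?thesis using k by (simp add: coeff_sum)
  qed
  then have "\<exists>P. PF P \<and> (\<forall>x. F k x = P (Y x))" if "k \<le> N" for k
    by (intro homogeneous_invariant_in_algebra[OF F(1,2)]) (use that in blast)
  then have "\<forall>k. \<exists>P. k \<le> N \<longrightarrow> PF P \<and> (\<forall>x. F k x = P (Y x))" by blast
  from choice[OF this] obtain P where P: "\<And>k. k \<le> N \<Longrightarrow> PF (P k)" "\<And>k x. k \<le> N \<Longrightarrow> F k x = P k (Y x)"
    by blast
  have "PF (\<lambda>y. \<Sum>k\<le>N. P k y)" by (rule real_polynomial_function_sum) (auto intro: P)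
  moreover have "f x = (\<Sum>k\<le>N. P k (Y x))" for x unfolding F(3) by (intro sum.cong) (auto simp: P(2))
  ultimately show ?thesis by blast
qed

end

theorem theorem1:
  fixes I :: "'n::finite \<Rightarrow> 'n rpoly"
  assumes "algebraically_independent I"
    and "\<And>j. homogeneous_poly (I j)"
    and "\<And>i j. \<exists>g :: 'n rpoly.
           (\<Sum>k\<in>UNIV. poly_partial k (I i) * poly_partial k (I j)) = poly_subst I g"
  shows "invariant_algebra (symmetry_group I) = generated_subalgebra I
         \<and> algebraically_independent I"
proof -
  have "\<forall>j. \<exists>d. hom d (poly_fun (I j))" using homogeneous_poly_hom assms(2) by blast
  from choice[OF this] obtain d where d: "\<And>j. hom (d j) (poly_fun (I j))" by blast
  have "\<forall>i. \<exists>g. \<forall>j. (\<Sum>k\<in>UNIV. poly_partial k (I i) * poly_partial k (I j)) = poly_subst I (g j)"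
    using assms(3) by (intro allI choice)
  from choice[OF this] obtain g where g: "\<And>i j. (\<Sum>k\<in>UNIV. poly_partial k (I i) * poly_partial k (I j)) = poly_subst I (g i j)"
    by blast
  interpret G: gradient_algebra "\<lambda>j. poly_fun (I j)" "\<lambda>i j. poly_fun (g i j)" d
  proof
    fix P y assume P: "PF P" and 0: "\<And>x. P (\<chi> j. poly_fun (I j) x) = 0"
    obtain q where q: "P = poly_fun q" using PF_imp_poly_fun[OF P] by blast
    have "poly_subst I q = 0"
      by (rule poly_fun_eq_0_imp) (use 0 in \<open>simp add: poly_fun_subst q fun_eq_iff\<close>)
    then have "q = 0" using assms(1) by (simp add: algebraically_independent_def)
    then show "P y = 0" by (simp add: q poly_fun_def)
  next
    fix i j x
    have "poly_fun (\<Sum>k\<in>UNIV. poly_partial k (I i) * poly_partial k (I j)) x = poly_fun (poly_subst I (g i j)) x"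
      by (simp only: g)
    then show "(\<Sum>k\<in>UNIV. pd k (poly_fun (I i)) x * pd k (poly_fun (I j)) x) = poly_fun (g i j) (\<chi> j. poly_fun (I j) x)"
      by (simp add: poly_fun_subst poly_fun_sum poly_fun_mult poly_fun_partial)
  qed (auto simp: PF_poly_fun d)
  have "invariant_algebra (symmetry_group I) = range (poly_subst I)"
  proof (intro set_eqI iffI)
    fix p assume p: "p \<in> invariant_algebra (symmetry_group I)"
    have "\<exists>P. PF P \<and> (\<forall>x. poly_fun p x = P (G.Y x))"
    proof (rule G.invariant_in_algebra[OF PF_poly_fun])
      fix M :: "real^'n \<Rightarrow> real^'n" and x
      assume "linear M" "bij M" "\<And>j x. poly_fun (I j) (M x) = poly_fun (I j) x"
      then have "M \<in> symmetry_group I" by (simp add: symmetry_group_def fun_eq_iff)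
      then have "poly_fun p \<circ> M = poly_fun p" using p by (simp add: invariant_algebra_def)
      then show "poly_fun p (M x) = poly_fun p x" by (simp add: fun_eq_iff)
    qed
    then obtain P where P: "PF P" "\<And>x. poly_fun p x = P (G.Y x)" by blast
    obtain q where q: "P = poly_fun q" using PF_imp_poly_fun[OF P(1)] by blast
    have "poly_fun p x = poly_fun (poly_subst I q) x" for x
      by (simp add: P(2) q poly_fun_subst G.Y_def)
    then have "p = poly_subst I q" by (intro poly_fun_inj ext)
    then show "p \<in> range (poly_subst I)" by blast
  next
    fix p assume "p \<in> range (poly_subst I)"
    then obtain q where q: "p = poly_subst I q" by blast
    have "poly_fun p (M x) = poly_fun p x" if "M \<in> symmetry_group I" for M x
      using that by (simp add: q poly_fun_subst symmetry_group_def fun_eq_iff)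
    then show "p \<in> invariant_algebra (symmetry_group I)" by (simp add: invariant_algebra_def fun_eq_iff)
  qed
  then show ?thesis using assms(1) by (simp add: generated_subalgebra_def)
qed

end
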